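(* Let $n=3$ for the Vlasov-Poisson (V-P) system and $n=2$ for the Vlasov-Yukawa (V-Y) system, and let $N\ge2n+3$. There are constants $C>0$ and $\epsilon_0>0$, depending only on $n$ and $N$ (and on the constant $C_0$ in the bootstrap assumptions), such that the following holds for $0<\epsilon\le\epsilon_0$. Let $(f,\phi)$ be a sufficiently smooth solution of the system on $[0,T]$ satisfying the bootstrap assumptions (B1)–(B4) stated in the context. Then for all multi-indices $\gamma,\alpha$ with $|\gamma|\le N$, $|\alpha|\le N-n$, and all $t\in[0,T]$, $$\|\nabla_xZ^\gamma(\phi)\,Y^\alpha(f)\|_{L^1(\mathbb{R}^n_x\times\mathbb{R}^n_v)}\le C\sum_{|\beta|\le|\gamma|}\frac{\epsilon}{(1+t)^2}\|\rho(Z^\beta f)\|_{L^1(\mathbb{R}^n_x)} .$$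
   Context: Systems. Fix $\mu\in\{1,-1\}$. Both consist of $\partial_tf+v\cdot\nabla_xf+\mu\nabla_x\phi\cdot\nabla_vf=0$, $x,v\in\mathbb{R}^n$, coupled with $\triangle\phi=\rho(f)$ (V-P) or $\triangle\phi-\phi=\rho(f)$ (V-Y), where $\rho(g)(t,x)=\int_{\mathbb{R}^n}g(t,x,v)\,dv$. The field is $\phi=G*_x\rho(f)$ with $G_0(x)=c_n|x|^{-(n-2)}$ (V-P), $G_1(x)=c'_n|x|^{-(n/2-1)}K_{n/2-1}(|x|)$ (V-Y), $K_\nu(r)=\int_0^\infty e^{-r\cosh\lambda}\cosh(\nu\lambda)\,d\lambda$, the Green's functions of $\triangle$ and $\triangle-\mathrm{Id}$. Write $T_\phi(g)=\partial_tg+\sum_iv^i\partial_{x^i}g+\mu\sum_i\partial_{x^i}\phi\,\partial_{v^i}g$. Vector fields. $Z^1,\dots,Z^M$, $M=2n+n(n-1)/2+1$, is an ordering of the operators $\partial_{x^i}$, $t\partial_{x^i}+\partial_{v^i}$ ($1\le i\le n$), $\Omega^x_{ij}+\Omega^v_{ij}$ ($1\le i<j\le n$), $S^x+S^v$, where $\Omega^x_{ij}=x^i\partial_{x^j}-x^j\partial_{x^i}$, $\Omega^v_{ij}=v^i\partial_{v^j}-v^j\partial_{v^i}$, $S^x=\sum_ix^i\partial_{x^i}$, $S^v=\sum_iv^i\partial_{v^i}$. On functions of $(t,x)$ only, such as $\phi$, $Z^i$ acts through its $x$-part ($\partial_{x^i}$, $t\partial_{x^i}$, $\Omega^x_{ij}$,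 $S^x$). Modified fields: $Y^i:=Z^i-\sum_{k=1}^n\varphi^i_k(t,x,v)\partial_{x^k}$, where $\varphi^i_k\equiv0$ if $Z^i$ is a translation $\partial_{x^j}$, and otherwise $\varphi_k^i$ solves $T_\phi(\varphi^i_k)=\mu t\,\partial_{x^k}(Z^i\phi+c_i\phi)$, $\varphi^i_k(0,x,v)=0$, with $c_i=-2$ if $Z^i=S^x+S^v$ and $c_i=0$ otherwise. For $\alpha=(\alpha^1,\dots,\alpha^k)$, $\alpha^j\in\{1,\dots,M\}$, $|\alpha|=k$, set $Z^\alpha=Z^{\alpha^1}\cdots Z^{\alpha^k}$, $Y^\alpha=Y^{\alpha^1}\cdots Y^{\alpha^k}$ (identity if $k=0$). $\mathcal{M}$ is the set of all functions $\varphi^i_k$, and $\mathcal{E}_N[f(t)]=\sum_{|\alpha|\le N}\|Y^\alpha f(t)\|_{L^1(\mathbb{R}^n_x\times\mathbb{R}^n_v)}$. Bootstrap assumptions. $\mathcal{E}_N[f(0)]\le\epsilon$ and, for all $t\in[0,T]$, with a fixed constant $C_0$ depending only on $n,N$: (B1) $\mathcal{E}_N[f(t)]\le2\epsilon$; (B2) $|Y^\alpha\varphi(t,x,v)|\le C_0\epsilon^{1/2}(1+\log(1+t))$ for all $(x,v)$, $|\alpha|\le N-n-2$, $\varphi\in\mathcal{M}$; (B3) $|Y^\alpha\nabla_x\varphi(t,x,v)|\le C_0\epsilon^{1/2}$ for all $(x,v)$, $|\alpha|\le N-n-3$, $\varphi\in\mathcal{M}$; (B4) $|\nabla_xZ^\alpha\phi(t,x)|\le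 C_0\epsilon^{1/2}(1+t)^{-2}$ for all $x$, $|\alpha|\le N-n-1$. All norms in the claim are at fixed time $t$. *)

theory Defs
  imports "HOL-Analysis.Analysis"
begin

text \<open>
  Dimension: \<open>n = CARD('n)\<close>.  The linear order on the finite index type \<open>'n\<close> only serves to
  select the pairs \<open>i < j\<close> for the rotations.  Functions of \<open>(t, x, v)\<close> have type \<open>'n kin\<close>,
  functions of \<open>(t, x)\<close> have type \<open>'n fld\<close>; only times \<open>t \<in> {0..T}\<close> are relevant.
\<close>

type_synonym 'n kin = "real \<Rightarrow> real^'n \<Rightarrow> real^'n \<Rightarrow> real"
type_synonym 'n fld = "real \<Rightarrow> real^'n \<Rightarrow> real"

datatype vlasov_system = Vlasov_Poisson | Vlasov_Yukawa


section \<open>Partial derivatives and regularity\<close>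

definition pd :: "'n::finite \<Rightarrow> (real^'n \<Rightarrow> real) \<Rightarrow> real^'n \<Rightarrow> real" where
  "pd i h x = deriv (\<lambda>s. h (x + s *\<^sub>R axis i 1)) 0"

definition has_pd :: "'n::finite \<Rightarrow> (real^'n \<Rightarrow> real) \<Rightarrow> real^'n \<Rightarrow> bool" where
  "has_pd i h x \<longleftrightarrow> (\<lambda>s. h (x + s *\<^sub>R axis i 1)) field_differentiable at 0"

definition dx :: "'n::finite \<Rightarrow> 'n kin \<Rightarrow> 'n kin" where
  "dx i g = (\<lambda>t x v. pd i (\<lambda>y. g t y v) x)"

definition dv :: "'n::finite \<Rightarrow> 'n kin \<Rightarrow> 'n kin" where
  "dv i g = (\<lambda>t x v. pd i (\<lambda>w. g t x w) v)"

definition dX :: "'n::finite \<Rightarrow> 'n fld \<Rightarrow> 'n fld" where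
  "dX i h = (\<lambda>t x. pd i (h t) x)"

text \<open>One-sided at the end points of \<open>[0, T]\<close>.\<close>
definition dt :: "real \<Rightarrow> 'n::finite kin \<Rightarrow> 'n kin" where
  "dt T g = (\<lambda>t x v. vector_derivative (\<lambda>s. g s x v) (at t within {0..T}))"

definition grad :: "'n::finite fld \<Rightarrow> real \<Rightarrow> real^'n \<Rightarrow> real^'n" where
  "grad h t x = (\<chi> i. dX i h t x)"

definition laplacian :: "'n::finite fld \<Rightarrow> 'n fld" where
  "laplacian h = (\<lambda>t x. \<Sum>i\<in>UNIV. dX i (dX i h) t x)"

text \<open>All partial derivatives in \<open>(x, v)\<close> of order at most \<open>k\<close> exist and are
  jointly continuous on \<open>[0, T] \<times> \<real>\<^sup>n \<times> \<real>\<^sup>n\<close>.\<close>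
primrec Ck :: "nat \<Rightarrow> real \<Rightarrow> 'n::finite kin \<Rightarrow> bool" where
  "Ck 0 T g \<longleftrightarrow> continuous_on ({0..T} \<times> UNIV) (\<lambda>(t, x, v). g t x v)"
| "Ck (Suc k) T g \<longleftrightarrow>
     continuous_on ({0..T} \<times> UNIV) (\<lambda>(t, x, v). g t x v) \<and>
     (\<forall>t\<in>{0..T}. \<forall>x v i. has_pd i (\<lambda>y. g t y v) x \<and> has_pd i (\<lambda>w. g t x w) v) \<and>
     (\<forall>i. Ck k T (dx i g) \<and> Ck k T (dv i g))"

definition time_diff :: "real \<Rightarrow> 'n::finite kin \<Rightarrow> bool" where
  "time_diff T g \<longleftrightarrow> (\<forall>t\<in>{0..T}. \<forall>x v. (\<lambda>s. g s x v) differentiable (at t within {0..T}))"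


section \<open>Green's functions\<close>

definition besselK :: "real \<Rightarrow> real \<Rightarrow> real" where
  "besselK \<nu> r = (LBINT l:{0..}. exp (- r * cosh l) * cosh (\<nu> * l))"

text \<open>
  The normalising constants are those for which \<open>green\<close> is the fundamental solution of
  \<open>\<Delta>\<close> (for \<open>n \<ge> 3\<close>) respectively \<open>\<Delta> - Id\<close>; for instance \<open>- 1 / (4 \<pi> |x|)\<close> for
  Vlasov-Poisson with \<open>n = 3\<close> and \<open>- K\<^sub>0(|x|) / (2 \<pi>)\<close> for Vlasov-Yukawa with \<open>n = 2\<close>.
  The value at \<open>x = 0\<close> is irrelevant.
\<close>
definition green :: "vlasov_system \<Rightarrow> real^'n::finite \<Rightarrow> real" where
  "green sys x =
     (let n = real CARD('n) in
      case sys of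
        Vlasov_Poisson \<Rightarrow>
          - 1 / (n * (n - 2) * unit_ball_vol n) * norm x powr (- (n - 2))
      | Vlasov_Yukawa \<Rightarrow>
          - ((2 * pi) powr (- n / 2)) * norm x powr (- (n / 2 - 1)) * besselK (n / 2 - 1) (norm x))"


section \<open>Vector fields\<close>

text \<open>
  The vector fields are indexed by the operators themselves instead of by \<open>1, \<dots>, M\<close>:
  \<open>Trans i\<close> is \<open>\<partial>\<^sub>x\<^sub>i\<close>, \<open>Gal i\<close> is \<open>t \<partial>\<^sub>x\<^sub>i + \<partial>\<^sub>v\<^sub>i\<close>, \<open>Rot i j\<close> is
  \<open>\<Omega>\<^sup>x + \<Omega>\<^sup>v\<close> (used for \<open>i < j\<close> only, see \<open>vfs\<close>) and \<open>Scal\<close> is \<open>S\<^sup>x + S\<^sup>v\<close>.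
\<close>
datatype 'n vf = Trans 'n | Gal 'n | Rot 'n 'n | Scal

definition vfs :: "'n::{finite,linorder} vf set" where
  "vfs = range Trans \<union> range Gal \<union> {Rot i j | i j. i < j} \<union> {Scal}"

definition multi_indices :: "nat \<Rightarrow> 'n::{finite,linorder} vf list set" where
  "multi_indices k = {\<alpha>. set \<alpha> \<subseteq> vfs \<and> length \<alpha> \<le> k}"

fun Z :: "'n::finite vf \<Rightarrow> 'n kin \<Rightarrow> 'n kin" where
  "Z (Trans i) g = dx i g"
| "Z (Gal i) g = (\<lambda>t x v. t * dx i g t x v + dv i g t x v)"
| "Z (Rot i j) g = (\<lambda>t x v. (x $ i * dx j g t x v - x $ j * dx i g t x v)
                          + (v $ i * dv j g t x v - v $ j * dv i g t x v))"
| "Z Scal g = (\<lambda>t x v. (\<Sum>i\<in>UNIV. x $ i * dx i g t x v) + (\<Sum>i\<in>UNIV. v $ i * dv i g t x v))"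

text \<open>The \<open>x\<close>-parts, acting on functions of \<open>(t, x)\<close>.\<close>
fun ZX :: "'n::finite vf \<Rightarrow> 'n fld \<Rightarrow> 'n fld" where
  "ZX (Trans i) h = dX i h"
| "ZX (Gal i) h = (\<lambda>t x. t * dX i h t x)"
| "ZX (Rot i j) h = (\<lambda>t x. x $ i * dX j h t x - x $ j * dX i h t x)"
| "ZX Scal h = (\<lambda>t x. \<Sum>i\<in>UNIV. x $ i * dX i h t x)"

text \<open>The coefficient functions \<open>\<phi>\<^sup>a\<^sub>k\<close> are given by a family \<open>co a k\<close>.\<close>
definition Y :: "('n vf \<Rightarrow> 'n \<Rightarrow> 'n kin) \<Rightarrow> 'n::finite vf \<Rightarrow> 'n kin \<Rightarrow> 'n kin" where
  "Y co a g = (\<lambda>t x v. Z a g t x v - (\<Sum>k\<in>UNIV. co a k t x v * dx k g t x v))"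

definition Zs :: "'n::finite vf list \<Rightarrow> 'n kin \<Rightarrow> 'n kin" where
  "Zs \<alpha> g = foldr Z \<alpha> g"

definition ZXs :: "'n::finite vf list \<Rightarrow> 'n fld \<Rightarrow> 'n fld" where
  "ZXs \<alpha> h = foldr ZX \<alpha> h"

definition Ys :: "('n vf \<Rightarrow> 'n \<Rightarrow> 'n kin) \<Rightarrow> 'n::finite vf list \<Rightarrow> 'n kin \<Rightarrow> 'n kin" where
  "Ys co \<alpha> g = foldr (Y co) \<alpha> g"

fun cc :: "'n vf \<Rightarrow> real" where
  "cc Scal = - 2"
| "cc _ = 0"


section \<open>Systems, modified fields, norms\<close>

definition rho :: "'n::finite kin \<Rightarrow> 'n fld" where
  "rho g = (\<lambda>t x. LINT v|lborel. g t x v)"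

definition transport :: "real \<Rightarrow> real \<Rightarrow> 'n::finite fld \<Rightarrow> 'n kin \<Rightarrow> 'n kin" where
  "transport T \<mu> \<phi> g = (\<lambda>t x v. dt T g t x v + (\<Sum>i\<in>UNIV. v $ i * dx i g t x v)
                              + \<mu> * (\<Sum>i\<in>UNIV. dX i \<phi> t x * dv i g t x v))"

text \<open>
  Classical solutions on \<open>[0, T]\<close>, with the regularity needed for all derivatives of order at
  most \<open>N\<close> of \<open>f\<close> and \<open>\<nabla>\<^sub>x\<phi>\<close> to exist classically.  The last conjunct makes the densities
  \<open>\<rho>(Z\<^sup>\<beta>f)\<close>, \<open>|\<beta>| \<le> N\<close>, well defined as locally integrable functions of \<open>x\<close>.
\<close>
definition smooth_solution ::
  "vlasov_system \<Rightarrow> nat \<Rightarrow> real \<Rightarrow> real \<Rightarrow> 'n::{finite,linorder} kin \<Rightarrow> 'n fld \<Rightarrow> bool" where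
  "smooth_solution sys N \<mu> T f \<phi> \<longleftrightarrow>
     Ck N T f \<and> time_diff T f \<and> Ck (N + 1) T (\<lambda>t x v. \<phi> t x) \<and>
     (\<forall>t\<in>{0..T}. \<forall>x v. transport T \<mu> \<phi> f t x v = 0) \<and>
     (\<forall>t\<in>{0..T}. \<forall>x. integrable lborel (f t x)) \<and>
     (\<forall>t\<in>{0..T}. \<forall>x.
        (case sys of
           Vlasov_Poisson \<Rightarrow> laplacian \<phi> t x = rho f t x
         | Vlasov_Yukawa \<Rightarrow> laplacian \<phi> t x - \<phi> t x = rho f t x)) \<and>
     (\<forall>t\<in>{0..T}. \<forall>x.
        has_bochner_integral lborel (\<lambda>y. green sys (x - y) * rho f t y) (\<phi> t x)) \<and>
     (\<forall>\<beta>\<in>multi_indices N. \<forall>t\<in>{0..T}. \<forall>R.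
        set_integrable lborel (cball 0 R \<times> UNIV) (\<lambda>(x, v). Zs \<beta> f t x v))"

definition modified_coefficients ::
  "nat \<Rightarrow> real \<Rightarrow> real \<Rightarrow> 'n::{finite,linorder} fld \<Rightarrow> ('n vf \<Rightarrow> 'n \<Rightarrow> 'n kin) \<Rightarrow> bool" where
  "modified_coefficients N \<mu> T \<phi> co \<longleftrightarrow>
     (\<forall>i k. \<forall>t\<in>{0..T}. \<forall>x v. co (Trans i) k t x v = 0) \<and>
     (\<forall>a\<in>vfs - range Trans. \<forall>k.
        Ck (N - 1) T (co a k) \<and> time_diff T (co a k) \<and>
        (\<forall>t\<in>{0..T}. \<forall>x v. transport T \<mu> \<phi> (co a k) t x v
            = \<mu> * t * dX k (\<lambda>t x. ZX a \<phi> t x + cc a * \<phi> t x) t x) \<and>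
        (\<forall>x v. co a k 0 x v = 0))"

definition coefficient_set :: "('n vf \<Rightarrow> 'n \<Rightarrow> 'n kin) \<Rightarrow> 'n::{finite,linorder} kin set" where
  "coefficient_set co = {co a k | a k. a \<in> vfs}"

definition L1_x :: "(real^'n::finite \<Rightarrow> real) \<Rightarrow> ennreal" where
  "L1_x h = (\<integral>\<^sup>+ x. ennreal \<bar>h x\<bar> \<partial>lborel)"

definition L1_xv :: "(real^'n::finite \<Rightarrow> real^'n \<Rightarrow> real) \<Rightarrow> ennreal" where
  "L1_xv h = (\<integral>\<^sup>+ (x, v). ennreal \<bar>h x v\<bar> \<partial>lborel)"

definition energy ::
  "nat \<Rightarrow> ('n vf \<Rightarrow> 'n \<Rightarrow> 'n kin) \<Rightarrow> 'n::{finite,linorder} kin \<Rightarrow> real \<Rightarrow> ennreal" where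
  "energy N co f t = (\<Sum>\<alpha>\<in>multi_indices N. L1_xv (Ys co \<alpha> f t))"

definition bootstrap ::
  "nat \<Rightarrow> real \<Rightarrow> real \<Rightarrow> real \<Rightarrow> 'n::{finite,linorder} kin \<Rightarrow> 'n fld
     \<Rightarrow> ('n vf \<Rightarrow> 'n \<Rightarrow> 'n kin) \<Rightarrow> bool" where
  "bootstrap N C0 \<epsilon> T f \<phi> co \<longleftrightarrow>
     energy N co f 0 \<le> ennreal \<epsilon> \<and>
     (\<forall>t\<in>{0..T}.
        energy N co f t \<le> ennreal (2 * \<epsilon>) \<and>
        (\<forall>\<alpha>\<in>multi_indices (N - CARD('n) - 2). \<forall>g\<in>coefficient_set co. \<forall>x v.
           \<bar>Ys co \<alpha> g t x v\<bar> \<le> C0 * sqrt \<epsilon> * (1 + ln (1 + t))) \<and>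
        (\<forall>\<alpha>\<in>multi_indices (N - CARD('n) - 3). \<forall>g\<in>coefficient_set co. \<forall>x v.
           norm (\<chi> j. Ys co \<alpha> (dx j g) t x v) \<le> C0 * sqrt \<epsilon>) \<and>
        (\<forall>\<alpha>\<in>multi_indices (N - CARD('n) - 1). \<forall>x.
           norm (grad (ZXs \<alpha> \<phi>) t x) \<le> C0 * sqrt \<epsilon> / (1 + t)\<^sup>2))"

lemma finite_vfs: "finite (vfs :: 'n::{finite,linorder} vf set)"
proof -
  have "{Rot i j | i j :: 'n. i < j} \<subseteq> (\<lambda>(i, j). Rot i j) ` UNIV" by auto
  then have "finite {Rot i j | i j :: 'n. i < j}" by (rule finite_subset) simp
  then show ?thesis by (simp add: vfs_def)
qed

lemma finite_multi_indices: "finite (multi_indices k)"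
  unfolding multi_indices_def by (rule finite_lists_length_le[OF finite_vfs])

end

theory Submission
  imports Defs
begin

text \<open>
  Write \<open>s = 1 + t\<close>.  The estimate splits into two independent halves.

  First, \<open>\<integral>\<integral> w(x - y) \<bar>Y\<^sup>\<alpha>f\<bar> dx dv \<le> C \<epsilon> / s\<^sup>2\<close> uniformly in \<open>y\<close>, where \<open>w(z) = \<bar>z\<bar>\<^sup>-\<^sup>2\<close> for Vlasov-Poisson and
  \<open>w(z) = \<bar>z\<bar>\<^sup>-\<^sup>1 (1 + \<bar>z\<bar>)\<^sup>-\<^sup>2\<close> for Vlasov-Yukawa.  This is a Hardy type inequality: \<open>w\<close> is bounded by the divergence of
  a field of size \<open>\<bar>z\<bar>\<^sup>-\<^sup>1\<close>, which in turn is bounded by the divergence of a bounded field, and each integration by parts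
  gains \<open>1 / s\<close> because \<open>s \<partial>\<^sub>x\<close> differs from modified fields only by a \<open>v\<close>-derivative and by the small term
  \<open>\<Sum>\<^sub>k \<phi>\<^sub>k \<partial>\<^sub>x\<^sub>k\<close>, both of which are integrated by parts.  No Sobolev inequality is needed.

  Second, \<open>\<bar>\<nabla>Z\<^sup>\<gamma>\<phi>\<bar> \<le> C \<Sum>\<^sub>\<beta> w * \<bar>\<rho>(Z\<^sup>\<beta>f)\<bar>\<close> in the sense of distributions.  Green's function is a superposition of Gaussians
  \<open>exp (- b \<bar>x - y\<bar>\<^sup>2)\<close>, and each field acting on \<open>x\<close> can be moved to \<open>y\<close>, and from there to \<open>f\<close>, up to radial kernels
  of the same type.  Mollifying and applying Fatou's lemma combines the two halves.
\<close>

section \<open>Directional derivatives on Euclidean spaces\<close>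

definition has_dd :: "'a::euclidean_space \<Rightarrow> ('a \<Rightarrow> real) \<Rightarrow> real
    \<Rightarrow> 'a \<Rightarrow> bool" where
  "has_dd b h D x \<longleftrightarrow> ((\<lambda>s. h (x + s *\<^sub>R b)) has_real_derivative D) (at 0)"

definition dd :: "'a::euclidean_space \<Rightarrow> ('a \<Rightarrow> real) \<Rightarrow> 'a \<Rightarrow>
    real" where
  "dd b h x = deriv (\<lambda>s. h (x + s *\<^sub>R b)) 0"

lemma dd_eqI: "has_dd b h D x \<Longrightarrow> dd b h x = D"
  by (simp add: has_dd_def dd_def DERIV_imp_deriv)

lemma has_dd_const: "has_dd b (\<lambda>x. c) 0 x"
  by (simp add: has_dd_def)

lemma has_dd_add: "has_dd b f D x \<Longrightarrow> has_dd b g E x \<Longrightarrow> has_dd b (\<lambda>x.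
    f x + g x) (D + E) x"
  unfolding has_dd_def by (rule DERIV_add)

lemma has_dd_diff: "has_dd b f D x \<Longrightarrow> has_dd b g E x \<Longrightarrow> has_dd b (\<lambda>x.
    f x - g x) (D - E) x"
  unfolding has_dd_def by (rule DERIV_diff)

lemma has_dd_mult:
  "has_dd b f D x \<Longrightarrow> has_dd b g E x \<Longrightarrow> has_dd b (\<lambda>x. f x * g x) (D *
      g x + f x * E) x"
  unfolding has_dd_def by (drule (1) DERIV_mult) (simp add: mult.commute add.commute)

lemma has_dd_cmult: "has_dd b f D x \<Longrightarrow> has_dd b (\<lambda>x. c * f x) (c * D) x"
  using has_dd_mult[OF has_dd_const] by fastforce

lemma has_dd_sum:
  "(\<And>i. i \<in> I \<Longrightarrow> has_dd b (f i) (D i) x) \<Longrightarrow> has_dd b (\<lambda>x.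
      \<Sum>i\<in>I. f i x) (\<Sum>i\<in>I. D i) x"
  unfolding has_dd_def by (rule DERIV_sum) auto

lemma has_dd_inner: "has_dd b (\<lambda>x. x \<bullet> c) (b \<bullet> c) x"
  unfolding has_dd_def by (auto simp: inner_add_left intro!: derivative_eq_intros)

lemma has_dd_inner_self: "has_dd b (\<lambda>x. x \<bullet> x) (2 * (x \<bullet> b)) x"
  unfolding has_dd_def
  by (auto simp: inner_add_left inner_add_right inner_commute intro!: derivative_eq_intros)

lemma has_dd_chain:
  assumes "(q has_real_derivative Q) (at (h x))" "has_dd b h D x"
  shows "has_dd b (\<lambda>x. q (h x)) (Q * D) x"
  using DERIV_chain2[of q Q "\<lambda>s. h (x + s *\<^sub>R b)" 0 D UNIV] assms by (simp add: has_dd_def)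

lemma has_dd_diff_arg: "has_dd b h D (x - y) \<Longrightarrow> has_dd b (\<lambda>x. h (x - y)) D x"
  by (simp add: has_dd_def algebra_simps)

lemma has_dd_diff_arg2: "has_dd b h D (x - y) \<Longrightarrow> has_dd b (\<lambda>y. h (x - y)) (- D) y"
  unfolding has_dd_def
proof -
  assume "((\<lambda>s. h (x - y + s *\<^sub>R b)) has_real_derivative D) (at 0)"
  then have "((\<lambda>s. h (x - y + s *\<^sub>R b)) has_real_derivative D) (at (- 0))" by simp
  then have "((\<lambda>s. h (x - y + (- s) *\<^sub>R b)) has_real_derivative - D) (at 0)"
    by (subst (asm) DERIV_mirror) simp
  then show "((\<lambda>s. h (x - (y + s *\<^sub>R b))) has_real_derivative - D) (at 0)"
    by (simp add: algebra_simps)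
qed

lemma has_dd_fst: "has_dd b h D (fst z) \<Longrightarrow> has_dd (b, c) (\<lambda>z. h (fst z)) D z"
  by (simp add: has_dd_def)

lemma has_dd_snd: "has_dd b h D (snd z) \<Longrightarrow> has_dd (c, b) (\<lambda>z. h (snd z)) D z"
  by (simp add: has_dd_def)

lemma has_dd_fst0: "has_dd (0, c) (\<lambda>z. h (fst z)) 0 z"
  by (simp add: has_dd_def)

lemma has_dd_snd0: "has_dd (c, 0) (\<lambda>z. h (snd z)) 0 z"
  by (simp add: has_dd_def)

lemma has_dd_shift:
  assumes "has_dd b h D (x + s *\<^sub>R b)"
  shows "((\<lambda>s. h (x + s *\<^sub>R b)) has_real_derivative D) (at s)"
proof -
  have "((\<lambda>r. h (x + (r + s) *\<^sub>R b)) has_real_derivative D) (at 0)"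
    using assms by (simp add: has_dd_def algebra_simps)
  then show ?thesis
    using DERIV_shift[of "\<lambda>s. h (x + s *\<^sub>R b)" D 0 s] by simp
qed

primrec CE :: "nat \<Rightarrow> ('a::euclidean_space \<Rightarrow> real) \<Rightarrow> bool" where
  "CE 0 h \<longleftrightarrow> continuous_on UNIV h"
| "CE (Suc k) h \<longleftrightarrow> continuous_on UNIV h \<and>
     (\<forall>b\<in>Basis. (\<forall>x. has_dd b h (dd b h x) x) \<and> CE k (dd b h))"

lemma CE_continuous: "CE k h \<Longrightarrow> continuous_on UNIV h"
  by (cases k) auto

lemma CE_has_dd: "CE (Suc k) h \<Longrightarrow> b \<in> Basis \<Longrightarrow> has_dd b h (dd b h x) x"
  by simp

lemma CE_dd: "CE (Suc k) h \<Longrightarrow> b \<in> Basis \<Longrightarrow> CE k (dd b h)"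
  by simp

lemma CE_SucD: "CE (Suc k) h \<Longrightarrow> CE k h"
  by (induction k arbitrary: h) auto

lemma CE_le: "CE k h \<Longrightarrow> j \<le> k \<Longrightarrow> CE j h"
  by (induction k) (auto simp: le_Suc_eq dest: CE_SucD simp del: CE.simps(2))

lemma CE_SucI:
  assumes "continuous_on UNIV h" "\<And>b x. b \<in> Basis \<Longrightarrow> has_dd b h (h' b x) x"
    "\<And>b. b \<in> Basis \<Longrightarrow> CE k (h' b)"
  shows "CE (Suc k) h"
proof -
  have "dd b h = h' b" if "b \<in> Basis" for b
    using assms(2)[OF that] by (auto simp: dd_eqI)
  then show ?thesis using assms by auto
qed

lemma CE_const: "CE k (\<lambda>x. c)"
  by (induction k arbitrary: c)
    (auto intro!: CE_SucI[where h' = "\<lambda>b x. 0"] has_dd_const simp del: CE.simps(2))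

lemma CE_add: "CE k f \<Longrightarrow> CE k g \<Longrightarrow> CE k (\<lambda>x. f x + g x)"
proof (induction k arbitrary: f g)
  case (Suc k)
  show ?case
    by (rule CE_SucI[where h' = "\<lambda>b x. dd b f x + dd b g x"])
      (use Suc in \<open>auto intro!: continuous_intros has_dd_add\<close>)
qed (auto intro: continuous_intros)

lemma CE_mult: "CE k f \<Longrightarrow> CE k g \<Longrightarrow> CE k (\<lambda>x. f x * g x)"
proof (induction k arbitrary: f g)
  case (Suc k)
  have "CE k f" "CE k g" using Suc.prems CE_SucD by blast+
  then show ?case
    by (intro CE_SucI[where h' = "\<lambda>b x. dd b f x * g x + f x * dd b g x"])
      (use Suc in \<open>auto intro!: continuous_intros has_dd_mult CE_add\<close>)
qed (auto intro: continuous_intros)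

lemma CE_sum: "(\<And>i. i \<in> I \<Longrightarrow> CE k (f i)) \<Longrightarrow> CE k (\<lambda>x.
    \<Sum>i\<in>I. f i x)"
  by (induction I rule: infinite_finite_induct) (auto intro: CE_const CE_add)

lemma CE_cmult: "CE k f \<Longrightarrow> CE k (\<lambda>x. c * f x)"
  by (rule CE_mult[OF CE_const])

lemma CE_diff: "CE k f \<Longrightarrow> CE k g \<Longrightarrow> CE k (\<lambda>x. f x - g x)"
  using CE_add[OF _ CE_cmult[of k g "-1"], of f] by simp

lemma CE_inner: "CE k (\<lambda>x. x \<bullet> c)"
  by (cases k)
    (auto intro!: CE_SucI[where h' = "\<lambda>b x. b \<bullet> c"] has_dd_inner CE_const continuous_intros
      simp del: CE.simps(2))

lemma CE_inner_self: "CE k (\<lambda>x. (x - a) \<bullet> (x - a))"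
proof -
  have "CE k (\<lambda>x. \<Sum>b\<in>Basis. (x \<bullet> b - a \<bullet> b) * (x \<bullet> b - a \<bullet>
      b))"
    by (intro CE_sum CE_mult CE_diff CE_inner CE_const)
  then show ?thesis by (subst euclidean_inner) (simp add: inner_diff_left)
qed

lemma has_derivative_max0_power:
  "((\<lambda>s::real. max 0 s ^ Suc (Suc m)) has_real_derivative real (m + 2) * max 0 s ^ Suc m) (at s)"
proof -
  consider "s < 0" | "s = 0" | "s > 0" by linarith
  then show ?thesis
  proof cases
    case 1
    have "((\<lambda>s::real. 0) has_real_derivative 0) (at s)" by simp
    then have "((\<lambda>s::real. max 0 s ^ Suc (Suc m)) has_real_derivative 0) (at s)"
      by (rule has_field_derivative_transform_within_open[where S = "{..<0}"]) (use 1 in auto)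
    with 1 show ?thesis by simp
  next
    case 3
    have "((\<lambda>s::real. s ^ Suc (Suc m)) has_real_derivative real (m + 2) * s ^ Suc m) (at s)"
      using DERIV_pow[of "Suc (Suc m)" s UNIV] by (simp add: add.commute del: power_Suc)
    then have "((\<lambda>s::real. max 0 s ^ Suc (Suc m)) has_real_derivative real (m + 2) * s ^ Suc m) (at
        s)"
      by (rule has_field_derivative_transform_within_open[where S = "{0<..}"]) (use 3 in auto)
    with 3 show ?thesis by simp
  next
    case 2
    have "((\<lambda>h::real. max 0 h ^ Suc (Suc m) / h) \<longlongrightarrow> 0) (at 0)"
    proof (rule Lim_null_comparison)
      show "\<forall>\<^sub>F h in at (0::real). norm (max 0 h ^ Suc (Suc m) / h) \<le> \<bar>h\<bar> ^ Suc
          m"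
        by (rule always_eventually) (auto simp: max_def abs_mult power_abs mult_nonpos_nonneg)
      show "((\<lambda>h::real. \<bar>h\<bar> ^ Suc m) \<longlongrightarrow> 0) (at 0)"
        by (auto intro!: tendsto_eq_intros)
    qed
    with 2 show ?thesis by (simp add: DERIV_def)
  qed
qed

lemma CE_max0_power: "(\<And>k. CE k P) \<Longrightarrow> CE k (\<lambda>x. max 0 (P x) ^ (k + 2))"
proof (induction k)
  case 0
  then show ?case using CE_continuous[of 0 P] by (auto intro!: continuous_intros)
next
  case (Suc k)
  note P = CE_continuous[OF Suc.prems]
  show ?case
  proof (rule CE_SucI[where h' = "\<lambda>b x. (real (k + 3) * max 0 (P x) ^ (k + 2)) * dd b P x"])
    show "CE k (\<lambda>x. real (k + 3) * max 0 (P x) ^ (k + 2) * dd b P x)" if "b \<in> Basis" for b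
      using CE_dd[OF Suc.prems that] Suc by (intro CE_mult CE_cmult Suc.IH)
    show "has_dd b (\<lambda>x. max 0 (P x) ^ (Suc k + 2)) (real (k + 3) * max 0 (P x) ^ (k + 2) * dd b P
        x) x"
      if "b \<in> Basis" for b x
      using has_dd_chain[where h = P, OF has_derivative_max0_power[of "Suc k" "P x"], of b "dd b P x"]
        CE_has_dd[OF Suc.prems[of 1, unfolded One_nat_def] that] by (simp add: add.commute)
  qed (use P in \<open>auto intro!: continuous_intros\<close>)
qed

section \<open>Integration by parts\<close>

lemma integrable_compact_support:
  fixes F :: "'a::euclidean_space \<Rightarrow> real"
  assumes "continuous_on UNIV F" "\<And>x. R < norm x \<Longrightarrow> F x = 0"
  shows "integrable lborel F"
proof -
  have "integrable lborel (\<lambda>x. indicator (cball 0 R) x *\<^sub>R F x)"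
    using assms(1) continuous_on_subset by (intro borel_integrable_compact) auto
  moreover have "(\<lambda>x. indicator (cball 0 R) x *\<^sub>R F x) = F"
    using assms(2) by (auto simp: indicator_def fun_eq_iff not_le)
  ultimately show ?thesis by simp
qed

lemma integral_lborel_translate:
  fixes F :: "'a::euclidean_space \<Rightarrow> real"
  assumes [measurable]: "F \<in> borel_measurable borel"
  shows "(\<integral>x. F (x + c) \<partial>lborel) = (\<integral>x. F x \<partial>lborel)"
proof -
  have "(\<integral>x. F x \<partial>lborel) = (\<integral>x. F x \<partial>distr lborel borel ((+) c))"
    by (simp add: lborel_distr_plus)
  also have "\<dots> = (\<integral>x. F (c + x) \<partial>lborel)"
    by (rule integral_distr) auto
  finally show ?thesis by (simp add: add.commute)
qed

lemma nn_integral_lborel_translate: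
  fixes F :: "'a::euclidean_space \<Rightarrow> ennreal"
  assumes [measurable]: "F \<in> borel_measurable borel"
  shows "(\<integral>\<^sup>+x. F (x + c) \<partial>lborel) = (\<integral>\<^sup>+x. F x \<partial>lborel)"
proof -
  have "(\<integral>\<^sup>+x. F x \<partial>lborel) = (\<integral>\<^sup>+x. F x \<partial>distr lborel
      borel ((+) c))"
    by (simp add: lborel_distr_plus)
  also have "\<dots> = (\<integral>\<^sup>+x. F (c + x) \<partial>lborel)"
    by (rule nn_integral_distr) auto
  finally show ?thesis by (simp add: add.commute)
qed

lemma integral_dd_eq_0:
  fixes F F' :: "'a::euclidean_space \<Rightarrow> real"
  assumes F: "continuous_on UNIV F" and F': "continuous_on UNIV F'"
    and d: "\<And>x. has_dd b F (F' x) x" and supp: "\<And>x. R < norm x \<Longrightarrow> F x = 0"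
  shows "(\<integral>x. F' x \<partial>lborel) = 0"
proof -
  define S where "S = cball (0::'a) (\<bar>R\<bar> + 2 * norm b)"
  have "compact (F' ` S)"
    unfolding S_def using F' continuous_on_subset by (intro compact_continuous_image) auto
  then obtain B where B: "\<And>x. x \<in> S \<Longrightarrow> \<bar>F' x\<bar> \<le> B"
    using compact_imp_bounded[of "F' ` S"] by (auto simp: bounded_iff)
  have "0 \<in> S" by (simp add: S_def)
  then have B0: "0 \<le> B" using B[of 0] by linarith
  define h :: "nat \<Rightarrow> real" where "h j = inverse (real (Suc j))" for j
  have h: "0 < h j" "h j \<le> 1" for j
    by (auto simp: h_def field_simps)
  have h0: "h \<longlonglongrightarrow> 0" unfolding h_def by (rule LIMSEQ_inverse_real_of_nat)
  define q where "q j x = (F (x + h j *\<^sub>R b) - F x) / h j" for j x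
  have [measurable]: "F \<in> borel_measurable borel" "F' \<in> borel_measurable borel"
    using F F' by (auto intro: borel_measurable_continuous_onI)
  have iF: "integrable lborel F"
    using integrable_compact_support[OF F supp] .
  have iFs: "integrable lborel (\<lambda>x. F (x + c))" for c
  proof (rule integrable_compact_support[where R = "R + norm c"])
    show "continuous_on UNIV (\<lambda>x. F (x + c))"
      by (intro continuous_on_compose2[OF F] continuous_intros) auto
    show "F (x + c) = 0" if "R + norm c < norm x" for x
    proof (rule supp)
      have "norm x \<le> norm (x + c) + norm c" by (metis add_diff_cancel norm_triangle_ineq4)
      with that show "R < norm (x + c)" by linarith
    qed
  qed
  have q0: "(\<integral>x. q j x \<partial>lborel) = 0" for j
    unfolding q_def using iF iFs[of "h j *\<^sub>R b"] integral_lborel_translate[of F "h j *\<^sub>R b"] by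
        simp
  have "(\<lambda>j. \<integral>x. q j x \<partial>lborel) \<longlonglongrightarrow> (\<integral>x. F' x
      \<partial>lborel)"
  proof (rule integral_dominated_convergence[where w = "\<lambda>x. B * indicator S x"])
    show "integrable lborel (\<lambda>x. B * indicator S x)"
      unfolding S_def by (intro integrable_mult_right integrable_real_indicator emeasure_bounded_finite)
          auto
    show "AE x in lborel. (\<lambda>j. q j x) \<longlonglongrightarrow> F' x"
    proof (rule AE_I2)
      fix x
      have "((\<lambda>r. (F (x + r *\<^sub>R b) - F x) / r) \<longlongrightarrow> F' x) (at 0)"
        using d[of x] by (simp add: has_dd_def DERIV_def)
      moreover have "filterlim h (at 0) sequentially"
        using h0 h(1) by (auto simp: filterlim_at less_imp_neq intro!: always_eventually dest: sym)
      ultimately show "(\<lambda>j. q j x) \<longlonglongrightarrow> F' x"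
        unfolding q_def using filterlim_compose by blast
    qed
    show "AE x in lborel. norm (q j x) \<le> B * indicator S x" for j
    proof (rule AE_I2)
      fix x
      show "norm (q j x) \<le> B * indicator S x"
      proof (cases "\<bar>R\<bar> + norm b < norm x")
        case True
        have "norm (h j *\<^sub>R b) \<le> norm b" using h[of j] mult_right_mono[of "h j" 1 "norm b"] by
            simp
        moreover have "norm x \<le> norm (x + h j *\<^sub>R b) + norm (h j *\<^sub>R b)"
          by (metis add_diff_cancel norm_triangle_ineq4)
        ultimately have "R < norm (x + h j *\<^sub>R b)" "R < norm x"
          using True norm_ge_zero[of b] by linarith+
        then show ?thesis using supp B0 by (simp add: q_def)
      next
        case False
        have "\<exists>z. 0 < z \<and> z < h j \<and>
            F (x + h j *\<^sub>R b) - F (x + 0 *\<^sub>R b) = (h j - 0) * F' (x + z *\<^sub>R b)"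
          using h(1)[of j] by (intro MVT2) (auto intro!: has_dd_shift d)
        then obtain z where z: "0 < z" "z < h j"
          "F (x + h j *\<^sub>R b) - F x = h j * F' (x + z *\<^sub>R b)" by auto
        then have q: "q j x = F' (x + z *\<^sub>R b)" using h(1)[of j] by (simp add: q_def)
        have "norm (z *\<^sub>R b) \<le> norm b"
          using z h(2)[of j] mult_right_mono[of z 1 "norm b"] by simp
        then have "norm (x + z *\<^sub>R b) \<le> \<bar>R\<bar> + 2 * norm b"
          using False norm_triangle_ineq[of x "z *\<^sub>R b"] by linarith
        moreover have "norm x \<le> \<bar>R\<bar> + 2 * norm b" using False norm_ge_zero[of b] by linarith
          ultimately have "x + z *\<^sub>R b \<in> S" "x \<in> S" by (auto simp: S_def)
        with B show ?thesis by (simp add: q)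
      qed
    qed
    show "q j \<in> borel_measurable lborel" for j unfolding q_def by measurable
  qed measurable
  then show ?thesis using q0 LIMSEQ_unique[OF _ tendsto_const] by simp
qed

lemma axis_Basis: "axis i (1::real) \<in> Basis"
  by (simp add: axis_in_Basis_iff)

lemma axis_fst_Basis: "(axis i (1::real), 0::'b::euclidean_space) \<in> Basis"
  and axis_snd_Basis: "(0::'b, axis i (1::real)) \<in> Basis"
  by (simp_all add: Basis_prod_def axis_Basis)

definition cutoff :: "real \<Rightarrow> 'a::euclidean_space \<Rightarrow> real" where
  "cutoff R z = (max 0 (1 - (z \<bullet> z) / R\<^sup>2))\<^sup>2"

definition dcutoff :: "real \<Rightarrow> 'a::euclidean_space \<Rightarrow> 'a \<Rightarrow> real" where
  "dcutoff R b z = - 4 * max 0 (1 - (z \<bullet> z) / R\<^sup>2) * (z \<bullet> b) / R\<^sup>2"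

lemma has_dd_cutoff: "has_dd b (cutoff R) (dcutoff R b z) z"
proof -
  have 1: "has_dd b (\<lambda>z. 1 - (1 / R\<^sup>2) * (z \<bullet> z)) (0 - (1 / R\<^sup>2) * (2 * (z
      \<bullet> b))) z"
    by (intro has_dd_diff has_dd_const has_dd_cmult has_dd_inner_self)
  show ?thesis
    using has_dd_chain[where h = "\<lambda>z. 1 - (1 / R\<^sup>2) * (z \<bullet> z)",
        OF has_derivative_max0_power[of 0] 1]
    by (simp add: cutoff_def[abs_def] dcutoff_def numeral_2_eq_2 mult_ac)
qed

lemma continuous_cutoff: "continuous_on S (cutoff R)"
  unfolding cutoff_def[abs_def] by (cases "R = 0") (auto intro!: continuous_intros)

lemma continuous_dcutoff: "continuous_on S (dcutoff R b)"
  unfolding dcutoff_def[abs_def] by (cases "R = 0") (auto intro!: continuous_intros)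

lemma cutoff_bounds: "0 \<le> cutoff R z" "cutoff R z \<le> 1"
  by (auto simp: cutoff_def power2_eq_square max_def mult_le_one)

lemma max0_eq_0_outside: "R < norm z \<Longrightarrow> 0 < R \<Longrightarrow> max 0 (1 - (z \<bullet> z) /
    R\<^sup>2) = 0"
  by (simp add: dot_square_norm power_mono max_def field_simps)

lemma cutoff_eq_0: "R < norm z \<Longrightarrow> 0 < R \<Longrightarrow> cutoff R z = 0"
  by (simp add: cutoff_def max0_eq_0_outside)

lemma dcutoff_bound:
  assumes "0 < R" shows "\<bar>dcutoff R b z\<bar> \<le> 4 * norm b / R"
proof (cases "R < norm z")
  case True
  then show ?thesis using assms by (simp add: dcutoff_def max0_eq_0_outside)
next
  case False
  let ?m = "max 0 (1 - (z \<bullet> z) / R\<^sup>2)"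
  have "\<bar>z \<bullet> b\<bar> \<le> R * norm b"
    using False Cauchy_Schwarz_ineq2[of z b] mult_right_mono[of "norm z" R "norm b"] by auto
  then have "\<bar>?m * (z \<bullet> b)\<bar> \<le> 1 * (R * norm b)"
    unfolding abs_mult by (intro mult_mono) auto
  then show ?thesis using assms
    by (simp add: dcutoff_def abs_mult field_simps power2_eq_square)
qed

lemma LIMSEQ_cutoff: "(\<lambda>j. cutoff (real (Suc j)) z) \<longlonglongrightarrow> 1"
proof -
  have "(\<lambda>j. inverse (real (Suc j))) \<longlonglongrightarrow> 0" by (rule
      LIMSEQ_inverse_real_of_nat)
  then have "(\<lambda>j. (max 0 (1 - (z \<bullet> z) * (inverse (real (Suc j)))\<^sup>2))\<^sup>2)
      \<longlonglongrightarrow> (max 0 (1 - (z \<bullet> z) * 0\<^sup>2))\<^sup>2"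
    by (intro tendsto_intros)
  then show ?thesis by (simp add: cutoff_def divide_inverse power_inverse)
qed

lemma CE_pair:
  fixes g :: "(real^'n) \<times> (real^'n) \<Rightarrow> real"
  assumes "CE 1 g"
  shows "has_dd (axis i 1, 0) g (dd (axis i 1, 0) g z) z" "has_dd (0, axis i 1) g (dd (0, axis i 1) g z) z"
    "continuous_on UNIV (dd (axis i 1, 0) g)" "continuous_on UNIV (dd (0, axis i 1) g)"
proof -
  have 1: "CE (Suc 0) g" using assms by simp
  show "has_dd (axis i 1, 0) g (dd (axis i 1, 0) g z) z" "has_dd (0, axis i 1) g (dd (0, axis i 1) g z) z"
    by (rule CE_has_dd[OF 1 axis_fst_Basis], rule CE_has_dd[OF 1 axis_snd_Basis])
  show "continuous_on UNIV (dd (axis i 1, 0) g)" "continuous_on UNIV (dd (0, axis i 1) g)"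
    using CE_dd[OF 1 axis_fst_Basis] CE_dd[OF 1 axis_snd_Basis] by (simp_all only: CE.simps(1))
qed

lemma fst_borel [measurable]:
    "fst \<in> (borel :: ('a::second_countable_topology \<times> 'b::second_countable_topology) measure)
        \<rightarrow>\<^sub>M borel"
  and snd_borel [measurable]:
    "snd \<in> (borel :: ('a::second_countable_topology \<times> 'b::second_countable_topology) measure)
        \<rightarrow>\<^sub>M borel"
  by (simp_all add: borel_prod[symmetric])

section \<open>A weighted \<open>L\<^sup>1\<close> estimate\<close>

text \<open>Integrate \<open>div (X \<psi> \<chi>)\<close>, where \<open>\<psi> \<approx> \<bar>g\<bar>\<close>, \<open>\<chi>\<close> is a cutoff, and the field
  \<open>X = \<Sum>\<^sub>k (s F\<^sub>k - \<Sum>\<^sub>i F\<^sub>i \<Phi>\<^sub>i\<^sub>k)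
      \<partial>\<^sub>x\<^sub>k + \<Sum>\<^sub>i F\<^sub>i \<partial>\<^sub>v\<^sub>i\<close> is chosen
          such that \<open>X g = \<Sum>\<^sub>i F\<^sub>i D\<^sub>i g\<close>.\<close>

lemma weighted_L1_estimate:
  fixes g :: "(real^'n) \<times> (real^'n) \<Rightarrow> real" and \<Phi> :: "'n \<Rightarrow> 'n
      \<Rightarrow> (real^'n) \<times> (real^'n) \<Rightarrow> real"
    and F :: "'n \<Rightarrow> real^'n \<Rightarrow> real" and dF :: "'n \<Rightarrow> 'n \<Rightarrow>
        real^'n \<Rightarrow> real"
    and m w :: "real^'n \<Rightarrow> real"
    and s \<kappa> K B :: real
  defines "D \<equiv> \<lambda>i z. s * dd (axis i 1, 0) g z + dd (0, axis i 1) g z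
                    - (\<Sum>k\<in>UNIV. \<Phi> i k z * dd (axis k 1, 0) g z)"
  assumes g: "CE 1 g" and \<Phi>: "\<And>i k. CE 1 (\<Phi> i k)"
    and \<Phi>_bd: "\<And>i k z. \<bar>\<Phi> i k z\<bar> \<le> \<kappa>" and d\<Phi>_bd: "\<And>i k z.
        \<bar>dd (axis k 1, 0) (\<Phi> i k) z\<bar> \<le> K"
    and F: "\<And>i. continuous_on UNIV (F i)" and dF: "\<And>k i. continuous_on UNIV (dF k i)"
    and FdF: "\<And>k i x. has_dd (axis k 1) (F i) (dF k i x) x"
    and Fm: "\<And>i x. \<bar>F i x\<bar> \<le> m x" and mB: "\<And>x. m x \<le> B"
    and m_meas [measurable]: "m \<in> borel_measurable borel"
    and w_meas [measurable]: "w \<in> borel_measurable borel"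
    and w0: "\<And>x. 0 \<le> w x"
    and w: "\<And>x. w x \<le> s * (\<Sum>k\<in>UNIV. dF k k x) - \<kappa> * (\<Sum>k\<in>UNIV.
        \<Sum>i\<in>UNIV. \<bar>dF k i x\<bar>)"
    and int_g: "integrable lborel g" and int_D: "\<And>i. integrable lborel (D i)"
  shows "(\<integral>\<^sup>+z. ennreal (w (fst z) * \<bar>g z\<bar>) \<partial>lborel)
       \<le> (\<integral>\<^sup>+z. ennreal (m (fst z) * ((\<Sum>i\<in>UNIV. \<bar>D i z\<bar>) + (real
           CARD('n))\<^sup>2 * K * \<bar>g z\<bar>)) \<partial>lborel)"
proof -
  define n where "n = real CARD('n)"
  have n0: "0 \<le> n" by (simp add: n_def)
  have m0: "0 \<le> m x" for x using Fm[of undefined x] by linarith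
  have B0: "0 \<le> B" using m0[of 0] mB[of 0] by linarith
  have \<kappa>0: "0 \<le> \<kappa>" using \<Phi>_bd[of undefined undefined undefined] by linarith
  have K0: "0 \<le> K" using d\<Phi>_bd[of undefined undefined undefined] by linarith
  let ?ex = "\<lambda>k. (axis k 1, 0) :: (real^'n) \<times> (real^'n)"
  let ?ev = "\<lambda>k. (0, axis k 1) :: (real^'n) \<times> (real^'n)"
  define A where "A z = m (fst z) * ((\<Sum>i\<in>UNIV. \<bar>D i z\<bar>) + n\<^sup>2 * K * \<bar>g
      z\<bar>)" for z
  have A0: "0 \<le> A z" for z unfolding A_def using m0 K0 by (intro mult_nonneg_nonneg add_nonneg_nonneg
      sum_nonneg) auto
  have cg: "continuous_on UNIV g" using CE_continuous[OF g] .
  have [measurable]: "g \<in> borel_measurable borel" using cg by (rule borel_measurable_continuous_onI)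
  have dg: "has_dd (?ex k) g (dd (?ex k) g z) z" "has_dd (?ev k) g (dd (?ev k) g z) z"
    "continuous_on UNIV (dd (?ex k) g)" "continuous_on UNIV (dd (?ev k) g)" for k z
    by (rule CE_pair[OF g])+
  have d\<Phi>: "has_dd (?ex k) (\<Phi> i j) (dd (?ex k) (\<Phi> i j) z) z"
    "has_dd (?ev k) (\<Phi> i j) (dd (?ev k) (\<Phi> i j) z) z"
    "continuous_on UNIV (dd (?ex k) (\<Phi> i j))" "continuous_on UNIV (\<Phi> i j)" for i j k z
    by (rule CE_pair[OF \<Phi>] CE_continuous[OF \<Phi>])+
  have meas_D [measurable]: "D i \<in> borel_measurable borel" for i
    using int_D[of i] by (auto dest: borel_measurable_integrable)
  have int_A: "integrable lborel A"
  proof (rule Bochner_Integration.integrable_bound)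
    show "integrable lborel (\<lambda>z. B * ((\<Sum>i\<in>UNIV. \<bar>D i z\<bar>) + n\<^sup>2 * K *
        \<bar>g z\<bar>))"
      using int_g int_D by (intro integrable_mult_right Bochner_Integration.integrable_add
          Bochner_Integration.integrable_sum integrable_abs) auto
    show "A \<in> borel_measurable lborel" unfolding A_def by measurable
    show "AE z in lborel. norm (A z) \<le> norm (B * ((\<Sum>i\<in>UNIV. \<bar>D i z\<bar>) + n\<^sup>2 * K
        * \<bar>g z\<bar>))"
    proof (rule AE_I2)
      fix z
      have "A z \<le> B * ((\<Sum>i\<in>UNIV. \<bar>D i z\<bar>) + n\<^sup>2 * K * \<bar>g z\<bar>)"
        unfolding A_def using mB K0 by (intro mult_right_mono add_nonneg_nonneg sum_nonneg) auto
      then show "norm (A z) \<le> norm (B * ((\<Sum>i\<in>UNIV. \<bar>D i z\<bar>) + n\<^sup>2 * K *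
          \<bar>g z\<bar>))"
        using A0[of z] by auto
    qed
  qed
  define C1 where "C1 = 4 * (n * (\<bar>s\<bar> * B + n * B * \<kappa>) + n * B)"
  define X where "X k z = s * F k (fst z) - (\<Sum>i\<in>UNIV. F i (fst z) * \<Phi> i k z)" for k z
  have cFf: "continuous_on UNIV (\<lambda>z. F i (fst z))" "continuous_on UNIV (\<lambda>z. dF k i (fst
      z))" for k i
    by (auto intro!: continuous_on_compose2[OF F] continuous_on_compose2[OF dF] continuous_intros)
  have cX: "continuous_on UNIV (X k)" for k
    unfolding X_def using cFf d\<Phi> by (intro continuous_intros) auto
  have X_bd: "\<bar>X k z\<bar> \<le> \<bar>s\<bar> * B + n * B * \<kappa>" for k z
  proof -
    have FB: "\<bar>F i (fst z)\<bar> \<le> B" for i using Fm mB order_trans by blast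
    have "\<bar>\<Sum>i\<in>UNIV. F i (fst z) * \<Phi> i k z\<bar> \<le> (\<Sum>i\<in>(UNIV::'n set). B *
        \<kappa>)"
      by (rule order_trans[OF sum_abs], rule sum_mono, unfold abs_mult, rule mult_mono)
        (rule FB \<Phi>_bd B0 abs_ge_zero)+
    moreover have "\<bar>s * F k (fst z)\<bar> \<le> \<bar>s\<bar> * B" using FB by (auto simp: abs_mult
        intro!: mult_left_mono)
    ultimately show ?thesis unfolding X_def by (simp add: n_def)
  qed
  define dX where "dX k z = s * dF k k (fst z)
      - (\<Sum>i\<in>UNIV. dF k i (fst z) * \<Phi> i k z + F i (fst z) * dd (?ex k) (\<Phi> i k) z)" for k z
  have dX: "has_dd (?ex k) (X k) (dX k z) z" for k z
    unfolding X_def[abs_def] dX_def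
    by (intro has_dd_diff has_dd_cmult has_dd_sum has_dd_mult has_dd_fst FdF d\<Phi>)
  have cdX: "continuous_on UNIV (dX k)" for k
    unfolding dX_def[abs_def] by (intro continuous_intros cFf d\<Phi>)
  have main: "(\<integral>\<^sup>+z. ennreal (w (fst z) * ((sqrt ((g z)\<^sup>2 + \<delta>\<^sup>2) -
      \<delta>) * cutoff R z)) \<partial>lborel)
      \<le> ennreal ((\<integral>z. A z \<partial>lborel) + C1 / R * (\<integral>z. \<bar>g z\<bar>
          \<partial>lborel))" if R: "0 < R" and \<delta>: "0 < \<delta>" for \<delta> R
  proof -
    define \<psi> where "\<psi> z = sqrt ((g z)\<^sup>2 + \<delta>\<^sup>2) - \<delta>" for z
    define r where "r z = g z / sqrt ((g z)\<^sup>2 + \<delta>\<^sup>2)" for z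
    let ?\<chi> = "cutoff R :: (real^'n) \<times> (real^'n) \<Rightarrow> real"
    have pos: "0 < (g z)\<^sup>2 + \<delta>\<^sup>2" for z using \<delta> by (simp add: add_nonneg_pos)
    have \<psi>0: "0 \<le> \<psi> z" for z using \<delta> unfolding \<psi>_def by (auto intro!:
        real_le_rsqrt)
    have \<psi>g: "\<psi> z \<le> \<bar>g z\<bar>" for z
      using sqrt_add_le_add_sqrt[of "(g z)\<^sup>2" "\<delta>\<^sup>2"] \<delta> by (simp add: \<psi>_def)
    have r1: "\<bar>r z\<bar> \<le> 1" for z
    proof -
      have "\<bar>g z\<bar> \<le> sqrt ((g z)\<^sup>2 + \<delta>\<^sup>2)" by (rule real_le_rsqrt) simp
      then show ?thesis using pos[of z] by (simp add: r_def abs_mult field_simps)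
    qed
    have d\<psi>: "has_dd b \<psi> (r z * G) z" if "has_dd b g G z" for b z G
    proof -
      have 1: "((\<lambda>u. sqrt (u\<^sup>2 + \<delta>\<^sup>2) - \<delta>) has_real_derivative r z) (at
          (g z))"
        unfolding r_def using pos[of z]
        by (auto intro!: derivative_eq_intros simp: field_simps)
      show ?thesis using has_dd_chain[where h = g, OF 1 that] by (simp add: \<psi>_def[abs_def])
    qed
    have c\<psi>: "continuous_on UNIV \<psi>" unfolding \<psi>_def[abs_def] using cg by (intro
        continuous_intros)
    have cr: "continuous_on UNIV r" unfolding r_def[abs_def] using cg pos
      by (intro continuous_intros) (auto simp: less_imp_neq[symmetric])
    have c\<chi>: "continuous_on UNIV ?\<chi>" by (rule continuous_cutoff)
    have cd\<chi>: "continuous_on UNIV (dcutoff R b)" for b :: "(real^'n) \<times> (real^'n)" by (rule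
        continuous_dcutoff)
    define P where "P k z = dX k z * (\<psi> z * ?\<chi> z)
        + X k z * ((r z * dd (?ex k) g z) * ?\<chi> z + \<psi> z * dcutoff R (?ex k) z)" for k z
    define Q where "Q k z = 0 * (\<psi> z * ?\<chi> z)
        + F k (fst z) * ((r z * dd (?ev k) g z) * ?\<chi> z + \<psi> z * dcutoff R (?ev k) z)" for k z
    have cP: "continuous_on UNIV (P k)" and cQ: "continuous_on UNIV (Q k)" for k
      unfolding P_def[abs_def] Q_def[abs_def]
      by (intro continuous_intros cX cdX c\<psi> cr c\<chi> cd\<chi> dg cFf)+
    have iP0: "(\<integral>z. P k z \<partial>lborel) = 0" for k
    proof (rule integral_dd_eq_0)
      show "continuous_on UNIV (\<lambda>z. X k z * (\<psi> z * ?\<chi> z))" by (intro continuous_intros cX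
          c\<psi> c\<chi>)
      show "has_dd (?ex k) (\<lambda>z. X k z * (\<psi> z * ?\<chi> z)) (P k z) z" for z
        unfolding P_def by (intro has_dd_mult dX d\<psi> dg has_dd_cutoff)
      show "X k z * (\<psi> z * ?\<chi> z) = 0" if "R < norm z" for z using cutoff_eq_0[OF that R] by simp
    qed (rule cP)
    have iQ0: "(\<integral>z. Q k z \<partial>lborel) = 0" for k
    proof (rule integral_dd_eq_0)
      show "continuous_on UNIV (\<lambda>z. F k (fst z) * (\<psi> z * ?\<chi> z))" by (intro
          continuous_intros cFf c\<psi> c\<chi>)
      show "has_dd (?ev k) (\<lambda>z. F k (fst z) * (\<psi> z * ?\<chi> z)) (Q k z) z" for z
        unfolding Q_def by (intro has_dd_mult has_dd_fst0 d\<psi> dg has_dd_cutoff)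
      show "F k (fst z) * (\<psi> z * ?\<chi> z) = 0" if "R < norm z" for z using cutoff_eq_0[OF that R] by
          simp
    qed (rule cQ)
    have "P k z = 0" if "R < norm z" for k z
      using that R by (simp add: P_def cutoff_eq_0 dcutoff_def max0_eq_0_outside)
    then have iP: "integrable lborel (P k)" for k using cP by (intro integrable_compact_support)
    have "Q k z = 0" if "R < norm z" for k z
      using that R by (simp add: Q_def cutoff_eq_0 dcutoff_def max0_eq_0_outside)
    then have iQ: "integrable lborel (Q k)" for k using cQ by (intro integrable_compact_support)
    define H where "H z = (\<Sum>k\<in>UNIV. P k z) + (\<Sum>k\<in>UNIV. Q k z) + A z + C1 / R * \<bar>g
        z\<bar>" for z
    have iH: "integrable lborel H" unfolding H_def
      using int_A int_g iP iQ by (intro Bochner_Integration.integrable_add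
          Bochner_Integration.integrable_sum integrable_mult_right integrable_abs) auto
    have "(\<integral>z. H z \<partial>lborel) = (\<integral>z. A z \<partial>lborel) + C1 / R *
        (\<integral>z. \<bar>g z\<bar> \<partial>lborel)"
      unfolding H_def using int_A int_g iP iQ iP0 iQ0
      by (simp add: Bochner_Integration.integral_add Bochner_Integration.integral_sum)
    moreover have wH: "w (fst z) * (\<psi> z * ?\<chi> z) \<le> H z" for z
    proof -
      have \<psi>\<chi>: "0 \<le> \<psi> z * ?\<chi> z" "\<psi> z * ?\<chi> z \<le> \<bar>g z\<bar>"
        using \<psi>0[of z] \<psi>g[of z] cutoff_bounds[of R z] mult_left_le[of "?\<chi> z" "\<psi> z"] by
            auto
      define T1 where "T1 = (s * (\<Sum>k\<in>UNIV. dF k k (fst z))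
          - (\<Sum>k\<in>UNIV. \<Sum>i\<in>UNIV. dF k i (fst z) * \<Phi> i k z)) * (\<psi> z * ?\<chi> z)"
      define T2 where "T2 = (\<Sum>k\<in>UNIV. \<Sum>i\<in>UNIV. F i (fst z) * dd (?ex k) (\<Phi> i k) z) *
          (\<psi> z * ?\<chi> z)"
      define T3 where "T3 = (?\<chi> z * r z) * (\<Sum>i\<in>UNIV. F i (fst z) * D i z)"
      define T4 where "T4 = \<psi> z * ((\<Sum>k\<in>UNIV. X k z * dcutoff R (?ex k) z)
          + (\<Sum>k\<in>UNIV. F k (fst z) * dcutoff R (?ev k) z))"
      have e0: "(\<Sum>k\<in>UNIV. dX k z) = s * (\<Sum>k\<in>UNIV. dF k k (fst z))
          - (\<Sum>k\<in>UNIV. \<Sum>i\<in>UNIV. dF k i (fst z) * \<Phi> i k z)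
          - (\<Sum>k\<in>UNIV. \<Sum>i\<in>UNIV. F i (fst z) * dd (?ex k) (\<Phi> i k) z)"
        by (simp add: dX_def sum_subtractf sum.distrib sum_distrib_left)
      then have e1: "(\<Sum>k\<in>UNIV. dX k z * (\<psi> z * ?\<chi> z)) = T1 - T2"
        unfolding T1_def T2_def sum_distrib_right[symmetric] e0 by (simp only: left_diff_distrib)
      have "(\<Sum>k\<in>UNIV. X k z * dd (?ex k) g z) = s * (\<Sum>k\<in>UNIV. F k (fst z) * dd (?ex k) g
          z)
          - (\<Sum>k\<in>UNIV. \<Sum>i\<in>UNIV. F i (fst z) * \<Phi> i k z * dd (?ex k) g z)"
        by (simp add: X_def left_diff_distrib sum_subtractf sum_distrib_left sum_distrib_right mult.assoc)
      also have "(\<Sum>k\<in>UNIV. \<Sum>i\<in>UNIV. F i (fst z) * \<Phi> i k z * dd (?ex k) g z)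
          = (\<Sum>i\<in>UNIV. F i (fst z) * (\<Sum>k\<in>UNIV. \<Phi> i k z * dd (?ex k) g z))"
        by (subst sum.swap) (simp add: sum_distrib_left mult_ac)
      finally have "(\<Sum>k\<in>UNIV. X k z * dd (?ex k) g z) + (\<Sum>k\<in>UNIV. F k (fst z) * dd (?ev
          k) g z)
          = (\<Sum>i\<in>UNIV. F i (fst z) * D i z)"
        by (simp add: D_def algebra_simps sum.distrib sum_subtractf sum_distrib_left)
      then have T3: "T3 = (?\<chi> z * r z) * (\<Sum>k\<in>UNIV. X k z * dd (?ex k) g z)
          + (?\<chi> z * r z) * (\<Sum>k\<in>UNIV. F k (fst z) * dd (?ev k) g z)"
        unfolding T3_def by (simp add: distrib_left[symmetric])
      then have e2: "(\<Sum>k\<in>UNIV. P k z) + (\<Sum>k\<in>UNIV. Q k z) = T1 - T2 + T3 + T4"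
      proof -
        have P: "P k z = dX k z * (\<psi> z * ?\<chi> z) + (?\<chi> z * r z) * (X k z * dd (?ex k) g z)
            + \<psi> z * (X k z * dcutoff R (?ex k) z)" for k
          unfolding P_def by (simp only: algebra_simps)
        have Q: "Q k z = (?\<chi> z * r z) * (F k (fst z) * dd (?ev k) g z)
            + \<psi> z * (F k (fst z) * dcutoff R (?ev k) z)" for k
          unfolding Q_def by (simp add: algebra_simps)
        show ?thesis
          unfolding e1[symmetric] T4_def T3 P Q sum.distrib sum_distrib_left[symmetric] distrib_left
          by simp
      qed
      have t1: "w (fst z) * (\<psi> z * ?\<chi> z) \<le> T1"
      proof -
        have "(\<Sum>k\<in>UNIV. \<Sum>i\<in>UNIV. dF k i (fst z) * \<Phi> i k z) \<le> (\<Sum>k\<in>UNIV.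
            \<Sum>i\<in>UNIV. \<kappa> * \<bar>dF k i (fst z)\<bar>)"
          by (rule sum_mono, rule sum_mono, rule order_trans[OF abs_ge_self], subst abs_mult,
              subst mult.commute, rule mult_right_mono) (rule \<Phi>_bd abs_ge_zero)+
        then have "w (fst z) \<le> s * (\<Sum>k\<in>UNIV. dF k k (fst z)) - (\<Sum>k\<in>UNIV.
            \<Sum>i\<in>UNIV. dF k i (fst z) * \<Phi> i k z)"
          using w[of "fst z"] by (simp add: sum_distrib_left)
        then show ?thesis unfolding T1_def using \<psi>\<chi>(1) by (rule mult_right_mono)
      qed
      have t2: "\<bar>T2\<bar> \<le> m (fst z) * (n\<^sup>2 * K * \<bar>g z\<bar>)"
      proof -
        have "\<bar>\<Sum>k\<in>UNIV. \<Sum>i\<in>UNIV. F i (fst z) * dd (?ex k) (\<Phi> i k) z\<bar> \<le>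
            (\<Sum>k\<in>(UNIV::'n set). \<Sum>i\<in>(UNIV::'n set). m (fst z) * K)"
          by (rule order_trans[OF sum_abs], rule sum_mono, rule order_trans[OF sum_abs], rule sum_mono,
              unfold abs_mult, rule mult_mono) (rule Fm d\<Phi>_bd m0 abs_ge_zero)+
        also have "\<dots> = m (fst z) * (n\<^sup>2 * K)" by (simp add: n_def power2_eq_square)
        finally have "\<bar>T2\<bar> \<le> m (fst z) * (n\<^sup>2 * K) * \<bar>g z\<bar>"
          unfolding T2_def abs_mult[of _ "\<psi> z * ?\<chi> z"] using \<psi>\<chi> by (intro mult_mono)
              auto
        then show ?thesis by (simp add: mult_ac)
      qed
      have t3: "\<bar>T3\<bar> \<le> m (fst z) * (\<Sum>i\<in>UNIV. \<bar>D i z\<bar>)"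
      proof -
        have "\<bar>\<Sum>i\<in>UNIV. F i (fst z) * D i z\<bar> \<le> (\<Sum>i\<in>UNIV. m (fst z) *
            \<bar>D i z\<bar>)"
          by (rule order_trans[OF sum_abs], rule sum_mono, unfold abs_mult, rule mult_right_mono) (use Fm
              in auto)
        moreover have "\<bar>?\<chi> z * r z\<bar> \<le> 1"
          using cutoff_bounds[of R z] r1[of z] by (simp add: abs_mult mult_le_one)
        ultimately have "\<bar>T3\<bar> \<le> 1 * (\<Sum>i\<in>UNIV. m (fst z) * \<bar>D i z\<bar>)"
          unfolding T3_def abs_mult[of "?\<chi> z * r z"] by (intro mult_mono) auto
        then show ?thesis by (simp add: sum_distrib_left)
      qed
      have t4: "\<bar>T4\<bar> \<le> C1 / R * \<bar>g z\<bar>"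
      proof -
        have dc: "\<bar>dcutoff R (?ex k) z\<bar> \<le> 4 / R" "\<bar>dcutoff R (?ev k) z\<bar> \<le> 4 /
            R" for k
          using dcutoff_bound[OF R, of "?ex k" z] dcutoff_bound[OF R, of "?ev k" z]
          by (simp_all add: norm_Pair)
        have "\<bar>\<Sum>k\<in>UNIV. X k z * dcutoff R (?ex k) z\<bar> \<le> (\<Sum>k\<in>(UNIV::'n set).
            (\<bar>s\<bar> * B + n * B * \<kappa>) * (4 / R))"
          by (rule order_trans[OF sum_abs], rule sum_mono, unfold abs_mult, rule mult_mono)
            (rule X_bd dc abs_ge_zero order_trans[OF abs_ge_zero X_bd])+
        moreover have "\<bar>\<Sum>k\<in>UNIV. F k (fst z) * dcutoff R (?ev k) z\<bar> \<le>
            (\<Sum>k\<in>(UNIV::'n set). B * (4 / R))"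
          by (rule order_trans[OF sum_abs], rule sum_mono, unfold abs_mult, rule mult_mono)
            (rule order_trans[OF Fm mB] dc abs_ge_zero B0)+
        ultimately have "\<bar>(\<Sum>k\<in>UNIV. X k z * dcutoff R (?ex k) z) + (\<Sum>k\<in>UNIV. F k
            (fst z) * dcutoff R (?ev k) z)\<bar>
            \<le> n * ((\<bar>s\<bar> * B + n * B * \<kappa>) * (4 / R)) + n * (B * (4 / R))"
          unfolding n_def by simp
        also have "\<dots> = C1 / R" by (simp add: C1_def algebra_simps add_divide_distrib)
        finally have "\<bar>T4\<bar> \<le> \<bar>g z\<bar> * (C1 / R)"
          unfolding T4_def abs_mult[of "\<psi> z"] using \<psi>0[of z] \<psi>g[of z] by (intro mult_mono)
              auto
        then show ?thesis by (simp add: mult_ac)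
      qed
      show ?thesis unfolding H_def e2 A_def using t1 t2 t3 t4
        by (simp add: distrib_left)
    qed
    moreover have "0 \<le> H z" for z
      using wH[of z] w0[of "fst z"] \<psi>0[of z] cutoff_bounds[of R z] by (meson mult_nonneg_nonneg
          order_trans)
    ultimately show ?thesis
      using nn_integral_eq_integral[OF iH] nn_integral_mono[of lborel "\<lambda>z. ennreal (w (fst z) *
          (\<psi> z * ?\<chi> z))" "\<lambda>z. ennreal (H z)"]
      by (simp add: \<psi>_def ennreal_leI)
  qed
  define e where "e j = inverse (real (Suc j))" for j
  have e: "e \<longlonglongrightarrow> 0" "0 < e j" for j
    unfolding e_def by (rule LIMSEQ_inverse_real_of_nat) simp
  define G where "G j z = w (fst z) * ((sqrt ((g z)\<^sup>2 + (e j)\<^sup>2) - e j) * cutoff (real (Suc j))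
      z)" for j z
  have lim: "(\<lambda>j. ennreal (G j z)) \<longlonglongrightarrow> ennreal (w (fst z) * \<bar>g z\<bar>)"
      for z
  proof -
    have "(\<lambda>j. G j z) \<longlonglongrightarrow> w (fst z) * ((sqrt ((g z)\<^sup>2 + 0\<^sup>2) - 0)
        * 1)"
      unfolding G_def by (intro tendsto_intros LIMSEQ_cutoff e)
    then show ?thesis by (intro tendsto_ennrealI) simp
  qed
  have [measurable]: "cutoff R \<in> borel_measurable borel" for R :: real
    using continuous_cutoff by (rule borel_measurable_continuous_onI)
  have "liminf (\<lambda>j. ennreal (G j z)) = ennreal (w (fst z) * \<bar>g z\<bar>)" for z
    using lim[of z] by (intro lim_imp_Liminf) auto
  then have "(\<integral>\<^sup>+z. ennreal (w (fst z) * \<bar>g z\<bar>) \<partial>lborel) =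
      (\<integral>\<^sup>+z. liminf (\<lambda>j. ennreal (G j z)) \<partial>lborel)"
    by simp
  also have "\<dots> \<le> liminf (\<lambda>j. \<integral>\<^sup>+z. ennreal (G j z) \<partial>lborel)"
    unfolding G_def by (intro nn_integral_liminf) measurable
  also have "\<dots> \<le> liminf (\<lambda>j. ennreal ((\<integral>z. A z \<partial>lborel) + C1 *
      (\<integral>z. \<bar>g z\<bar> \<partial>lborel) * e j))"
    unfolding G_def
  proof (intro Liminf_mono always_eventually allI)
    fix j
    show "(\<integral>\<^sup>+z. ennreal (w (fst z) * ((sqrt ((g z)\<^sup>2 + (e j)\<^sup>2) - e j) *
        cutoff (real (Suc j)) z)) \<partial>lborel)
      \<le> ennreal ((\<integral>z. A z \<partial>lborel) + C1 * (\<integral>z. \<bar>g z\<bar>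
          \<partial>lborel) * e j)"
      using main[of "real (Suc j)" "e j"] e(2)[of j] by (simp add: e_def field_simps)
  qed
  also have "\<dots> = ennreal ((\<integral>z. A z \<partial>lborel) + C1 * (\<integral>z. \<bar>g z\<bar>
      \<partial>lborel) * 0)"
    by (intro lim_imp_Liminf tendsto_ennrealI tendsto_intros e) simp
  also have "\<dots> = (\<integral>\<^sup>+z. ennreal (A z) \<partial>lborel)"
    using nn_integral_eq_integral[OF int_A] A0 by simp
  finally show ?thesis by (simp add: A_def n_def)
qed

lemma component_le_inner_self: "\<bar>z $ i * z $ k\<bar> \<le> (z::real^'n) \<bullet> z"
proof -
  have "\<bar>z $ i\<bar> * \<bar>z $ k\<bar> \<le> norm z * norm z"
    by (intro mult_mono component_le_norm_cart) auto
  then show ?thesis by (simp add: abs_mult dot_square_norm power2_eq_square)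
qed

lemma radial_L1_estimate:
  fixes g :: "(real^'n) \<times> (real^'n) \<Rightarrow> real" and \<Phi> :: "'n \<Rightarrow> 'n
      \<Rightarrow> (real^'n) \<times> (real^'n) \<Rightarrow> real"
    and H1 H2 :: "'n \<Rightarrow> (real^'n) \<times> (real^'n) \<Rightarrow> real"
    and b b' m w :: "real \<Rightarrow> real" and s \<kappa> K B \<eta> :: real and a :: ennreal
  defines "q \<equiv> \<lambda>x. x \<bullet> x + \<eta>\<^sup>2" and "n \<equiv> real CARD('n)"
  assumes g: "CE 1 g" and \<Phi>: "\<And>i k. CE 1 (\<Phi> i k)"
    and \<Phi>_bd: "\<And>i k z. \<bar>\<Phi> i k z\<bar> \<le> \<kappa>" and d\<Phi>_bd: "\<And>i k z.
        \<bar>dd (axis k 1, 0) (\<Phi> i k) z\<bar> \<le> K"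
    and n: "n \<le> 3" and K: "K \<le> 1 / 9" and s: "0 \<le> s" and \<eta>: "0 < \<eta>"
    and b: "\<And>u. 0 < u \<Longrightarrow> (b has_real_derivative b' u) (at u)" and b': "continuous_on
        {0<..} b'"
    and sgn: "\<And>u. 0 < u \<Longrightarrow> 0 \<le> b u" "\<And>u. 0 < u \<Longrightarrow> b' u \<le> 0"
    and m: "\<And>u. 0 < u \<Longrightarrow> sqrt u * b u \<le> m u" "\<And>u. \<eta>\<^sup>2 \<le> u
        \<Longrightarrow> m u \<le> B"
    and [measurable]: "m \<in> borel_measurable borel" "w \<in> borel_measurable borel"
    and w0: "\<And>u. 0 < u \<Longrightarrow> 0 \<le> w u"
    and w: "\<And>u. 0 < u \<Longrightarrow> w u \<le> s * (n * b u + 2 * u * b' u) - \<kappa> * (n\<^sup>2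
        * (b u - 2 * u * b' u))"
    and D: "\<And>i z. s * dd (axis i 1, 0) g z + dd (0, axis i 1) g z
                    - (\<Sum>k\<in>UNIV. \<Phi> i k z * dd (axis k 1, 0) g z) = H1 i z + H2 i z"
    and int: "integrable lborel g" "\<And>i. integrable lborel (H1 i)" "\<And>i. integrable lborel (H2 i)"
    and a: "\<And>h. h \<in> {g} \<union> range H1 \<union> range H2 \<Longrightarrow>
              (\<integral>\<^sup>+z. ennreal (m (q (fst z - y)) * \<bar>h z\<bar>) \<partial>lborel) \<le>
                  a"
  shows "(\<integral>\<^sup>+z. ennreal (w (q (fst z - y)) * \<bar>g z\<bar>) \<partial>lborel) \<le> 7 * a"
proof -
  define F where "F i x = (x - y) $ i * b (q (x - y))" for i x
  define dF where "dF k i x = (axis k 1 \<bullet> axis i (1::real)) * b (q (x - y))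
      + (x - y) $ i * (b' (q (x - y)) * (2 * ((x - y) \<bullet> axis k 1)))" for k i x
  have q: "\<eta>\<^sup>2 \<le> q x" "0 < q x" "x \<bullet> x \<le> q x" for x :: "real^'n"
    using \<eta> by (auto simp: q_def add_nonneg_pos)
  have cb: "continuous_on {0<..} b"
    using b by (intro DERIV_continuous_on) (auto intro: has_field_derivative_at_within)
  have cq: "continuous_on UNIV (\<lambda>x. q (x - y))" unfolding q_def by (intro continuous_intros)
  have cbq: "continuous_on UNIV (\<lambda>x. b (q (x - y)))" "continuous_on UNIV (\<lambda>x. b' (q (x -
      y)))"
    by (auto intro!: continuous_on_compose2[OF cb cq] continuous_on_compose2[OF b' cq] q)
  have int_D: "integrable lborel (\<lambda>z. s * dd (axis i 1, 0) g z + dd (0, axis i 1) g z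
                    - (\<Sum>k\<in>UNIV. \<Phi> i k z * dd (axis k 1, 0) g z))" for i
    unfolding D using int by auto
  have n0: "0 \<le> n" by (simp add: n_def)
  have \<kappa>0: "0 \<le> \<kappa>" using \<Phi>_bd[of undefined undefined undefined] by linarith
  have K0: "0 \<le> K" using d\<Phi>_bd[of undefined undefined undefined] by linarith
  have m0: "0 \<le> m u" if "0 < u" for u
    using m(1)[OF that] sgn(1)[OF that] that by (meson mult_nonneg_nonneg order_trans real_sqrt_ge_zero
        less_imp_le)
  have qm: "(\<lambda>x. q (x - y)) \<in> borel_measurable borel" using cq by (rule
      borel_measurable_continuous_onI)
  have mq [measurable]: "(\<lambda>x. m (q (x - y))) \<in> borel_measurable borel"
    and wq [measurable]: "(\<lambda>x. w (q (x - y))) \<in> borel_measurable borel"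
    by (rule measurable_compose[OF qm], measurable)+
  have [measurable]: "g \<in> borel_measurable borel" "H1 i \<in> borel_measurable borel" "H2 i \<in>
      borel_measurable borel" for i
    using int by (auto dest: borel_measurable_integrable)
  have "(\<integral>\<^sup>+z. ennreal (w (q (fst z - y)) * \<bar>g z\<bar>) \<partial>lborel)
     \<le> (\<integral>\<^sup>+z. ennreal (m (q (fst z - y)) * ((\<Sum>i\<in>UNIV. \<bar>s * dd (axis i 1,
         0) g z + dd (0, axis i 1) g z
                    - (\<Sum>k\<in>UNIV. \<Phi> i k z * dd (axis k 1, 0) g z)\<bar>) + (real
                        CARD('n))\<^sup>2 * K * \<bar>g z\<bar>)) \<partial>lborel)"
  proof (rule weighted_L1_estimate[where F = F and dF = dF and \<kappa> = \<kappa> and B = B and w =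
      "\<lambda>x. w (q (x - y))" and m = "\<lambda>x. m (q (x - y))" and g = g and \<Phi> = \<Phi> and s =
          s, OF g \<Phi> \<Phi>_bd d\<Phi>_bd _ _ _ _ _ mq wq _ _ int(1) int_D])
    show "continuous_on UNIV (F i)" for i
      unfolding F_def[abs_def] by (intro continuous_intros cbq)
    show "continuous_on UNIV (dF k i)" for k i
      unfolding dF_def[abs_def] by (intro continuous_intros cbq)
    show "has_dd (axis k 1) (F i) (dF k i x) x" for k i x
    proof -
      have 1: "has_dd (axis k 1) (\<lambda>x. x \<bullet> axis i 1) (axis k 1 \<bullet> axis i (1::real))
          (x - y)"
        by (rule has_dd_inner)
      have 2: "has_dd (axis k 1) q (2 * ((x - y) \<bullet> axis k 1)) (x - y)"
        unfolding q_def using has_dd_add[OF has_dd_inner_self has_dd_const] by fastforce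
      show ?thesis
        using has_dd_diff_arg[OF has_dd_mult[OF 1 has_dd_chain[where h = q, OF b[OF q(2)] 2]]]
        by (simp add: F_def[abs_def] dF_def inner_axis)
    qed
    show "\<bar>F i x\<bar> \<le> m (q (x - y))" for i x
    proof -
      have "\<bar>(x - y) $ i\<bar> \<le> sqrt (q (x - y))"
        using component_le_norm_cart[of "x - y" i] q(3)[of "x - y"]
        by (simp add: norm_eq_sqrt_inner real_sqrt_le_mono order_trans del: vector_minus_component)
      then have "\<bar>F i x\<bar> \<le> sqrt (q (x - y)) * b (q (x - y))"
        unfolding F_def abs_mult using sgn(1)[OF q(2)] by (intro mult_mono) (auto simp: q(2) less_imp_le)
      also have "\<dots> \<le> m (q (x - y))" by (rule m(1)[OF q(2)])
      finally show ?thesis .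
    qed
    show "m (q (x - y)) \<le> B" for x by (rule m(2)[OF q(1)])
    show "0 \<le> w (q (x - y))" for x by (rule w0[OF q(2)])
    show "w (q (x - y)) \<le> s * (\<Sum>k\<in>UNIV. dF k k x) - \<kappa> * (\<Sum>k\<in>UNIV.
        \<Sum>i\<in>UNIV. \<bar>dF k i x\<bar>)" for x
    proof -
      define z where "z = x - y"
      define u where "u = q z"
      have u: "0 < u" "z \<bullet> z \<le> u" unfolding u_def by (rule q)+
      have "(\<Sum>k\<in>UNIV. dF k k x) = n * b u + 2 * (z \<bullet> z) * b' u"
      proof -
        have "dF k k x = b u + (2 * b' u) * (z $ k * z $ k)" for k
          unfolding dF_def z_def[symmetric] u_def[symmetric] by (simp add: inner_axis inner_axis_axis)
        then show ?thesis
          by (simp only: sum.distrib sum_distrib_left[symmetric]) (simp add: inner_vec_def n_def)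
      qed
      moreover have "u * b' u \<le> (z \<bullet> z) * b' u"
        using u sgn(2)[OF u(1)] by (intro mult_right_mono_neg)
      ultimately have 1: "s * (n * b u + 2 * u * b' u) \<le> s * (\<Sum>k\<in>UNIV. dF k k x)"
        using s by (intro mult_left_mono) auto
      have "\<bar>dF k i x\<bar> \<le> b u - 2 * u * b' u" for k i
      proof -
        have "\<bar>dF k i x\<bar> \<le> \<bar>(axis k 1 \<bullet> axis i (1::real)) * b u\<bar> + \<bar>z
            $ i * (b' u * (2 * (z \<bullet> axis k 1)))\<bar>"
          unfolding dF_def z_def[symmetric] u_def[symmetric] by (rule abs_triangle_ineq)
        also have "\<bar>(axis k 1 \<bullet> axis i (1::real)) * b u\<bar> \<le> b u"
          using sgn(1)[OF u(1)] by (simp add: inner_axis_axis)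
        also have "\<bar>z $ i * (b' u * (2 * (z \<bullet> axis k 1)))\<bar> = 2 * \<bar>z $ i * z $
            k\<bar> * (- b' u)"
          using sgn(2)[OF u(1)] by (simp add: inner_axis abs_mult)
        also have "\<dots> \<le> 2 * u * (- b' u)"
          using component_le_inner_self[of z i k] u sgn(2)[OF u(1)] by (intro mult_right_mono) auto
        finally show ?thesis by simp
      qed
      then have "(\<Sum>k\<in>UNIV. \<Sum>i\<in>UNIV. \<bar>dF k i x\<bar>) \<le> (\<Sum>k\<in>(UNIV::'n
          set). \<Sum>i\<in>(UNIV::'n set). b u - 2 * u * b' u)"
        by (intro sum_mono)
      also have "\<dots> = n\<^sup>2 * (b u - 2 * u * b' u)" by (simp add: n_def power2_eq_square)
      finally have 2: "\<kappa> * (\<Sum>k\<in>UNIV. \<Sum>i\<in>UNIV. \<bar>dF k i x\<bar>) \<le> \<kappa>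
          * (n\<^sup>2 * (b u - 2 * u * b' u))"
        using \<kappa>0 by (rule mult_left_mono)
      show ?thesis using w[OF u(1)] 1 2 unfolding z_def[symmetric] u_def[symmetric] by linarith
    qed
  qed
  also have "\<dots> \<le> (\<integral>\<^sup>+z. (\<Sum>i\<in>UNIV. ennreal (m (q (fst z - y)) * \<bar>H1
      i z\<bar>) + ennreal (m (q (fst z - y)) * \<bar>H2 i z\<bar>))
        + ennreal (m (q (fst z - y)) * \<bar>g z\<bar>) \<partial>lborel)"
  proof (rule nn_integral_mono)
    fix z :: "(real^'n) \<times> (real^'n)"
    let ?m = "m (q (fst z - y))"
    have m0': "0 \<le> ?m" by (rule m0[OF q(2)])
    have "(real CARD('n))\<^sup>2 * K \<le> 3\<^sup>2 * (1 / 9)"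
      using n n0 K K0 unfolding n_def by (intro mult_mono power_mono) auto
    then have "(real CARD('n))\<^sup>2 * K * \<bar>g z\<bar> \<le> \<bar>g z\<bar>" using
        mult_right_mono[of _ 1 "\<bar>g z\<bar>"] by simp
    moreover have "(\<Sum>i\<in>UNIV. \<bar>H1 i z + H2 i z\<bar>) \<le> (\<Sum>i\<in>UNIV. \<bar>H1 i
        z\<bar> + \<bar>H2 i z\<bar>)" by (intro sum_mono) auto
    ultimately have "?m * ((\<Sum>i\<in>UNIV. \<bar>H1 i z + H2 i z\<bar>) + (real CARD('n))\<^sup>2 * K *
        \<bar>g z\<bar>)
        \<le> ?m * ((\<Sum>i\<in>UNIV. \<bar>H1 i z\<bar> + \<bar>H2 i z\<bar>) + \<bar>g z\<bar>)"
      using m0' by (intro mult_left_mono add_mono) auto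
    also have "\<dots> = (\<Sum>i\<in>UNIV. ?m * \<bar>H1 i z\<bar> + ?m * \<bar>H2 i z\<bar>) + ?m *
        \<bar>g z\<bar>"
      by (simp add: distrib_left sum_distrib_left)
    finally have "ennreal (?m * ((\<Sum>i\<in>UNIV. \<bar>H1 i z + H2 i z\<bar>) + (real CARD('n))\<^sup>2
        * K * \<bar>g z\<bar>))
        \<le> ennreal ((\<Sum>i\<in>UNIV. ?m * \<bar>H1 i z\<bar> + ?m * \<bar>H2 i z\<bar>) + ?m * \<bar>g
            z\<bar>)" by (rule ennreal_leI)
    also have "\<dots> = (\<Sum>i\<in>UNIV. ennreal (?m * \<bar>H1 i z\<bar>) + ennreal (?m * \<bar>H2 i
        z\<bar>)) + ennreal (?m * \<bar>g z\<bar>)"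
      using m0' by (simp add: ennreal_plus[symmetric] sum_nonneg sum_ennreal del: ennreal_plus)
    finally show "ennreal (?m * ((\<Sum>i\<in>UNIV. \<bar>s * dd (axis i 1, 0) g z + dd (0, axis i 1) g z
                    - (\<Sum>k\<in>UNIV. \<Phi> i k z * dd (axis k 1, 0) g z)\<bar>) + (real
                        CARD('n))\<^sup>2 * K * \<bar>g z\<bar>))
       \<le> (\<Sum>i\<in>UNIV. ennreal (?m * \<bar>H1 i z\<bar>) + ennreal (?m * \<bar>H2 i z\<bar>)) +
           ennreal (?m * \<bar>g z\<bar>)"
      by (simp only: D)
  qed
  also have "\<dots> = (\<Sum>i\<in>UNIV. (\<integral>\<^sup>+z. ennreal (m (q (fst z - y)) * \<bar>H1 i
      z\<bar>) \<partial>lborel)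
        + (\<integral>\<^sup>+z. ennreal (m (q (fst z - y)) * \<bar>H2 i z\<bar>) \<partial>lborel))
        + (\<integral>\<^sup>+z. ennreal (m (q (fst z - y)) * \<bar>g z\<bar>) \<partial>lborel)"
    by (simp add: nn_integral_add nn_integral_sum)
  also have "\<dots> \<le> (\<Sum>i\<in>(UNIV::'n set). a + a) + a"
    by (intro add_mono sum_mono a) auto
  also have "\<dots> = of_nat (2 * CARD('n) + 1) * a"
    by (simp add: mult_2 distrib_left distrib_right add.assoc)
  also have "\<dots> \<le> of_nat 7 * a"
    using n unfolding n_def by (intro mult_right_mono of_nat_mono) auto
  finally show ?thesis by simp
qed

lemma continuous_on_pos_measurable:
  fixes h :: "real \<Rightarrow> real"
  assumes "continuous_on {0<..} h"
  shows "(\<lambda>u. if 0 < u then h u else 0) \<in> borel_measurable borel"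
  using borel_measurable_continuous_on_if[of "{0<..}" h "\<lambda>_. 0"] assms by (simp add:
      greaterThan_iff)

type_synonym 'n phase = "(real, 'n) vec \<times> (real, 'n) vec"

locale modified_family =
  fixes G :: "('n::{finite,linorder}) vf list \<Rightarrow> 'n phase \<Rightarrow> real"
    and \<Phi> :: "'n \<Rightarrow> 'n \<Rightarrow> 'n phase \<Rightarrow> real"
    and N :: nat and s \<kappa> K \<epsilon> :: real
  assumes G_CE: "\<And>\<alpha>. \<alpha> \<in> multi_indices N \<Longrightarrow> length \<alpha> < N
      \<Longrightarrow> CE 1 (G \<alpha>)"
    and G_int: "\<And>\<alpha>. \<alpha> \<in> multi_indices N \<Longrightarrow> integrable lborel (G
        \<alpha>)"
    and G_L1: "\<And>\<alpha>. \<alpha> \<in> multi_indices N \<Longrightarrow> (\<integral>\<^sup>+z.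
        ennreal \<bar>G \<alpha> z\<bar> \<partial>lborel) \<le> ennreal (2 * \<epsilon>)"
    and G_step: "\<And>\<alpha> i z. \<alpha> \<in> multi_indices N \<Longrightarrow> length \<alpha> < N
        \<Longrightarrow>
        s * dd (axis i 1, 0) (G \<alpha>) z + dd (0, axis i 1) (G \<alpha>) z
          - (\<Sum>k\<in>UNIV. \<Phi> i k z * dd (axis k 1, 0) (G \<alpha>) z) = G (Trans i # \<alpha>) z +
              G (Gal i # \<alpha>) z"
    and \<Phi>: "\<And>i k. CE 1 (\<Phi> i k)"
    and \<Phi>_bd: "\<And>i k z. \<bar>\<Phi> i k z\<bar> \<le> \<kappa>" and d\<Phi>_bd: "\<And>i k z.
        \<bar>dd (axis k 1, 0) (\<Phi> i k) z\<bar> \<le> K"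
    and dim: "CARD('n) \<le> 3" "CARD('n) \<ge> 2" and K: "K \<le> 1 / 9" and s: "1 \<le> s" and \<kappa>:
        "\<kappa> \<le> sqrt s / 54"
    and \<epsilon>: "0 \<le> \<epsilon>"
begin

lemma Cons_multi:
  assumes "\<alpha> \<in> multi_indices N" "length \<alpha> < N"
  shows "Trans i # \<alpha> \<in> multi_indices N" "Gal i # \<alpha> \<in> multi_indices N"
  using assms by (auto simp: multi_indices_def vfs_def)

text \<open>Trades one derivative for one power of the weight and a factor \<open>1 / s\<close>.\<close>

lemma step:
  fixes b b' m w :: "real \<Rightarrow> real" and a \<eta> B :: real
  assumes \<alpha>: "\<alpha> \<in> multi_indices N" "length \<alpha> < N" and \<eta>: "0 < \<eta>"
    and b: "\<And>u. 0 < u \<Longrightarrow> (b has_real_derivative b' u) (at u)" and b': "continuous_on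
        {0<..} b'"
    and sgn: "\<And>u. 0 < u \<Longrightarrow> 0 \<le> b u" "\<And>u. 0 < u \<Longrightarrow> b' u \<le> 0"
    and m: "\<And>u. 0 < u \<Longrightarrow> sqrt u * b u \<le> m u" "\<And>u. \<eta>\<^sup>2 \<le> u
        \<Longrightarrow> m u \<le> B"
    and cont: "continuous_on {0<..} m" "continuous_on {0<..} w"
    and w0: "\<And>u. 0 < u \<Longrightarrow> 0 \<le> w u"
    and w: "\<And>u. 0 < u \<Longrightarrow> s / 2 * w u \<le> s * (real CARD('n) * b u + 2 * u * b' u)
              - \<kappa> * ((real CARD('n))\<^sup>2 * (b u - 2 * u * b' u))"
    and a0: "0 \<le> a" and a: "\<And>\<beta>. \<beta> \<in> multi_indices N \<Longrightarrow> length
        \<beta> \<le> Suc (length \<alpha>) \<Longrightarrow>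
      (\<integral>\<^sup>+z. ennreal (m ((fst z - y) \<bullet> (fst z - y) + \<eta>\<^sup>2) * \<bar>G
          \<beta> z\<bar>) \<partial>lborel) \<le> ennreal a"
  shows "(\<integral>\<^sup>+z. ennreal (w ((fst z - y) \<bullet> (fst z - y) + \<eta>\<^sup>2) * \<bar>G
      \<alpha> z\<bar>) \<partial>lborel) \<le> ennreal (14 * a / s)"
proof -
  define q where "q x = (x - y) \<bullet> (x - y) + \<eta>\<^sup>2" for x :: "(real, 'n) vec"
  have pos: "0 < x \<bullet> x + \<eta>\<^sup>2" for x :: "(real, 'n) vec" using \<eta> by (simp add:
      add_nonneg_pos)
  have q: "0 < q x" for x unfolding q_def by (rule pos)
  have cq: "continuous_on UNIV q" unfolding q_def[abs_def] by (intro continuous_intros)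
  have [measurable]: "(\<lambda>x. w (q x)) \<in> borel_measurable borel"
    by (intro borel_measurable_continuous_onI continuous_on_compose2[OF cont(2) cq]) (auto simp: q)
  have [measurable]: "G \<alpha> \<in> borel_measurable borel"
    using G_int[OF \<alpha>(1)] by (auto dest: borel_measurable_integrable)
  define W where "W u = s / 2 * w u" for u
  have W: "continuous_on {0<..} W" "\<And>u. 0 < u \<Longrightarrow> 0 \<le> W u"
    "\<And>u. 0 < u \<Longrightarrow> W u \<le> s * (real CARD('n) * b u + 2 * u * b' u)
              - \<kappa> * ((real CARD('n))\<^sup>2 * (b u - 2 * u * b' u))"
    unfolding W_def[abs_def] using w w0 s by (auto intro!: continuous_intros cont simp del:
        times_divide_eq_left)
  have "0 < u" if "\<eta>\<^sup>2 \<le> u" for u using that \<eta> by (meson less_le_trans zero_less_power)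
  then have "(\<integral>\<^sup>+z. ennreal ((if 0 < (fst z - y) \<bullet> (fst z - y) + \<eta>\<^sup>2
      then W ((fst z - y) \<bullet> (fst z - y) + \<eta>\<^sup>2) else 0) * \<bar>G \<alpha> z\<bar>)
          \<partial>lborel) \<le> 7 * ennreal a"
    using dim s K Cons_multi[OF \<alpha>] \<alpha>
    by (intro radial_L1_estimate[where \<Phi> = \<Phi> and b = b and b' = b' and s = s and \<kappa> =
        \<kappa> and K = K and
        m = "\<lambda>u. if 0 < u then m u else 0" and w = "\<lambda>u. if 0 < u then W u else 0" and B = B
            and
        ?H1.0 = "\<lambda>i. G (Trans i # \<alpha>)" and ?H2.0 = "\<lambda>i. G (Gal i # \<alpha>)"]
        G_CE \<Phi> \<Phi>_bd d\<Phi>_bd \<eta> b b' sgn continuous_on_pos_measurable cont(1) W(1) G_step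
            G_int)
      (auto simp: m W pos intro!: a)
  then have "ennreal (2 / s) * (\<integral>\<^sup>+z. ennreal (s / 2 * w (q (fst z)) * \<bar>G \<alpha>
      z\<bar>) \<partial>lborel) \<le> ennreal (2 / s) * (7 * ennreal a)"
    by (intro mult_left_mono) (simp_all add: pos q_def W_def)
  also have "ennreal (2 / s) * (\<integral>\<^sup>+z. ennreal (s / 2 * w (q (fst z)) * \<bar>G \<alpha>
      z\<bar>) \<partial>lborel)
      = (\<integral>\<^sup>+z. ennreal (2 / s) * ennreal (s / 2 * w (q (fst z)) * \<bar>G \<alpha> z\<bar>)
          \<partial>lborel)"
    by (rule nn_integral_cmult[symmetric]) measurable
  also have "\<dots> = (\<integral>\<^sup>+z. ennreal (w (q (fst z)) * \<bar>G \<alpha> z\<bar>)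
      \<partial>lborel)"
    using s by (intro nn_integral_cong) (simp add: ennreal_mult'[symmetric])
  also have "ennreal (2 / s) * (7 * ennreal a) = ennreal (14 * a / s)"
  proof -
    have 7: "7 * ennreal a = ennreal (7 * a)" using a0 by (simp add: ennreal_mult)
    show ?thesis unfolding 7 using s a0 by (simp add: ennreal_mult'[symmetric])
  qed
  finally show ?thesis by (simp add: q_def)
qed

lemma \<kappa>_le: "\<kappa> \<le> s / 54" "sqrt s \<le> s"
proof -
  show "sqrt s \<le> s" using s by (simp add: real_le_lsqrt power2_eq_square)
  then show "\<kappa> \<le> s / 54" using \<kappa> by simp
qed

lemma \<kappa>_dim: "\<kappa> * (real CARD('n))\<^sup>2 \<le> s / 6"
proof -
  have "(real CARD('n))\<^sup>2 \<le> 3\<^sup>2" using dim by (intro power_mono) auto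
  moreover have "0 \<le> \<kappa>" by (rule order_trans[OF abs_ge_zero \<Phi>_bd])
  ultimately have "\<kappa> * (real CARD('n))\<^sup>2 \<le> s / 54 * 9" using \<kappa>_le by (intro
      mult_mono) auto
  then show ?thesis by simp
qed

lemma weight1:
  assumes \<alpha>: "\<alpha> \<in> multi_indices N" "length \<alpha> < N" and \<eta>: "0 < \<eta>"
  shows "(\<integral>\<^sup>+z. ennreal (1 / sqrt ((fst z - y) \<bullet> (fst z - y) + \<eta>\<^sup>2) *
      \<bar>G \<alpha> z\<bar>) \<partial>lborel) \<le> ennreal (28 * \<epsilon> / s)"
proof -
  let ?n = "real CARD('n)"
  have "(\<integral>\<^sup>+z. ennreal (1 / sqrt ((fst z - y) \<bullet> (fst z - y) + \<eta>\<^sup>2) *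
      \<bar>G \<alpha> z\<bar>) \<partial>lborel) \<le> ennreal (14 * (2 * \<epsilon>) / s)"
  proof (rule step[where b = "\<lambda>u. 1 / sqrt u" and b' = "\<lambda>u. - 1 / (2 * u * sqrt u)" and m =
      "\<lambda>u. 1" and B = 1
        and w = "\<lambda>u. 1 / sqrt u", OF \<alpha> \<eta>])
    show "((\<lambda>u. 1 / sqrt u) has_real_derivative - 1 / (2 * u * sqrt u)) (at u)" if "0 < u" for u
      using that by (auto intro!: derivative_eq_intros simp: field_simps power2_eq_square)
    show "s / 2 * (1 / sqrt u) \<le> s * (?n * (1 / sqrt u) + 2 * u * (- 1 / (2 * u * sqrt u)))
        - \<kappa> * (?n\<^sup>2 * (1 / sqrt u - 2 * u * (- 1 / (2 * u * sqrt u))))" if "0 < u" for u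
    proof -
      have "s * 2 \<le> s * ?n" using dim s by (intro mult_left_mono) auto
      then have "s / 2 \<le> s * (?n - 1) - \<kappa> * ?n\<^sup>2 * 2"
        using \<kappa>_dim s unfolding right_diff_distrib by linarith
      then have "s / 2 / sqrt u \<le> (s * (?n - 1) - \<kappa> * ?n\<^sup>2 * 2) / sqrt u"
        using that by (intro divide_right_mono) auto
      also have "\<dots> = s * (?n * (1 / sqrt u) + 2 * u * (- 1 / (2 * u * sqrt u)))
        - \<kappa> * (?n\<^sup>2 * (1 / sqrt u - 2 * u * (- 1 / (2 * u * sqrt u))))"
      proof -
        obtain r where r: "0 < r" "u = r\<^sup>2" using \<open>0 < u\<close> by (metis real_sqrt_gt_zero
            real_sqrt_pow2 less_imp_le)
        then have "sqrt u = r" by simp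
        then show ?thesis using r by (simp add: field_simps power2_eq_square)
      qed
      finally show ?thesis by simp
    qed
  qed (use \<epsilon> in \<open>auto intro!: continuous_intros G_L1\<close>)
  then show ?thesis by simp
qed

lemma weight2:
  assumes \<alpha>: "\<alpha> \<in> multi_indices N" "Suc (length \<alpha>) < N" and \<eta>: "0 < \<eta>"
      and n3: "CARD('n) = 3"
  shows "(\<integral>\<^sup>+z. ennreal (1 / ((fst z - y) \<bullet> (fst z - y) + \<eta>\<^sup>2) * \<bar>G
      \<alpha> z\<bar>) \<partial>lborel) \<le> ennreal (812 * \<epsilon> / s\<^sup>2)"
proof -
  have "(\<integral>\<^sup>+z. ennreal (1 / ((fst z - y) \<bullet> (fst z - y) + \<eta>\<^sup>2) * \<bar>G
      \<alpha> z\<bar>) \<partial>lborel) \<le> ennreal (14 * (28 * \<epsilon> / s) / s)"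
  proof (rule step[where b = "\<lambda>u. 1 / u" and b' = "\<lambda>u. - 1 / u\<^sup>2" and m =
      "\<lambda>u. 1 / sqrt u" and B = "1 / \<eta>"
        and w = "\<lambda>u. 1 / u", OF \<alpha>(1) _ \<eta>])
    show "((\<lambda>u. 1 / u) has_real_derivative - 1 / u\<^sup>2) (at u)" if "0 < u" for u
      using that by (auto intro!: derivative_eq_intros simp: field_simps power2_eq_square)
    show "sqrt u * (1 / u) \<le> 1 / sqrt u" if "0 < u" for u
      using that by (simp add: field_simps flip: power2_eq_square)
    show "1 / sqrt u \<le> 1 / \<eta>" if "\<eta>\<^sup>2 \<le> u" for u
      using that \<eta> by (simp add: frac_le real_le_rsqrt)
    show "s / 2 * (1 / u) \<le> s * (real CARD('n) * (1 / u) + 2 * u * (- 1 / u\<^sup>2))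
        - \<kappa> * ((real CARD('n))\<^sup>2 * (1 / u - 2 * u * (- 1 / u\<^sup>2)))" if "0 < u" for u
    proof -
      have "s / 2 \<le> s - \<kappa> * 9 * 3" using \<kappa>_le s by simp
      then have "s / 2 / u \<le> (s - \<kappa> * 9 * 3) / u" using that by (intro divide_right_mono) auto
      then show ?thesis using that n3 by (simp add: field_simps power2_eq_square)
    qed
    show "(\<integral>\<^sup>+z. ennreal (1 / sqrt ((fst z - y) \<bullet> (fst z - y) + \<eta>\<^sup>2) *
        \<bar>G \<beta> z\<bar>) \<partial>lborel) \<le> ennreal (28 * \<epsilon> / s)"
      if "\<beta> \<in> multi_indices N" "length \<beta> \<le> Suc (length \<alpha>)" for \<beta>
      using that \<alpha> by (intro weight1 \<eta>) auto
  qed (use \<epsilon> s \<alpha> in \<open>auto intro!: continuous_intros\<close>)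
  also have "\<dots> \<le> ennreal (812 * \<epsilon> / s\<^sup>2)"
    using \<epsilon> s by (intro ennreal_leI) (simp add: power2_eq_square divide_right_mono)
  finally show ?thesis .
qed

text \<open>The first term of the multiplier \<open>b\<close> produces the weight.  Its gradient decays more slowly than
  its divergence, so that the coefficients \<open>\<Phi> = O(s\<^sup>1\<^sup>/\<^sup>2)\<close> cause an
      error which is absorbed by the second term.\<close>

lemma weight2_yukawa:
  assumes \<alpha>: "\<alpha> \<in> multi_indices N" "Suc (length \<alpha>) < N" and \<eta>: "0 < \<eta>"
      and n2: "CARD('n) = 2"
  shows "(\<integral>\<^sup>+z. ennreal (1 / (sqrt ((fst z - y) \<bullet> (fst z - y) + \<eta>\<^sup>2) *
            (1 + sqrt ((fst z - y) \<bullet> (fst z - y) + \<eta>\<^sup>2))\<^sup>2) * \<bar>G \<alpha>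
                z\<bar>) \<partial>lborel) \<le> ennreal (812 * \<epsilon> / s\<^sup>2)"
proof -
  define b where "b u = 1 / (sqrt u * (1 + sqrt u)) + 1 / (sqrt s * (sqrt u * sqrt (sqrt u)))" for u
  define b' where "b' u = - (1 / (2 * u)) * ((1 + 2 * sqrt u) / (sqrt u * (1 + sqrt u)\<^sup>2)
      + 3 / 2 / (sqrt s * (sqrt u * sqrt (sqrt u))))" for u
  define m where "m u = 2 / sqrt u + 1 / s" for u
  define w where "w u = 1 / (sqrt u * (1 + sqrt u)\<^sup>2)" for u
  have s0: "0 < s" "0 < sqrt s" using s by auto
  have "(\<integral>\<^sup>+z. ennreal (w ((fst z - y) \<bullet> (fst z - y) + \<eta>\<^sup>2) * \<bar>G
      \<alpha> z\<bar>) \<partial>lborel) \<le> ennreal (14 * (58 * \<epsilon> / s) / s)"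
  proof (rule step[where b = b and b' = b' and m = m and B = "2 / \<eta> + 1 / s" and w = w, OF \<alpha>(1)
      _ \<eta>])
    fix u :: real assume u: "0 < u"
    define q where "q = sqrt (sqrt u)"
    have q: "0 < q" "sqrt u = q\<^sup>2" "sqrt (sqrt u) = q" using u by (auto simp: q_def)
    have "u = (sqrt u)\<^sup>2" using u by simp
    then have uq: "u = q ^ 4" unfolding q by simp
    define S where "S = sqrt s"
    have S: "1 \<le> S" "s = S\<^sup>2" using s by (auto simp: S_def)
    have q1: "0 < 1 + q\<^sup>2" by (simp add: add_pos_nonneg)
    have bq: "b u = 1 / (q\<^sup>2 * (1 + q\<^sup>2)) + 1 / (S * q ^ 3)"
      using q(1) by (simp add: b_def q(2) S_def power3_eq_cube power2_eq_square mult_ac)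
    have b'q: "2 * u * b' u = - ((1 + 2 * q\<^sup>2) / (q\<^sup>2 * (1 + q\<^sup>2)\<^sup>2) + 3 / 2 / (S *
        q ^ 3))"
    proof -
      have "2 * u * (- (1 / (2 * u)) * X) = - X" for X using u by simp
      moreover have "sqrt u * sqrt (sqrt u) = q ^ 3" using q by (simp add: power3_eq_cube power2_eq_square)
      ultimately show ?thesis unfolding b'_def S_def q(2)[symmetric] by simp
    qed
    have wq: "w u = 1 / (q\<^sup>2 * (1 + q\<^sup>2)\<^sup>2)" by (simp add: w_def q)
    show "(b has_real_derivative b' u) (at u)"
    proof -
      have d1: "((\<lambda>u. sqrt u) has_real_derivative 1 / (2 * q\<^sup>2)) (at u)"
        using u by (auto intro!: derivative_eq_intros simp: q field_simps)
      have d2: "((\<lambda>u. sqrt (sqrt u)) has_real_derivative 1 / (4 * q ^ 3)) (at u)"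
      proof -
        have "(sqrt has_real_derivative 1 / (2 * q)) (at (sqrt u))"
          using DERIV_real_sqrt[of "sqrt u"] u by (simp add: q(3) field_simps)
        from DERIV_chain2[OF this d1] show ?thesis
          by (simp add: power2_eq_square power3_eq_cube mult.assoc)
      qed
      have d3: "((\<lambda>u. inverse (sqrt u * (1 + sqrt u))) has_real_derivative
          - (inverse (q\<^sup>2 * (1 + q\<^sup>2)) * (1 / (2 * q\<^sup>2) * (1 + q\<^sup>2) + (0 + 1 / (2 *
              q\<^sup>2)) * q\<^sup>2) * inverse (q\<^sup>2 * (1 + q\<^sup>2)))) (at u)"
      proof (rule DERIV_cong[OF DERIV_inverse'[OF DERIV_mult[OF d1 DERIV_add[OF DERIV_const d1]]]])
        show "sqrt u * (1 + sqrt u) \<noteq> 0" using u by (simp add: add_pos_pos less_imp_neq[symmetric])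
      qed (simp only: q(2))
      have d4: "((\<lambda>u. inverse (sqrt s * (sqrt u * sqrt (sqrt u)))) has_real_derivative
          - (inverse (S * (q\<^sup>2 * q)) * (S * (1 / (2 * q\<^sup>2) * q + 1 / (4 * q ^ 3) * q\<^sup>2))
              * inverse (S * (q\<^sup>2 * q)))) (at u)"
      proof (rule DERIV_cong[OF DERIV_inverse'[OF DERIV_cmult[OF DERIV_mult[OF d1 d2]]]])
        show "sqrt s * (sqrt u * sqrt (sqrt u)) \<noteq> 0" using u s0 by simp
      qed (simp only: q(3) S_def, simp only: q(2))
      define A where "A = - (inverse (q\<^sup>2 * (1 + q\<^sup>2)) * (1 / (2 * q\<^sup>2) * (1 + q\<^sup>2)
          + (0 + 1 / (2 * q\<^sup>2)) * q\<^sup>2) * inverse (q\<^sup>2 * (1 + q\<^sup>2)))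
         + - (inverse (S * (q\<^sup>2 * q)) * (S * (1 / (2 * q\<^sup>2) * q + 1 / (4 * q ^ 3) * q\<^sup>2))
             * inverse (S * (q\<^sup>2 * q)))"
      have "2 * u * A = 2 * u * b' u"
        unfolding b'q unfolding uq A_def using q(1) q1 S by (simp add: divide_simps) (simp add:
            algebra_simps eval_nat_numeral)
      then have "A = b' u" using u by simp
      then have "b' u = - (inverse (q\<^sup>2 * (1 + q\<^sup>2)) * (1 / (2 * q\<^sup>2) * (1 + q\<^sup>2) +
          (0 + 1 / (2 * q\<^sup>2)) * q\<^sup>2) * inverse (q\<^sup>2 * (1 + q\<^sup>2)))
         + - (inverse (S * (q\<^sup>2 * q)) * (S * (1 / (2 * q\<^sup>2) * q + 1 / (4 * q ^ 3) * q\<^sup>2))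
             * inverse (S * (q\<^sup>2 * q)))" by (simp only: A_def)
      from DERIV_add[OF d3 d4, folded this] show ?thesis unfolding b_def[abs_def] inverse_eq_divide .
    qed
    show "0 \<le> b u" "b' u \<le> 0" "0 \<le> w u"
      unfolding b_def b'_def w_def using u s0 by (auto intro!: mult_nonpos_nonneg divide_nonneg_nonneg
          add_nonneg_nonneg)
    show "sqrt u * b u \<le> m u"
    proof -
      have "0 \<le> (1 / S - 1 / q)\<^sup>2" by simp
      then have "2 * (1 / S * (1 / q)) \<le> 1 / s + 1 / q\<^sup>2"
        by (simp add: power2_diff S power_divide)
      moreover have "0 \<le> 1 / S * (1 / q)" using S q(1) by simp
      ultimately have "1 / S * (1 / q) \<le> 1 / s + 1 / q\<^sup>2" by linarith
      moreover have "1 / (1 + q\<^sup>2) \<le> 1 / q\<^sup>2" using q(1) q1 by (intro divide_left_mono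
          mult_pos_pos) auto
      moreover have "sqrt u * b u = 1 / (1 + q\<^sup>2) + 1 / S * (1 / q)"
      proof -
        have "q\<^sup>2 * (1 / (q\<^sup>2 * (1 + q\<^sup>2))) = 1 / (1 + q\<^sup>2)" using q(1) by simp
        moreover have "q\<^sup>2 * (1 / (S * q ^ 3)) = 1 / S * (1 / q)"
          using q(1) by (simp add: power2_eq_square power3_eq_cube)
        ultimately show ?thesis
          by (simp only: bq q(2) distrib_left[of "q\<^sup>2" "1 / (q\<^sup>2 * (1 + q\<^sup>2))"])
      qed
      ultimately show ?thesis by (simp add: m_def q)
    qed
    show "s / 2 * w u \<le> s * (real CARD('n) * b u + 2 * u * b' u)
        - \<kappa> * ((real CARD('n))\<^sup>2 * (b u - 2 * u * b' u))"
    proof -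
      define W where "W = 1 / (q\<^sup>2 * (1 + q\<^sup>2)\<^sup>2)"
      define V where "V = 1 / q ^ 3"
      have WV: "0 \<le> W" "0 \<le> V" using q(1) by (auto simp: W_def V_def)
      have e1: "1 / (q\<^sup>2 * (1 + q\<^sup>2)) = (1 + q\<^sup>2) * W" "(1 + 2 * q\<^sup>2) / (q\<^sup>2
          * (1 + q\<^sup>2)\<^sup>2) = (1 + 2 * q\<^sup>2) * W"
        "1 / (S * q ^ 3) = V / S" "3 / 2 / (S * q ^ 3) = 3 / 2 * (V / S)"
        using q(1) q1 S by (auto simp: W_def V_def power2_eq_square)
      have "(1 + q\<^sup>2) * W \<le> V / 2"
      proof -
        have "0 \<le> (q - 1)\<^sup>2" by simp
        then have "2 * q \<le> 1 + q\<^sup>2" by (simp add: power2_diff)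
        then have "q\<^sup>2 * (2 * q) \<le> q\<^sup>2 * (1 + q\<^sup>2)" by (intro mult_left_mono) auto
        then have "1 / (q\<^sup>2 * (1 + q\<^sup>2)) \<le> 1 / (q\<^sup>2 * (2 * q))"
          using q(1) q1 by (intro divide_left_mono mult_pos_pos) auto
        then show ?thesis unfolding e1(1) V_def by (simp add: power3_eq_cube power2_eq_square mult_ac)
      qed
      moreover have "(1 + 2 * q\<^sup>2) * W \<le> 2 * ((1 + q\<^sup>2) * W)" using WV(1) by (simp add:
          algebra_simps)
      moreover have "V / S \<le> V" using WV S by (simp add: divide_le_eq_1 pos_divide_le_eq
          mult_le_cancel_left1)
      ultimately have d: "b u - 2 * u * b' u \<le> 4 * V" unfolding bq b'q e1 by linarith
      have "\<kappa> * (b u - 2 * u * b' u) \<le> S / 54 * (4 * V)"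
      proof -
        have "\<kappa> * (b u - 2 * u * b' u) \<le> \<kappa> * (4 * V)"
          using d order_trans[OF abs_ge_zero \<Phi>_bd] by (intro mult_left_mono)
        also have "\<dots> \<le> S / 54 * (4 * V)" using \<kappa> WV by (intro mult_right_mono) (auto simp:
            S_def)
        finally show ?thesis .
      qed
      moreover have "s * (2 * b u + 2 * u * b' u) = s * W + S * V / 2"
        unfolding bq b'q e1 using S by (simp add: algebra_simps power2_eq_square)
      moreover have "0 \<le> S * V" "0 \<le> s * W" using S s WV by auto
      moreover have "\<kappa> * (2\<^sup>2 * (b u - 2 * u * b' u)) = 4 * (\<kappa> * (b u - 2 * u * b' u))"
          by simp
      moreover have "s / 2 * W = s * W / 2" "S / 54 * (4 * V) = 4 / 54 * (S * V)" by simp_all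
      ultimately show ?thesis unfolding wq W_def[symmetric] n2 of_nat_numeral by linarith
    qed
  next
    show "continuous_on {0<..} b'" "continuous_on {0<..} m" "continuous_on {0<..} w"
      unfolding b'_def[abs_def] m_def[abs_def] w_def[abs_def] using s0
      by (auto intro!: continuous_intros simp: add_nonneg_eq_0_iff add_pos_pos less_imp_neq[symmetric])
    show "m u \<le> 2 / \<eta> + 1 / s" if "\<eta>\<^sup>2 \<le> u" for u
      unfolding m_def using that \<eta> by (simp add: frac_le real_le_rsqrt)
    fix \<beta> :: "'n vf list" assume \<beta>: "\<beta> \<in> multi_indices N" "length \<beta> \<le> Suc
        (length \<alpha>)"
    have "(\<integral>\<^sup>+z. ennreal (m ((fst z - y) \<bullet> (fst z - y) + \<eta>\<^sup>2) * \<bar>G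
        \<beta> z\<bar>) \<partial>lborel)
      = (\<integral>\<^sup>+z. ennreal 2 * ennreal (1 / sqrt ((fst z - y) \<bullet> (fst z - y) +
          \<eta>\<^sup>2) * \<bar>G \<beta> z\<bar>) + ennreal (1 / s) * ennreal \<bar>G \<beta> z\<bar>
              \<partial>lborel)"
    proof (intro nn_integral_cong)
      fix z
      have "ennreal ((2 / r + 1 / s) * c) = ennreal 2 * ennreal (1 / r * c) + ennreal (1 / s) * ennreal c"
        if "0 \<le> r" "0 \<le> c" for r c
      proof -
        have "(2 / r + 1 / s) * c = 2 * (1 / r * c) + 1 / s * c" by (simp add: distrib_right)
        moreover have "ennreal (2 * (1 / r * c) + 1 / s * c) = ennreal (2 * (1 / r * c)) + ennreal (1 / s *
            c)"
          using that s by (intro ennreal_plus) auto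
        moreover have "ennreal (2 * (1 / r * c)) = ennreal 2 * ennreal (1 / r * c)"
          "ennreal (1 / s * c) = ennreal (1 / s) * ennreal c"
          using that s by (intro ennreal_mult; simp)+
        ultimately show ?thesis by presburger
      qed
      then show "ennreal (m ((fst z - y) \<bullet> (fst z - y) + \<eta>\<^sup>2) * \<bar>G \<beta> z\<bar>)
          =
          ennreal 2 * ennreal (1 / sqrt ((fst z - y) \<bullet> (fst z - y) + \<eta>\<^sup>2) * \<bar>G
              \<beta> z\<bar>) + ennreal (1 / s) * ennreal \<bar>G \<beta> z\<bar>"
        unfolding m_def by simp
    qed
    also have "\<dots> = ennreal 2 * (\<integral>\<^sup>+z. ennreal (1 / sqrt ((fst z - y) \<bullet> (fst z
        - y) + \<eta>\<^sup>2) * \<bar>G \<beta> z\<bar>) \<partial>lborel)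
        + ennreal (1 / s) * (\<integral>\<^sup>+z. ennreal \<bar>G \<beta> z\<bar> \<partial>lborel)"
    proof -
      have [measurable]: "G \<beta> \<in> borel_measurable borel"
        using G_int[OF \<beta>(1)] by (auto dest: borel_measurable_integrable)
      have [measurable]: "(\<lambda>x. 1 / sqrt ((x - y) \<bullet> (x - y) + \<eta>\<^sup>2)) \<in>
          borel_measurable borel" by measurable
      show ?thesis by (subst nn_integral_add) (measurable, simp add: nn_integral_cmult)
    qed
    also have "\<dots> \<le> ennreal 2 * ennreal (28 * \<epsilon> / s) + ennreal (1 / s) * ennreal (2 *
        \<epsilon>)"
      using \<beta> \<alpha> by (intro add_mono mult_left_mono weight1 \<eta> G_L1) auto
    also have "\<dots> = ennreal (58 * \<epsilon> / s)"
    proof -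
      have "ennreal 2 * ennreal (28 * \<epsilon> / s) = ennreal (2 * (28 * \<epsilon> / s))"
        "ennreal (1 / s) * ennreal (2 * \<epsilon>) = ennreal (1 / s * (2 * \<epsilon>))"
        using s \<epsilon> by (intro ennreal_mult[symmetric]; simp)+
      moreover have "ennreal (2 * (28 * \<epsilon> / s)) + ennreal (1 / s * (2 * \<epsilon>)) = ennreal (2
          * (28 * \<epsilon> / s) + 1 / s * (2 * \<epsilon>))"
        using s \<epsilon> by (intro ennreal_plus[symmetric]) auto
      moreover have "2 * (28 * \<epsilon> / s) + 1 / s * (2 * \<epsilon>) = 58 * \<epsilon> / s" by (simp
          add: field_simps)
      ultimately show ?thesis by presburger
    qed
    finally show "(\<integral>\<^sup>+z. ennreal (m ((fst z - y) \<bullet> (fst z - y) + \<eta>\<^sup>2) *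
        \<bar>G \<beta> z\<bar>) \<partial>lborel) \<le> ennreal (58 * \<epsilon> / s)" .
  qed (use \<epsilon> s \<alpha> in auto)
  then show ?thesis unfolding w_def by (simp add: power2_eq_square mult_ac)
qed

end

definition wt :: "vlasov_system \<Rightarrow> real^'n \<Rightarrow> real" where
  "wt sys x = (case sys of Vlasov_Poisson \<Rightarrow> 1 / (x \<bullet> x)
     | Vlasov_Yukawa \<Rightarrow> 1 / (norm x * (1 + norm x)\<^sup>2))"

lemma wt_nonneg: "0 \<le> wt sys x"
  by (cases sys) (auto simp: wt_def)

lemma wt_measurable [measurable]: "wt sys \<in> borel_measurable borel"
  by (cases sys) (auto simp: wt_def[abs_def])

context modified_family
begin

lemma wt_L1:
  assumes \<alpha>: "\<alpha> \<in> multi_indices N" "Suc (length \<alpha>) < N"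
    and sys: "(sys = Vlasov_Poisson \<and> CARD('n) = 3) \<or> (sys = Vlasov_Yukawa \<and> CARD('n) = 2)"
  shows "(\<integral>\<^sup>+z. ennreal (wt sys (fst z - y) * \<bar>G \<alpha> z\<bar>) \<partial>lborel)
      \<le> ennreal (812 * \<epsilon> / s\<^sup>2)"
proof -
  define W where "W e x = (case sys of Vlasov_Poisson \<Rightarrow> 1 / (x \<bullet> x + e\<^sup>2)
     | Vlasov_Yukawa \<Rightarrow> 1 / (sqrt (x \<bullet> x + e\<^sup>2) * (1 + sqrt (x \<bullet> x +
         e\<^sup>2))\<^sup>2))" for e :: real and x :: "(real, 'n) vec"
  define e where "e j = inverse (real (Suc j))" for j
  have e: "e \<longlonglongrightarrow> 0" "0 < e j" for j
    unfolding e_def by (rule LIMSEQ_inverse_real_of_nat) simp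
  have [measurable]: "W e \<in> borel_measurable borel" for e
    by (cases sys) (auto simp: W_def[abs_def])
  have [measurable]: "G \<alpha> \<in> borel_measurable borel"
    using G_int[OF \<alpha>(1)] by (auto dest: borel_measurable_integrable)
  have bd: "(\<integral>\<^sup>+z. ennreal (W (e j) (fst z - y) * \<bar>G \<alpha> z\<bar>)
      \<partial>lborel) \<le> ennreal (812 * \<epsilon> / s\<^sup>2)" for j
    using sys weight2[OF \<alpha> e(2)[of j], of y] weight2_yukawa[OF \<alpha> e(2)[of j], of y] by (auto
        simp: W_def)
  have W0: "0 \<le> W r x" for r x by (cases sys) (auto simp: W_def intro!: divide_nonneg_nonneg
      mult_nonneg_nonneg add_nonneg_nonneg)
  have lim: "ennreal (wt sys x * c) \<le> liminf (\<lambda>j. ennreal (W (e j) x * c))" if "0 \<le> c" for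
      x c
  proof (cases "x = 0")
    case True
    then show ?thesis by (cases sys) (auto simp: wt_def)
  next
    case False
    have "(\<lambda>j. W (e j) x) \<longlonglongrightarrow> wt sys x"
    proof (cases sys)
      case Vlasov_Poisson
      have "(\<lambda>j. 1 / (x \<bullet> x + (e j)\<^sup>2)) \<longlonglongrightarrow> 1 / (x \<bullet> x
          + 0\<^sup>2)"
        using False by (intro tendsto_intros e) auto
      then show ?thesis by (simp add: W_def wt_def Vlasov_Poisson)
    next
      case Vlasov_Yukawa
      have "(\<lambda>j. 1 / (sqrt (x \<bullet> x + (e j)\<^sup>2) * (1 + sqrt (x \<bullet> x + (e
          j)\<^sup>2))\<^sup>2)) \<longlonglongrightarrow>
          1 / (sqrt (x \<bullet> x + 0\<^sup>2) * (1 + sqrt (x \<bullet> x + 0\<^sup>2))\<^sup>2)"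
        using False by (intro tendsto_intros e) (auto simp: add_nonneg_eq_0_iff)
      then show ?thesis by (simp add: W_def wt_def Vlasov_Yukawa norm_eq_sqrt_inner)
    qed
    then have "(\<lambda>j. ennreal (W (e j) x * c)) \<longlonglongrightarrow> ennreal (wt sys x * c)"
      by (intro tendsto_ennrealI tendsto_intros)
    then show ?thesis by (simp add: lim_imp_Liminf)
  qed
  have "(\<integral>\<^sup>+z. ennreal (wt sys (fst z - y) * \<bar>G \<alpha> z\<bar>) \<partial>lborel)
      \<le> (\<integral>\<^sup>+z. liminf (\<lambda>j. ennreal (W (e j) (fst z - y) * \<bar>G \<alpha>
          z\<bar>)) \<partial>lborel)"
    by (intro nn_integral_mono lim) auto
  also have "\<dots> \<le> liminf (\<lambda>j. \<integral>\<^sup>+z. ennreal (W (e j) (fst z - y) * \<bar>G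
      \<alpha> z\<bar>) \<partial>lborel)"
    by (intro nn_integral_liminf) measurable
  also have "\<dots> \<le> liminf (\<lambda>j::nat. ennreal (812 * \<epsilon> / s\<^sup>2))"
    by (intro Liminf_mono always_eventually allI bd)
  also have "\<dots> = ennreal (812 * \<epsilon> / s\<^sup>2)" by (simp add: Liminf_const)
  finally show ?thesis .
qed

end

section \<open>The vector fields at a fixed time\<close>

text \<open>Coefficients of the fields: \<open>vcoef 1 t\<close> belongs to the \<open>x\<close>-part, \<open>vcoef 0 1\<close> to the \<open>v\<close>-part.
  All of them are affine with linear part \<open>vcoef 0 0\<close>.\<close>

fun vcoef :: "real \<Rightarrow> real \<Rightarrow> 'n vf \<Rightarrow> real^'n \<Rightarrow> real^'n" where
  "vcoef p q (Trans j) x = p *\<^sub>R axis j 1"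
| "vcoef p q (Gal j) x = q *\<^sub>R axis j 1"
| "vcoef p q (Rot i j) x = (x $ i) *\<^sub>R axis j 1 - (x $ j) *\<^sub>R axis i 1"
| "vcoef p q Scal x = x"

definition Vf :: "real \<Rightarrow> real \<Rightarrow> 'n vf \<Rightarrow> (real^'n \<Rightarrow> real)
    \<Rightarrow> real^'n \<Rightarrow> real" where
  "Vf p q a h x = (\<Sum>k\<in>UNIV. vcoef p q a x $ k * dd (axis k 1) h x)"

definition dvg :: "'n::finite vf \<Rightarrow> real" where
  "dvg a = (if a = Scal then real CARD('n) else 0)"

lemma pd_eq_dd: "pd k h = dd (axis k 1) h"
  by (simp add: fun_eq_iff pd_def dd_def)

lemma sum_axis_mult:
  "(\<Sum>k\<in>UNIV. (c *\<^sub>R axis j (1::real)) $ k * f k) = c * f j"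
proof -
  have "(\<Sum>k\<in>UNIV. (c *\<^sub>R axis j (1::real)) $ k * f k) = (\<Sum>k\<in>UNIV. if k = j then c *
      f k else 0)"
    by (intro sum.cong) (auto simp: axis_def)
  then show ?thesis by simp
qed

lemma sum_axis1_mult: "(\<Sum>k\<in>UNIV. axis j (1::real) $ k * f k) = f j"
  using sum_axis_mult[of 1 j f] by simp

lemma ZX_eq_Vf: "ZX a h t = Vf 1 t a (h t)"
proof
  fix x
  show "ZX a h t x = Vf 1 t a (h t) x"
    by (cases a)
      (simp_all add: Vf_def dX_def pd_eq_dd sum_axis_mult sum_axis1_mult left_diff_distrib sum_subtractf
        del: vector_scaleR_component)
qed

lemma Z_eq_Vf:
  "Z a g t x v = Vf 1 t a (\<lambda>y. g t y v) x + Vf 0 1 a (\<lambda>w. g t x w) v"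
  by (cases a)
    (simp_all add: Vf_def dx_def dv_def pd_eq_dd sum_axis_mult sum_axis1_mult left_diff_distrib
        sum_subtractf
      del: vector_scaleR_component)

lemma has_dd_vcoef:
  fixes b x :: "real^'n"
  shows "has_dd b (\<lambda>x. vcoef p q a x $ k) (vcoef 0 0 a b $ k) x"
proof -
  have c: "has_dd b (\<lambda>x::real^'n. x $ i) (b $ i) x" for i
    using has_dd_inner[of b "axis i 1" x] by (simp add: inner_axis inner_real_def)
  show ?thesis
  proof (cases a)
    case (Rot i j)
    show ?thesis unfolding Rot
      using has_dd_diff[OF has_dd_cmult[OF c[of i], of "axis j 1 $ k"] has_dd_cmult[OF c[of j], of "axis i
          1 $ k"]]
      by (simp add: mult.commute)
  qed (auto simp: has_dd_const c)
qed

lemma vcoef_diff: "vcoef p q a x - vcoef p q a y = vcoef 0 0 a (x - y)"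
  by (cases a) (auto simp: algebra_simps)

lemma inner_vcoef00: "vcoef 0 0 a z \<bullet> z = (if a = Scal then z \<bullet> z else 0)"
  by (cases a) (auto simp: inner_diff_left inner_axis' )

lemma norm_vcoef: "norm (vcoef p q a x) \<le> \<bar>p\<bar> + \<bar>q\<bar> + 2 * norm x"
proof (cases a)
  case (Rot i j)
  have "norm (vcoef p q a x) \<le> norm ((x $ i) *\<^sub>R axis j (1::real)) + norm ((x $ j) *\<^sub>R axis
      i (1::real))"
    unfolding Rot vcoef.simps by (rule norm_triangle_ineq4)
  also have "\<dots> \<le> norm x + norm x"
    by (intro add_mono) (simp_all add: component_le_norm_cart)
  finally show ?thesis by simp
qed auto

lemma abs_inner_vcoef: "\<bar>vcoef p q a x \<bullet> x\<bar> \<le> (\<bar>p\<bar> + \<bar>q\<bar>) * norm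
    x + norm x * norm x"
proof (cases a)
  case (Trans j)
  have "\<bar>vcoef p q a x \<bullet> x\<bar> \<le> \<bar>p\<bar> * norm x"
    unfolding Trans by (simp add: inner_axis' abs_mult component_le_norm_cart mult_left_mono)
  also have "\<dots> \<le> (\<bar>p\<bar> + \<bar>q\<bar>) * norm x + norm x * norm x" by (simp add:
      distrib_right)
  finally show ?thesis .
next
  case (Gal j)
  have "\<bar>vcoef p q a x \<bullet> x\<bar> \<le> \<bar>q\<bar> * norm x"
    unfolding Gal by (simp add: inner_axis' abs_mult component_le_norm_cart mult_left_mono)
  also have "\<dots> \<le> (\<bar>p\<bar> + \<bar>q\<bar>) * norm x + norm x * norm x" by (simp add:
      distrib_right)
  finally show ?thesis .
next
  case (Rot i j)
  then show ?thesis by (simp add: inner_diff_left inner_axis')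
next
  case Scal
  then show ?thesis by (simp add: dot_square_norm power2_eq_square)
qed

lemma sum_dvg:
  assumes "a \<in> vfs" shows "(\<Sum>k\<in>UNIV. vcoef 0 0 a (axis k 1) $ k) = dvg a"
proof (cases a)
  case (Rot i j)
  then have "i \<noteq> j" using assms by (auto simp: vfs_def)
  then have "vcoef 0 0 a (axis k 1) $ k = 0" for k
    by (auto simp: Rot axis_def)
  then show ?thesis by (simp add: Rot dvg_def)
qed (auto simp: dvg_def axis_def)

lemma CE_vcoef: "CE m (\<lambda>x::real^'n. vcoef p q a x $ k)"
proof -
  have c: "CE m (\<lambda>x::real^'n. x $ i)" for i
    using CE_inner[of m "axis i (1::real)"] by (simp add: inner_axis inner_real_def)
  show ?thesis
  proof (cases a)
    case (Rot i j)
    show ?thesis unfolding Rot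
      using CE_diff[OF CE_cmult[OF c[of i], of "axis j 1 $ k"] CE_cmult[OF c[of j], of "axis i 1 $ k"]]
      by (simp add: mult.commute)
  qed (auto simp: CE_const c)
qed

lemma CE_Vf: "CE (Suc m) h \<Longrightarrow> CE m (Vf p q a h)"
  unfolding Vf_def[abs_def] by (intro CE_sum CE_mult CE_vcoef CE_dd axis_Basis)

lemma CE_has_dd_axis:
  fixes h :: "real^'n \<Rightarrow> real"
  shows "CE (Suc m) h \<Longrightarrow> has_dd (axis k 1) h (dd (axis k 1) h x) x"
  by (rule CE_has_dd[OF _ axis_Basis])

lemma Vf_mult:
  assumes "CE (Suc i) f" "CE (Suc j) g"
  shows "Vf p q a (\<lambda>x. f x * g x) x = Vf p q a f x * g x + f x * Vf p q a g x"
proof -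
  have "dd (axis k 1) (\<lambda>x. f x * g x) x = dd (axis k 1) f x * g x + f x * dd (axis k 1) g x" for k
    using assms by (intro dd_eqI has_dd_mult CE_has_dd_axis)
  then show ?thesis
    by (simp add: Vf_def algebra_simps sum.distrib sum_distrib_left)
qed

lemma dd_eq_0_outside:
  assumes "\<And>x. R < norm x \<Longrightarrow> h x = 0" "R < norm x"
  shows "dd b h x = 0"
proof (rule dd_eqI, unfold has_dd_def)
  have o: "open ((\<lambda>s. norm (x + s *\<^sub>R b)) -` {R<..})"
    by (intro continuous_open_vimage continuous_intros open_greaterThan)
  have "((\<lambda>s::real. 0::real) has_real_derivative 0) (at 0)" by simp
  then show "((\<lambda>s. h (x + s *\<^sub>R b)) has_real_derivative 0) (at 0)"
    by (rule has_field_derivative_transform_within_open[OF _ o]) (use assms in auto)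
qed

lemma Vf_eq_0_outside:
  assumes "\<And>x. R < norm x \<Longrightarrow> h x = 0" "R < norm x"
  shows "Vf p q a h x = 0"
  unfolding Vf_def using dd_eq_0_outside[OF assms] by simp

definition adj :: "real \<Rightarrow> 'n::finite vf \<Rightarrow> (real^'n \<Rightarrow> real)
    \<Rightarrow> real^'n \<Rightarrow> real" where
  "adj t a \<xi> x = - Vf 1 t a \<xi> x - dvg a * \<xi> x"

lemma CE_adj: "CE (Suc m) \<xi> \<Longrightarrow> CE m (adj t a \<xi>)"
proof -
  assume \<xi>: "CE (Suc m) \<xi>"
  have "CE m (\<lambda>x. (-1) * Vf 1 t a \<xi> x - dvg a * \<xi> x)"
    by (intro CE_diff CE_cmult CE_Vf[OF \<xi>] CE_SucD[OF \<xi>])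
  then show ?thesis by (simp add: adj_def[abs_def])
qed

lemma adj_eq_0_outside:
  assumes "\<And>x. R < norm x \<Longrightarrow> \<xi> x = 0" "R < norm x"
  shows "adj t a \<xi> x = 0"
  unfolding adj_def using assms(1)[OF assms(2)] Vf_eq_0_outside[OF assms] by simp

lemma integral_Vf_mult:
  assumes a: "a \<in> vfs" and h: "CE 1 h" and \<xi>: "CE 1 \<xi>" and supp: "\<And>x. R < norm x
      \<Longrightarrow> \<xi> x = 0"
  shows "(\<integral>x. Vf 1 t a h x * \<xi> x \<partial>lborel) = (\<integral>x. h x * adj t a \<xi> x
      \<partial>lborel)"
proof -
  have h': "CE (Suc 0) h" and \<xi>': "CE (Suc 0) \<xi>" using h \<xi> by simp_all
  note ch = CE_continuous[OF h] CE_continuous[OF \<xi>] CE_continuous[OF CE_vcoef[of 0]]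
    CE_continuous[OF CE_dd[OF h' axis_Basis]] CE_continuous[OF CE_dd[OF \<xi>' axis_Basis]]
    CE_continuous[OF CE_Vf[OF h']] CE_continuous[OF CE_adj[OF \<xi>']]
  define P where "P k x = (vcoef 0 0 a (axis k 1) $ k * h x + vcoef 1 t a x $ k * dd (axis k 1) h x) *
      \<xi> x
      + (vcoef 1 t a x $ k * h x) * dd (axis k 1) \<xi> x" for k x
  have cP: "continuous_on UNIV (P k)" for k unfolding P_def[abs_def] by (intro continuous_intros ch)
  have P0: "P k x = 0" if "R < norm x" for k x
    using supp[OF that] dd_eq_0_outside[OF supp that] by (simp add: P_def)
  have iP: "integrable lborel (P k)" for k using integrable_compact_support[OF cP P0] .
  have "(\<integral>x. P k x \<partial>lborel) = 0" for k
  proof (rule integral_dd_eq_0[OF _ cP])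
    show "continuous_on UNIV (\<lambda>x. (vcoef 1 t a x $ k * h x) * \<xi> x)" by (intro continuous_intros
        ch)
    show "has_dd (axis k 1) (\<lambda>x. (vcoef 1 t a x $ k * h x) * \<xi> x) (P k x) x" for x
      unfolding P_def by (intro has_dd_mult has_dd_vcoef CE_has_dd_axis[OF h'] CE_has_dd_axis[OF \<xi>'])
  qed (use supp in auto)
  then have "(\<integral>x. (\<Sum>k\<in>UNIV. P k x) \<partial>lborel) = 0" using iP by simp
  moreover have "(\<Sum>k\<in>UNIV. P k x) = Vf 1 t a h x * \<xi> x - h x * adj t a \<xi> x" for x
    unfolding P_def adj_def Vf_def sum_dvg[OF a, symmetric]
    by (simp add: algebra_simps sum.distrib sum_distrib_left sum_distrib_right)
  moreover have "integrable lborel (\<lambda>x. Vf 1 t a h x * \<xi> x)" "integrable lborel (\<lambda>x. h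
      x * adj t a \<xi> x)"
  proof -
    have c: "continuous_on UNIV (\<lambda>x. Vf 1 t a h x * \<xi> x)" "continuous_on UNIV (\<lambda>x. h x
        * adj t a \<xi> x)"
      by (intro continuous_intros ch)+
    show "integrable lborel (\<lambda>x. Vf 1 t a h x * \<xi> x)"
      by (rule integrable_compact_support[OF c(1), where R = R]) (simp add: supp)
    show "integrable lborel (\<lambda>x. h x * adj t a \<xi> x)"
      by (rule integrable_compact_support[OF c(2), where R = R]) (simp add: adj_eq_0_outside[of R \<xi>, OF
          supp])
  qed
  ultimately show ?thesis by simp
qed

lemma Vf_cutoff: "Vf p q a (cutoff R) x = - 4 * max 0 (1 - (x \<bullet> x) / R\<^sup>2) * (vcoef p q a x
    \<bullet> x) / R\<^sup>2"
proof -
  have 1: "dd (axis k 1) (cutoff R) x = - 4 * max 0 (1 - (x \<bullet> x) / R\<^sup>2) / R\<^sup>2 * x $ k"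
      for k
    by (rule dd_eqI) (use has_dd_cutoff[of "axis k 1" R x] in \<open>simp add: dcutoff_def
        inner_axis\<close>)
  have "Vf p q a (cutoff R) x = (\<Sum>k\<in>UNIV. - 4 * max 0 (1 - (x \<bullet> x) / R\<^sup>2) /
      R\<^sup>2 * (vcoef p q a x $ k * x $ k))"
    unfolding Vf_def 1 by (intro sum.cong) auto
  also have "\<dots> = - 4 * max 0 (1 - (x \<bullet> x) / R\<^sup>2) / R\<^sup>2 * (vcoef p q a x \<bullet>
      x)"
    unfolding sum_distrib_left[symmetric] by (simp add: inner_vec_def)
  finally show ?thesis by simp
qed

lemma Vf_cutoff_bound:
  assumes R: "1 \<le> R" shows "\<bar>Vf p q a (cutoff R) x\<bar> \<le> 4 * (\<bar>p\<bar> + \<bar>q\<bar>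
      + 1)"
proof (cases "R < norm x")
  case True
  then show ?thesis using R by (simp add: Vf_cutoff max0_eq_0_outside)
next
  case False
  then have x: "norm x \<le> R" by simp
  have "\<bar>vcoef p q a x \<bullet> x\<bar> \<le> (\<bar>p\<bar> + \<bar>q\<bar>) * norm x + norm x *
      norm x" by (rule abs_inner_vcoef)
  also have "\<dots> \<le> (\<bar>p\<bar> + \<bar>q\<bar>) * (R * R) + R * R"
  proof -
    have "R * 1 \<le> R * R" using R by (intro mult_left_mono) auto
    then have "norm x \<le> R * R" using x by linarith
    then show ?thesis using x R by (intro add_mono mult_left_mono mult_mono) auto
  qed
  finally have 1: "\<bar>vcoef p q a x \<bullet> x\<bar> \<le> (\<bar>p\<bar> + \<bar>q\<bar> + 1) *
      R\<^sup>2" by (simp add: power2_eq_square algebra_simps)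
  have "\<bar>Vf p q a (cutoff R) x\<bar> = 4 * (max 0 (1 - (x \<bullet> x) / R\<^sup>2) * \<bar>vcoef p q
      a x \<bullet> x\<bar>) / R\<^sup>2"
    by (simp add: Vf_cutoff abs_mult)
  also have "\<dots> \<le> 4 * (1 * ((\<bar>p\<bar> + \<bar>q\<bar> + 1) * R\<^sup>2)) / R\<^sup>2"
    using 1 by (intro divide_right_mono mult_left_mono mult_mono) auto
  finally show ?thesis using R by simp
qed

lemma Vf_cutoff_tendsto: "(\<lambda>j. Vf p q a (cutoff (real (Suc j))) x) \<longlonglongrightarrow> 0"
proof -
  have "(\<lambda>j. - 4 * max 0 (1 - (x \<bullet> x) * (inverse (real (Suc j)))\<^sup>2) * (vcoef p q a x
      \<bullet> x) * (inverse (real (Suc j)))\<^sup>2)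
      \<longlonglongrightarrow> - 4 * max 0 (1 - (x \<bullet> x) * 0\<^sup>2) * (vcoef p q a x \<bullet> x)
          * 0\<^sup>2"
    by (intro tendsto_intros LIMSEQ_inverse_real_of_nat)
  then show ?thesis by (simp add: Vf_cutoff divide_inverse power_inverse)
qed

lemma CE_cutoff: "CE 1 (cutoff R)"
proof -
  have "CE (Suc 0) (cutoff R :: 'a::euclidean_space \<Rightarrow> real)"
    by (rule CE_SucI[where h' = "dcutoff R"]) (auto simp: continuous_cutoff has_dd_cutoff
        continuous_dcutoff)
  then show ?thesis by simp
qed

lemma abs_sum3_le: "\<bar>x\<bar> \<le> a \<Longrightarrow> \<bar>y\<bar> \<le> b \<Longrightarrow>
    \<bar>z\<bar> \<le> c \<Longrightarrow> \<bar>x + y + z\<bar> \<le> a + b + (c::real)"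
  by linarith

lemma tendsto_integral_zero:
  fixes s :: "nat \<Rightarrow> 'a \<Rightarrow> real"
  assumes "\<And>i. integral\<^sup>L M (s i) = 0" "f \<in> borel_measurable M" "\<And>i. s i \<in>
      borel_measurable M"
    "integrable M w" "\<And>x. (\<lambda>i. s i x) \<longlonglongrightarrow> f x" "\<And>i x. \<bar>s i
        x\<bar> \<le> w x"
  shows "integral\<^sup>L M f = 0"
proof -
  have "(\<lambda>i. integral\<^sup>L M (s i)) \<longlonglongrightarrow> integral\<^sup>L M f"
    using assms by (intro integral_dominated_convergence[where w = w]) auto
  then show ?thesis using assms(1) LIMSEQ_unique[OF _ tendsto_const] by simp
qed

text \<open>The \<open>v\<close>-parts of the fields integrate to zero, except for \<open>S\<^sup>v\<close>, which contributes \<open>- n\<close>;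
  a further \<open>- n\<close> comes from moving \<open>S\<^sup>x\<close> to the test function.\<close>

lemma rho_Z_integral:
  fixes g :: "'n::{finite,linorder} kin" and \<Theta> :: "(real, 'n) vec \<Rightarrow> real"
  defines "G \<equiv> \<lambda>t z. g t (fst z) (snd z)" and "ZG \<equiv> \<lambda>a t z. Z a g t (fst z)
      (snd z)"
  assumes a: "a \<in> vfs" and G: "CE 1 (G t)"
    and loc: "\<And>R. set_integrable lborel (cball 0 R \<times> UNIV) (G t)"
      "\<And>R. set_integrable lborel (cball 0 R \<times> UNIV) (ZG a t)"
    and int: "integrable lborel (rho g t)" "integrable lborel (rho (Z a g) t)"
    and \<Theta>: "CE 1 \<Theta>" and B: "\<And>y. \<bar>\<Theta> y\<bar> \<le> B" "\<And>y. \<bar>Vf 1 t a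
        \<Theta> y\<bar> \<le> B"
  shows "(\<integral>y. rho (Z a g) t y * \<Theta> y \<partial>lborel) = (\<integral>y. rho g t y * (- Vf 1
      t a \<Theta> y - 2 * dvg a * \<Theta> y) \<partial>lborel)"
proof -
  let ?ex = "\<lambda>k. (axis k 1, 0) :: 'n phase"
  let ?ev = "\<lambda>k. (0, axis k 1) :: 'n phase"
  have B0: "0 \<le> B" using B(1)[of 0] by linarith
  have d0: "0 \<le> dvg a" by (simp add: dvg_def)
  have \<Theta>': "CE (Suc 0) \<Theta>" using \<Theta> by simp
  have cut': "CE (Suc 0) (cutoff R :: (real, 'n) vec \<Rightarrow> real)" for R using CE_cutoff[of R] by
      simp
  have ZG: "ZG a t z = (\<Sum>k\<in>UNIV. vcoef 1 t a (fst z) $ k * dd (?ex k) (G t) z)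
      + (\<Sum>k\<in>UNIV. vcoef 0 1 a (snd z) $ k * dd (?ev k) (G t) z)" for z
    by (simp add: ZG_def Z_eq_Vf Vf_def G_def dd_def)
  note cG = CE_continuous[OF G] CE_pair(3,4)[OF G]
  note cc = CE_continuous[OF \<Theta>] CE_continuous[OF CE_vcoef[of 0]] CE_continuous[OF CE_cutoff]
    CE_continuous[OF CE_dd[OF \<Theta>' axis_Basis]] CE_continuous[OF CE_Vf[OF \<Theta>']] CE_continuous[OF
        CE_Vf[OF cut']]
    CE_continuous[OF CE_dd[OF cut' axis_Basis]]
  have cfs: "continuous_on UNIV (\<lambda>z::'n phase. h (fst z))" "continuous_on UNIV (\<lambda>z::'n
      phase. h (snd z))"
    if "continuous_on UNIV h" for h :: "(real, 'n) vec \<Rightarrow> real"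
    by (auto intro!: continuous_on_compose2[OF that] continuous_intros)
  have cZG: "continuous_on UNIV (ZG a t)"
    unfolding ZG by (intro continuous_intros cfs cc cG)
  have [measurable]: "G t \<in> borel_measurable borel" "ZG a t \<in> borel_measurable borel"
    "\<Theta> \<in> borel_measurable borel" "Vf 1 t a \<Theta> \<in> borel_measurable borel"
    "cutoff R \<in> borel_measurable (borel :: (real, 'n) vec measure)"
    "Vf p q a (cutoff R) \<in> borel_measurable borel" for p q R
    by (intro borel_measurable_continuous_onI cG cZG cc)+
  define E where "E R x = Vf 1 t a \<Theta> x * cutoff R x + \<Theta> x * Vf 1 t a (cutoff R) x" for R x
  have E: "Vf 1 t a (\<lambda>x. \<Theta> x * cutoff R x) x = E R x" for R x
    unfolding E_def by (rule Vf_mult[OF \<Theta>' cut'])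
  have [measurable]: "E R \<in> borel_measurable borel" for R unfolding E_def[abs_def] by measurable
  have Eb: "\<bar>E R x\<bar> \<le> B + B * (4 * (2 + \<bar>t\<bar>))" if "1 \<le> R" for R x
  proof -
    have "\<bar>Vf 1 t a \<Theta> x * cutoff R x\<bar> \<le> B * 1"
      unfolding abs_mult using B cutoff_bounds[of R x] B0 by (intro mult_mono) auto
    moreover have "\<bar>\<Theta> x * Vf 1 t a (cutoff R) x\<bar> \<le> B * (4 * (2 + \<bar>t\<bar>))"
      unfolding abs_mult using B Vf_cutoff_bound[OF that, of 1 t a x] B0 by (intro mult_mono) auto
    ultimately show ?thesis unfolding E_def by linarith
  qed
  have E0: "E R x = 0" if "1 \<le> R" "R < norm x" for R x
    using that by (simp add: E_def cutoff_eq_0 Vf_cutoff max0_eq_0_outside)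
  define I where "I R m z = (ZG a t z + 2 * dvg a * G t z) * (\<Theta> (fst z) * cutoff R (fst z) * cutoff
      m (snd z))
      + G t z * (E R (fst z) * cutoff m (snd z) + \<Theta> (fst z) * cutoff R (fst z) * Vf 0 1 a (cutoff m)
          (snd z))" for R m z
  have I0: "(\<integral>z. I R m z \<partial>lborel) = 0" if R: "1 \<le> R" and m: "1 \<le> m" for R m
  proof -
    define U where "U z = \<Theta> (fst z) * cutoff R (fst z) * cutoff m (snd z)" for z :: "'n phase"
    define dU where "dU k z = (dd (axis k 1) \<Theta> (fst z) * cutoff R (fst z) + \<Theta> (fst z) * dd
        (axis k 1) (cutoff R) (fst z)) * cutoff m (snd z)
        + \<Theta> (fst z) * cutoff R (fst z) * 0" for k and z :: "'n phase"
    define dW where "dW k z = 0 * cutoff m (snd z) + \<Theta> (fst z) * cutoff R (fst z) * dd (axis k 1)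
        (cutoff m) (snd z)" for k and z :: "'n phase"
    have U: "has_dd (?ex k) U (dU k z) z" "has_dd (?ev k) U (dW k z) z" for k z
      unfolding U_def[abs_def] dU_def dW_def
      by (intro has_dd_mult[of _ "\<lambda>z. \<Theta> (fst z) * cutoff R (fst z)"] has_dd_snd0
          has_dd_fst[of _ "\<lambda>x. \<Theta> x * cutoff R x"] has_dd_mult CE_has_dd_axis[OF \<Theta>']
              CE_has_dd_axis[OF cut'],
          intro has_dd_mult[of _ "\<lambda>z. \<Theta> (fst z) * cutoff R (fst z)"]
            has_dd_fst0[of _ "\<lambda>x. \<Theta> x * cutoff R x"] has_dd_snd CE_has_dd_axis[OF cut'])
    have cU: "continuous_on UNIV U" "continuous_on UNIV (dU k)" "continuous_on UNIV (dW k)" for k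
      unfolding U_def[abs_def] dU_def[abs_def] dW_def[abs_def] by (intro continuous_intros cfs cc)+
    have U0: "U z = 0" if "R + m < norm z" for z
    proof -
      have "norm z \<le> norm (fst z) + norm (snd z)"
        by (metis norm_fst_le norm_Pair prod.collapse real_sqrt_sum_squares_triangle_ineq
            sqrt_sum_squares_le_sum norm_ge_zero)
      then have "R < norm (fst z) \<or> m < norm (snd z)" using that by linarith
      then show ?thesis using R m by (auto simp: U_def cutoff_eq_0)
    qed
    define P where "P k z = (vcoef 0 0 a (axis k 1) $ k * G t z + vcoef 1 t a (fst z) $ k * dd (?ex k) (G
        t) z) * U z
       + (vcoef 1 t a (fst z) $ k * G t z) * dU k z" for k z
    define Q where "Q k z = (vcoef 0 0 a (axis k 1) $ k * G t z + vcoef 0 1 a (snd z) $ k * dd (?ev k) (G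
        t) z) * U z
       + (vcoef 0 1 a (snd z) $ k * G t z) * dW k z" for k z
    have cP: "continuous_on UNIV (P k)" and cQ: "continuous_on UNIV (Q k)" for k
      unfolding P_def[abs_def] Q_def[abs_def] by (intro continuous_intros cfs cc cG cU)+
    have dU0: "dU k z = 0" "dW k z = 0" if "R + m < norm z" for k z
      using dd_eqI[OF U(1), of k z] dd_eqI[OF U(2), of k z] dd_eq_0_outside[OF U0 that] by auto
    have iPQ: "integrable lborel (P k)" "integrable lborel (Q k)" for k
      using U0 dU0 by (intro integrable_compact_support[OF cP, where R = "R + m"]
          integrable_compact_support[OF cQ, where R = "R + m"]; simp add: P_def Q_def)+
    have "(\<integral>z. P k z \<partial>lborel) = 0" for k
    proof (rule integral_dd_eq_0[OF _ cP])
      show "continuous_on UNIV (\<lambda>z. (vcoef 1 t a (fst z) $ k * G t z) * U z)"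
        by (intro continuous_intros cfs cc cG cU)
      show "has_dd (?ex k) (\<lambda>z. (vcoef 1 t a (fst z) $ k * G t z) * U z) (P k z) z" for z
        unfolding P_def by (intro has_dd_mult has_dd_fst[of _ "\<lambda>x. vcoef 1 t a x $ k"] has_dd_vcoef
            U CE_pair[OF G])
    qed (use U0 in auto)
    moreover have "(\<integral>z. Q k z \<partial>lborel) = 0" for k
    proof (rule integral_dd_eq_0[OF _ cQ])
      show "continuous_on UNIV (\<lambda>z. (vcoef 0 1 a (snd z) $ k * G t z) * U z)"
        by (intro continuous_intros cfs cc cG cU)
      show "has_dd (?ev k) (\<lambda>z. (vcoef 0 1 a (snd z) $ k * G t z) * U z) (Q k z) z" for z
        unfolding Q_def by (intro has_dd_mult has_dd_snd[of _ "\<lambda>x. vcoef 0 1 a x $ k"] has_dd_vcoef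
            U CE_pair[OF G])
    qed (use U0 in auto)
    ultimately have "(\<integral>z. (\<Sum>k\<in>UNIV. P k z) + (\<Sum>k\<in>UNIV. Q k z) \<partial>lborel)
        = 0" using iPQ by simp
    moreover have "(\<Sum>k\<in>UNIV. P k z) + (\<Sum>k\<in>UNIV. Q k z) = I R m z" for z
    proof -
      have "(\<Sum>k\<in>UNIV. P k z) = dvg a * (G t z * U z)
          + (\<Sum>k\<in>UNIV. vcoef 1 t a (fst z) $ k * dd (?ex k) (G t) z) * U z
          + G t z * (\<Sum>k\<in>UNIV. vcoef 1 t a (fst z) $ k * dU k z)"
        unfolding P_def sum_dvg[OF a, symmetric] sum_distrib_left sum_distrib_right sum.distrib[symmetric]
        by (intro sum.cong) (auto simp: algebra_simps)
      moreover have "(\<Sum>k\<in>UNIV. Q k z) = dvg a * (G t z * U z)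
          + (\<Sum>k\<in>UNIV. vcoef 0 1 a (snd z) $ k * dd (?ev k) (G t) z) * U z
          + G t z * (\<Sum>k\<in>UNIV. vcoef 0 1 a (snd z) $ k * dW k z)"
        unfolding Q_def sum_dvg[OF a, symmetric] sum_distrib_left sum_distrib_right sum.distrib[symmetric]
        by (intro sum.cong) (auto simp: algebra_simps)
      moreover have "(\<Sum>k\<in>UNIV. vcoef 1 t a (fst z) $ k * dU k z) = E R (fst z) * cutoff m (snd z)"
        unfolding E_def Vf_def dU_def sum_distrib_left sum_distrib_right sum.distrib[symmetric]
        by (intro sum.cong) (auto simp: algebra_simps)
      moreover have "(\<Sum>k\<in>UNIV. vcoef 0 1 a (snd z) $ k * dW k z)
          = \<Theta> (fst z) * cutoff R (fst z) * Vf 0 1 a (cutoff m) (snd z)"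
        unfolding Vf_def dW_def sum_distrib_left by (intro sum.cong) (auto simp: algebra_simps)
      ultimately show ?thesis unfolding I_def ZG U_def by (simp add: algebra_simps)
    qed
    ultimately show ?thesis by simp
  qed
  define J where "J R z = (ZG a t z + 2 * dvg a * G t z) * (\<Theta> (fst z) * cutoff R (fst z)) + G t z *
      E R (fst z)" for R z
  have iloc: "integrable lborel (\<lambda>z. indicator (cball 0 R \<times> UNIV) z * \<bar>G t z\<bar>)"
    "integrable lborel (\<lambda>z. indicator (cball 0 R \<times> UNIV) z * \<bar>ZG a t z\<bar>)" for R
    using integrable_abs[OF loc(1)[of R, unfolded set_integrable_def]]
      integrable_abs[OF loc(2)[of R, unfolded set_integrable_def]] by (simp_all add: abs_mult)
  define w where "w R z = B * (indicator (cball 0 R \<times> UNIV) z * \<bar>ZG a t z\<bar>)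
    + (2 * dvg a * B + (B + B * (4 * (2 + \<bar>t\<bar>))) + B * 8) * (indicator (cball 0 R \<times> UNIV)
        z * \<bar>G t z\<bar>)" for R z
  have iw: "integrable lborel (w R)" for R unfolding w_def
    by (intro Bochner_Integration.integrable_add integrable_mult_right iloc)
  have Iw: "\<bar>I R m z\<bar> \<le> w R z" if R: "1 \<le> R" and m: "1 \<le> m" for R m z
  proof (cases "R < norm (fst z)")
    case True
    have "I R m z = 0" using R True by (simp add: I_def cutoff_eq_0 E0)
    moreover have "0 \<le> w R z" unfolding w_def using B0 d0 by (intro add_nonneg_nonneg
        mult_nonneg_nonneg) auto
    ultimately show ?thesis by simp
  next
    case False
    then have i: "indicator (cball 0 R \<times> UNIV) z = (1::real)" by (simp add: indicator_def
        mem_Times_iff)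
    let ?U = "\<Theta> (fst z) * cutoff R (fst z) * cutoff m (snd z)"
    have U1: "\<bar>\<Theta> (fst z) * cutoff R (fst z)\<bar> \<le> B * 1"
      unfolding abs_mult using B cutoff_bounds[of R "fst z"] B0 by (intro mult_mono) auto
    then have U: "\<bar>?U\<bar> \<le> B * 1" 
      unfolding abs_mult[of "\<Theta> (fst z) * cutoff R (fst z)"] using cutoff_bounds[of m "snd z"] B0 by
          (intro mult_mono) auto
    have V: "\<bar>E R (fst z) * cutoff m (snd z)\<bar> \<le> (B + B * (4 * (2 + \<bar>t\<bar>))) * 1"
      unfolding abs_mult using Eb[OF R, of "fst z"] cutoff_bounds[of m "snd z"] B0 by (intro mult_mono) auto
    have W: "\<bar>\<Theta> (fst z) * cutoff R (fst z) * Vf 0 1 a (cutoff m) (snd z)\<bar> \<le> B * 8"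
      unfolding abs_mult[of "\<Theta> (fst z) * cutoff R (fst z)"]
      using U1 Vf_cutoff_bound[OF m, of 0 1 a "snd z"] B0 by (intro mult_mono) auto
    have "\<bar>ZG a t z * ?U\<bar> \<le> \<bar>ZG a t z\<bar> * B" "\<bar>(2 * dvg a * G t z) * ?U\<bar>
        \<le> (2 * dvg a * \<bar>G t z\<bar>) * B"
      unfolding abs_mult[of _ ?U] using U d0 by (auto intro!: mult_left_mono simp: abs_mult)
    moreover have "\<bar>G t z * (E R (fst z) * cutoff m (snd z) + \<Theta> (fst z) * cutoff R (fst z) * Vf
        0 1 a (cutoff m) (snd z))\<bar>
        \<le> \<bar>G t z\<bar> * ((B + B * (4 * (2 + \<bar>t\<bar>))) + B * 8)"
      unfolding abs_mult[of "G t z"] using V W by (intro mult_left_mono) auto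
    ultimately have "\<bar>I R m z\<bar> \<le> \<bar>ZG a t z\<bar> * B + (2 * dvg a * \<bar>G t z\<bar>) *
        B
        + \<bar>G t z\<bar> * ((B + B * (4 * (2 + \<bar>t\<bar>))) + B * 8)"
      unfolding I_def distrib_right[of "ZG a t z"] by (rule abs_sum3_le)
    also have "\<dots> = w R z" unfolding w_def i by (simp add: algebra_simps)
    finally show ?thesis .
  qed
  have J0: "(\<integral>z. J R z \<partial>lborel) = 0" if R: "1 \<le> R" for R
  proof (rule tendsto_integral_zero[where s = "\<lambda>j. I R (real (Suc j))" and w = "w R"])
    show "(\<lambda>j. I R (real (Suc j)) z) \<longlonglongrightarrow> J R z" for z
    proof -
      have "(\<lambda>j. I R (real (Suc j)) z) \<longlonglongrightarrow> (ZG a t z + 2 * dvg a * G t z) *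
          (\<Theta> (fst z) * cutoff R (fst z) * 1)
        + G t z * (E R (fst z) * 1 + \<Theta> (fst z) * cutoff R (fst z) * 0)"
        unfolding I_def by (intro tendsto_intros LIMSEQ_cutoff Vf_cutoff_tendsto)
      then show ?thesis by (simp add: J_def)
    qed
    show "J R \<in> borel_measurable lborel" unfolding J_def[abs_def] by measurable
    show "I R (real (Suc j)) \<in> borel_measurable lborel" for j unfolding I_def[abs_def] by measurable
  qed (use I0 Iw iw R in auto)
  have iJ: "integrable lborel (J R)" if R: "1 \<le> R" for R
  proof (rule Bochner_Integration.integrable_bound[OF iw[of R]])
    show "J R \<in> borel_measurable lborel" unfolding J_def[abs_def] by measurable
    show "AE z in lborel. norm (J R z) \<le> norm (w R z)"
    proof (rule AE_I2)
      fix z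
      have "(\<lambda>j. I R (real (Suc j)) z) \<longlonglongrightarrow> (ZG a t z + 2 * dvg a * G t z) *
          (\<Theta> (fst z) * cutoff R (fst z) * 1)
        + G t z * (E R (fst z) * 1 + \<Theta> (fst z) * cutoff R (fst z) * 0)"
        unfolding I_def by (intro tendsto_intros LIMSEQ_cutoff Vf_cutoff_tendsto)
      then have "(\<lambda>j. \<bar>I R (real (Suc j)) z\<bar>) \<longlonglongrightarrow> \<bar>J R
          z\<bar>" by (intro tendsto_rabs) (simp add: J_def)
      then have "\<bar>J R z\<bar> \<le> w R z" by (rule LIMSEQ_le_const2) (use Iw[OF R] in auto)
      then show "norm (J R z) \<le> norm (w R z)" by simp
    qed
  qed
  define L where "L R x = (rho (Z a g) t x + 2 * dvg a * rho g t x) * (\<Theta> x * cutoff R x) + rho g t x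
      * E R x" for R x
  have L0: "(\<integral>x. L R x \<partial>lborel) = 0" if R: "1 \<le> R" for R
  proof -
    have "(\<integral>z. J R z \<partial>(lborel \<Otimes>\<^sub>M lborel)) = (\<integral>x. \<integral>v.
        J R (x, v) \<partial>lborel \<partial>lborel)"
      by (rule lborel_pair.integral_fst'[symmetric]) (use iJ[OF R] in \<open>simp add: lborel_prod\<close>)
    also have "\<dots> = (\<integral>x. L R x \<partial>lborel)"
    proof (rule integral_cong_AE)
      have ii: "integrable (lborel \<Otimes>\<^sub>M lborel) (\<lambda>z. indicator (cball 0 R \<times>
          UNIV) z * G t z)"
        "integrable (lborel \<Otimes>\<^sub>M lborel) (\<lambda>z. indicator (cball 0 R \<times> UNIV) z *
            ZG a t z)"
        using loc[of R] by (simp_all add: lborel_prod set_integrable_def)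
      show "AE x in lborel. (\<integral>v. J R (x, v) \<partial>lborel) = L R x"
        using lborel_pair.AE_integrable_fst'[OF ii(1)] lborel_pair.AE_integrable_fst'[OF ii(2)]
      proof eventually_elim
        case (elim x)
        show ?case
        proof (cases "R < norm x")
          case True
          then show ?thesis using R by (simp add: J_def L_def E0 cutoff_eq_0)
        next
          case False
          then have "integrable lborel (\<lambda>v. G t (x, v))" "integrable lborel (\<lambda>v. ZG a t (x,
              v))"
            using elim by (simp_all add: indicator_def)
          then show ?thesis
            unfolding J_def L_def by (simp add: rho_def G_def ZG_def)
        qed
      qed
      have "integrable (lborel \<Otimes>\<^sub>M lborel) (J R)" using iJ[OF R] by (simp add: lborel_prod)
      from borel_measurable_integrable[OF lborel_pair.integrable_fst'[OF this]]
      show "(\<lambda>x. \<integral>v. J R (x, v) \<partial>lborel) \<in> borel_measurable lborel" by simp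
      show "L R \<in> borel_measurable lborel" unfolding L_def[abs_def]
        using borel_measurable_integrable[OF int(1)] borel_measurable_integrable[OF int(2)] by measurable
    qed
    finally show ?thesis using J0[OF R] by (simp add: lborel_prod)
  qed
  have [measurable]: "rho g t \<in> borel_measurable borel" "rho (Z a g) t \<in> borel_measurable borel"
    using borel_measurable_integrable[OF int(1)] borel_measurable_integrable[OF int(2)] by simp_all
  have "(\<integral>x. (rho (Z a g) t x + 2 * dvg a * rho g t x) * \<Theta> x + rho g t x * Vf 1 t a
      \<Theta> x \<partial>lborel) = 0"
  proof (rule tendsto_integral_zero[where s = "\<lambda>j. L (real (Suc j))" and
      w = "\<lambda>x. B * \<bar>rho (Z a g) t x\<bar> + (2 * dvg a * B + (B + B * (4 * (2 +
          \<bar>t\<bar>)))) * \<bar>rho g t x\<bar>"])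
    show "(\<lambda>j. L (real (Suc j)) x) \<longlonglongrightarrow> (rho (Z a g) t x + 2 * dvg a * rho g t
        x) * \<Theta> x + rho g t x * Vf 1 t a \<Theta> x" for x
    proof -
      have "(\<lambda>j. L (real (Suc j)) x) \<longlonglongrightarrow> (rho (Z a g) t x + 2 * dvg a * rho g
          t x) * (\<Theta> x * 1)
         + rho g t x * (Vf 1 t a \<Theta> x * 1 + \<Theta> x * 0)"
        unfolding L_def E_def by (intro tendsto_intros LIMSEQ_cutoff Vf_cutoff_tendsto)
      then show ?thesis by simp
    qed
    show "\<bar>L (real (Suc j)) x\<bar> \<le> B * \<bar>rho (Z a g) t x\<bar> + (2 * dvg a * B + (B + B *
        (4 * (2 + \<bar>t\<bar>)))) * \<bar>rho g t x\<bar>" for j x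
    proof -
      let ?R = "real (Suc j)" and ?U = "\<Theta> x * cutoff (real (Suc j)) x"
      have U: "\<bar>?U\<bar> \<le> B * 1"
        unfolding abs_mult using B cutoff_bounds[of ?R x] B0 by (intro mult_mono) auto
      have "\<bar>rho (Z a g) t x * ?U\<bar> \<le> \<bar>rho (Z a g) t x\<bar> * B" "\<bar>(2 * dvg a * rho
          g t x) * ?U\<bar> \<le> (2 * dvg a * \<bar>rho g t x\<bar>) * B"
        unfolding abs_mult[of _ ?U] using U d0 by (auto intro!: mult_left_mono simp: abs_mult)
      moreover have "\<bar>rho g t x * E ?R x\<bar> \<le> \<bar>rho g t x\<bar> * (B + B * (4 * (2 +
          \<bar>t\<bar>)))"
        unfolding abs_mult using Eb[of ?R x] by (intro mult_left_mono) auto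
      ultimately have "\<bar>L ?R x\<bar> \<le> \<bar>rho (Z a g) t x\<bar> * B + (2 * dvg a * \<bar>rho g
          t x\<bar>) * B
          + \<bar>rho g t x\<bar> * (B + B * (4 * (2 + \<bar>t\<bar>)))"
        unfolding L_def distrib_right[of "rho (Z a g) t x"] by (rule abs_sum3_le)
      then show ?thesis by (simp add: algebra_simps)
    qed
    show "integrable lborel (\<lambda>x. B * \<bar>rho (Z a g) t x\<bar> + (2 * dvg a * B + (B + B * (4 *
        (2 + \<bar>t\<bar>)))) * \<bar>rho g t x\<bar>)"
      using int by (intro Bochner_Integration.integrable_add integrable_mult_right integrable_abs)
    show "L (real (Suc j)) \<in> borel_measurable lborel" for j unfolding L_def[abs_def] by measurable
    show "(\<lambda>x. (rho (Z a g) t x + 2 * dvg a * rho g t x) * \<Theta> x + rho g t x * Vf 1 t a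
        \<Theta> x) \<in> borel_measurable lborel"
      by measurable
  qed (use L0 in simp)
  moreover have "integrable lborel (\<lambda>y. rho (Z a g) t y * \<Theta> y)"
    by (rule Bochner_Integration.integrable_bound[OF integrable_mult_right[OF integrable_abs[OF int(2)], of
        B]])
      (auto simp: abs_mult mult.commute intro!: mult_right_mono B order_trans[OF B(1)])
  moreover have "integrable lborel (\<lambda>y. rho g t y * (- Vf 1 t a \<Theta> y - 2 * dvg a * \<Theta>
      y))"
  proof (rule Bochner_Integration.integrable_bound[OF integrable_mult_right[OF integrable_abs[OF int(1)],
      of "B + 2 * dvg a * B"]])
    show "AE y in lborel. norm (rho g t y * (- Vf 1 t a \<Theta> y - 2 * dvg a * \<Theta> y)) \<le> norm
        ((B + 2 * dvg a * B) * \<bar>rho g t y\<bar>)"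
    proof (rule AE_I2)
      fix y
      have "\<bar>2 * dvg a * \<Theta> y\<bar> \<le> 2 * dvg a * B" using d0 B(1)[of y] by (auto simp:
          abs_mult intro!: mult_left_mono)
      then have "\<bar>- Vf 1 t a \<Theta> y - 2 * dvg a * \<Theta> y\<bar> \<le> B + 2 * dvg a * B" using
          B(2)[of y] by linarith
      then have "\<bar>- Vf 1 t a \<Theta> y - 2 * dvg a * \<Theta> y\<bar> * \<bar>rho g t y\<bar> \<le>
          (B + 2 * dvg a * B) * \<bar>rho g t y\<bar>"
        by (rule mult_right_mono) simp
      then show "norm (rho g t y * (- Vf 1 t a \<Theta> y - 2 * dvg a * \<Theta> y)) \<le> norm ((B + 2 *
          dvg a * B) * \<bar>rho g t y\<bar>)"
        using B0 d0 by (simp add: abs_mult mult.commute)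
    qed
  qed measurable
  ultimately have "(\<integral>y. rho (Z a g) t y * \<Theta> y - rho g t y * (- Vf 1 t a \<Theta> y - 2 *
      dvg a * \<Theta> y) \<partial>lborel) = 0"
    by (simp add: algebra_simps)
  then show ?thesis
    using \<open>integrable lborel (\<lambda>y. rho (Z a g) t y * \<Theta> y)\<close>
      \<open>integrable lborel (\<lambda>y. rho g t y * (- Vf 1 t a \<Theta> y - 2 * dvg a * \<Theta>
          y))\<close> by simp
qed

section \<open>Gaussian kernels\<close>

definition ek :: "real \<Rightarrow> nat \<Rightarrow> 'a::euclidean_space \<Rightarrow> real" where
  "ek b j z = (b * (z \<bullet> z)) ^ j * exp (- (b * (z \<bullet> z)))"

definition rk :: "real \<Rightarrow> nat \<Rightarrow> 'a::euclidean_space \<Rightarrow> real" where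
  "rk b j z = b * (real j * (b * (z \<bullet> z)) ^ (j - 1) - (b * (z \<bullet> z)) ^ j) * exp (- (b * (z
      \<bullet> z)))"

lemma has_dd_ek: "has_dd c (ek b j) (2 * (z \<bullet> c) * rk b j z) z"
proof -
  have "((\<lambda>u. (b * u) ^ j * exp (- (b * u))) has_real_derivative
      b * (real j * (b * u) ^ (j - 1) - (b * u) ^ j) * exp (- (b * u))) (at u)" for u
  proof -
    have 1: "((\<lambda>u. b * u) has_real_derivative b) (at u)" by (auto intro!: derivative_eq_intros)
    have 2: "((\<lambda>u. exp (- (b * u))) has_real_derivative exp (- (b * u)) * - b) (at u)"
      by (auto intro!: derivative_eq_intros)
    from DERIV_mult[OF DERIV_power[OF 1, of j] 2] show ?thesis
      by (rule DERIV_cong) (simp add: algebra_simps del: power_mult_distrib)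
  qed
  from has_dd_chain[where h = "\<lambda>z. z \<bullet> z", OF this has_dd_inner_self]
  show ?thesis by (simp add: ek_def[abs_def] rk_def mult_ac)
qed

lemma continuous_ek: "continuous_on S (ek b j)"
  unfolding ek_def[abs_def] by (intro continuous_intros)

lemma continuous_rk: "continuous_on S (rk b j)"
  unfolding rk_def[abs_def] by (intro continuous_intros)

lemma inner_self_rk: "2 * (z \<bullet> z) * rk b j z = 2 * real j * ek b j z - 2 * ek b (Suc j) z"
proof (cases j)
  case 0
  then show ?thesis by (simp add: ek_def rk_def)
next
  case (Suc i)
  then show ?thesis by (simp add: ek_def rk_def algebra_simps)
qed

lemma power_exp_le_fact:
  assumes "0 \<le> (u::real)" shows "u ^ j * exp (- u) \<le> fact j"
proof -
  have "(\<Sum>n\<in>{j}. u ^ n /\<^sub>R fact n) \<le> (\<Sum>n. u ^ n /\<^sub>R fact n)"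
    by (rule sum_le_suminf) (use assms summable_exp_generic[of u] in auto)
  then have "u ^ j / fact j \<le> exp u" by (simp add: exp_def divide_inverse mult.commute)
  then show ?thesis by (simp add: exp_minus field_simps)
qed

lemma power_exp_le_fact_half:
  assumes "0 \<le> (u::real)" shows "u ^ j * exp (- u) \<le> 2 ^ j * fact j * exp (- u / 2)"
proof -
  have "(u / 2) ^ j * exp (- (u / 2)) * exp (- (u / 2)) \<le> fact j * exp (- (u / 2))"
    by (rule mult_right_mono[OF power_exp_le_fact]) (use assms in auto)
  moreover have "exp (- u) = exp (- (u / 2)) * exp (- (u / 2))" by (simp flip: exp_add)
  ultimately show ?thesis by (simp add: power_divide field_simps)
qed

lemma ek_bound: "0 \<le> b \<Longrightarrow> \<bar>ek b j z\<bar> \<le> fact j"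
  using power_exp_le_fact[of "b * (z \<bullet> z)" j] by (simp add: ek_def abs_mult)

lemma abs_rk_le:
  assumes "0 \<le> b"
  shows "\<bar>rk b j z\<bar> \<le> b * (real j * ((b * (z \<bullet> z)) ^ (j - 1) * exp (- (b * (z
      \<bullet> z)))) + (b * (z \<bullet> z)) ^ j * exp (- (b * (z \<bullet> z))))"
proof -
  let ?u = "b * (z \<bullet> z)"
  have u: "0 \<le> ?u" using assms by simp
  have "\<bar>real j * ?u ^ (j - 1) - ?u ^ j\<bar> \<le> real j * ?u ^ (j - 1) + ?u ^ j"
    using u by (intro order_trans[OF abs_triangle_ineq4]) (simp add: abs_mult)
  then have "b * (\<bar>real j * ?u ^ (j - 1) - ?u ^ j\<bar> * exp (- ?u)) \<le> b * ((real j * ?u ^ (j -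
      1) + ?u ^ j) * exp (- ?u))"
    using assms by (intro mult_left_mono mult_right_mono) auto
  moreover have "\<bar>rk b j z\<bar> = b * (\<bar>real j * ?u ^ (j - 1) - ?u ^ j\<bar> * exp (- ?u))"
    unfolding rk_def abs_mult using assms by simp
  ultimately show ?thesis by (simp only: distrib_right mult.assoc)
qed

lemma rk_bounds:
  assumes b: "0 \<le> b"
  obtains C where "\<And>z::'a::euclidean_space. \<bar>rk b j z\<bar> \<le> C" "\<And>z::'a. (z \<bullet>
      z) * \<bar>rk b j z\<bar> \<le> C"
    "\<And>z::'a. norm z * \<bar>rk b j z\<bar> \<le> C"
proof -
  define C1 where "C1 = b * (real j * fact (j - 1) + fact j)"
  define C2 where "C2 = real j * fact j + fact (Suc j)"
  have C0: "0 \<le> C1" "0 \<le> C2" using b by (auto simp: C1_def C2_def)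
  have 1: "\<bar>rk b j z\<bar> \<le> C1" for z :: 'a
    unfolding C1_def using b
    by (intro order_trans[OF abs_rk_le[OF b]] mult_left_mono add_mono power_exp_le_fact) auto
  have 2: "(z \<bullet> z) * \<bar>rk b j z\<bar> \<le> C2" for z :: 'a
  proof -
    have "2 * ((z \<bullet> z) * \<bar>rk b j z\<bar>) = \<bar>2 * (z \<bullet> z) * rk b j z\<bar>" by
        (simp add: abs_mult)
    also have "\<dots> \<le> \<bar>2 * real j * ek b j z\<bar> + \<bar>2 * ek b (Suc j) z\<bar>"
      unfolding inner_self_rk by (rule abs_triangle_ineq4)
    also have "\<dots> = 2 * (real j * \<bar>ek b j z\<bar> + \<bar>ek b (Suc j) z\<bar>)" by (simp add:
        abs_mult)
    also have "\<dots> \<le> 2 * C2"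
      unfolding C2_def by (intro mult_left_mono add_mono ek_bound[OF b]) auto
    finally show ?thesis by simp
  qed
  have 3: "norm z * \<bar>rk b j z\<bar> \<le> C1 + C2" for z :: 'a
  proof -
    have "0 \<le> (norm z - 1)\<^sup>2" by simp
    then have "2 * norm z \<le> 1 + (norm z)\<^sup>2" by (simp add: power2_diff)
    then have "norm z \<le> 1 + (norm z)\<^sup>2" using norm_ge_zero[of z] by linarith
    then have "norm z \<le> 1 + z \<bullet> z" by (simp add: dot_square_norm)
    then have "norm z * \<bar>rk b j z\<bar> \<le> (1 + z \<bullet> z) * \<bar>rk b j z\<bar>" by (rule
        mult_right_mono) simp
    then show ?thesis using 1[of z] 2[of z] by (simp add: distrib_right)
  qed
  show ?thesis
    by (rule that[of "C1 + C2"]) (use 1 2 3 C0 in \<open>auto intro: order_trans simp: add_increasing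
        add_increasing2\<close>)
qed

lemma dd_kernel_le:
  fixes z :: "real^'n"
  assumes b: "0 \<le> b"
  shows "\<bar>2 * z $ k * rk b j z\<bar> \<le> 2 * (real j * (2 ^ (j - 1) * fact (j - 1)) + 2 ^ j * fact j)
      * (b * norm z * exp (- (b * (z \<bullet> z)) / 2))"
proof -
  let ?u = "b * (z \<bullet> z)" and ?c = "real j * (2 ^ (j - 1) * fact (j - 1)) + 2 ^ j * fact j :: real"
  have "\<bar>rk b j z\<bar> \<le> b * (real j * (2 ^ (j - 1) * fact (j - 1) * exp (- ?u / 2)) + 2 ^ j *
      fact j * exp (- ?u / 2))"
    using b by (intro order_trans[OF abs_rk_le[OF b]] mult_left_mono add_mono power_exp_le_fact_half) auto
  also have "\<dots> = ?c * (b * exp (- ?u / 2))" by (simp add: algebra_simps)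
  finally have 1: "\<bar>rk b j z\<bar> \<le> ?c * (b * exp (- ?u / 2))" .
  have "\<bar>z $ k\<bar> * \<bar>rk b j z\<bar> \<le> norm z * (?c * (b * exp (- ?u / 2)))"
    using 1 by (intro mult_mono component_le_norm_cart) auto
  then show ?thesis by (simp add: abs_mult algebra_simps)
qed

lemma CE_ek_left: "CE 1 (\<lambda>x. ek b j (x - y))" for y :: "'a::euclidean_space"
proof -
  have "CE (Suc 0) (\<lambda>x. ek b j (x - y))"
    by (rule CE_SucI[where h' = "\<lambda>c x. 2 * ((x - y) \<bullet> c) * rk b j (x - y)"])
      (auto intro!: continuous_intros continuous_on_compose2[OF continuous_ek[of UNIV]]
        continuous_on_compose2[OF continuous_rk[of UNIV]] has_dd_diff_arg has_dd_ek)
  then show ?thesis by simp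
qed

lemma CE_ek_right: "CE 1 (\<lambda>y. ek b j (x - y))" for x :: "'a::euclidean_space"
proof -
  have "CE (Suc 0) (\<lambda>y. ek b j (x - y))"
    by (rule CE_SucI[where h' = "\<lambda>c y. - (2 * ((x - y) \<bullet> c) * rk b j (x - y))"])
      (auto intro!: continuous_intros continuous_on_compose2[OF continuous_ek[of UNIV]]
        continuous_on_compose2[OF continuous_rk[of UNIV]] has_dd_diff_arg2 has_dd_ek)
  then show ?thesis by simp
qed

lemma Vf_ek_left: "Vf p q a (\<lambda>x. ek b j (x - y)) x = 2 * (vcoef p q a x \<bullet> (x - y)) * rk b j
    (x - y)"
proof -
  have 1: "dd (axis k 1) (\<lambda>x. ek b j (x - y)) x = 2 * ((x - y) \<bullet> axis k 1) * rk b j (x -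
      y)" for k
    by (intro dd_eqI has_dd_diff_arg has_dd_ek)
  have "Vf p q a (\<lambda>x. ek b j (x - y)) x = (\<Sum>k\<in>UNIV. 2 * rk b j (x - y) * (vcoef p q a x $
      k * (x - y) $ k))"
    unfolding Vf_def 1 by (intro sum.cong) (auto simp: inner_axis mult_ac)
  also have "\<dots> = 2 * rk b j (x - y) * (vcoef p q a x \<bullet> (x - y))"
    unfolding sum_distrib_left[symmetric] by (simp only: inner_vec_def inner_real_def)
  finally show ?thesis by simp
qed

lemma Vf_ek_right: "Vf p q a (\<lambda>y. ek b j (x - y)) y = - (2 * (vcoef p q a y \<bullet> (x - y)) * rk
    b j (x - y))"
proof -
  have 1: "dd (axis k 1) (\<lambda>y. ek b j (x - y)) y = - (2 * ((x - y) \<bullet> axis k 1) * rk b j (x -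
      y))" for k
    by (intro dd_eqI has_dd_diff_arg2 has_dd_ek)
  have "Vf p q a (\<lambda>y. ek b j (x - y)) y = (\<Sum>k\<in>UNIV. - (2 * rk b j (x - y)) * (vcoef p q a
      y $ k * (x - y) $ k))"
    unfolding Vf_def 1 by (intro sum.cong) (auto simp: inner_axis mult_ac)
  also have "\<dots> = - (2 * rk b j (x - y)) * (vcoef p q a y \<bullet> (x - y))"
    unfolding sum_distrib_left[symmetric] by (simp only: inner_vec_def inner_real_def)
  finally show ?thesis by simp
qed

text \<open>The sum of the \<open>x\<close>- and the \<open>y\<close>-field only sees the radial function of \<open>x - y\<close>.\<close>

lemma Vf_ek_sum:
  "Vf p q a (\<lambda>x. ek b j (x - y)) x = - Vf p q a (\<lambda>y. ek b j (x - y)) y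
     + (if a = Scal then 2 * real j * ek b j (x - y) - 2 * ek b (Suc j) (x - y) else 0)"
proof -
  have "2 * (vcoef p q a x \<bullet> (x - y)) * rk b j (x - y) - 2 * (vcoef p q a y \<bullet> (x - y)) * rk
      b j (x - y)
      = 2 * (vcoef 0 0 a (x - y) \<bullet> (x - y)) * rk b j (x - y)"
    unfolding vcoef_diff[of p q a x y, symmetric] by (simp add: inner_diff_left algebra_simps)
  also have "\<dots> = (if a = Scal then 2 * real j * ek b j (x - y) - 2 * ek b (Suc j) (x - y) else 0)"
    by (simp add: inner_vcoef00 inner_self_rk)
  finally show ?thesis unfolding Vf_ek_left Vf_ek_right by simp
qed

lemma Vf_ek_right_bounded:
  assumes b: "0 \<le> b"
  obtains B where "\<And>y. \<bar>Vf 1 t a (\<lambda>y. ek b j (x - y)) y\<bar> \<le> B"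
proof -
  obtain C where C: "\<And>z::(real, 'a) vec. (z \<bullet> z) * \<bar>rk b j z\<bar> \<le> C"
      "\<And>z::(real, 'a) vec. norm z * \<bar>rk b j z\<bar> \<le> C"
    using rk_bounds[OF b] by metis
  have "\<bar>Vf 1 t a (\<lambda>y. ek b j (x - y)) y\<bar> \<le> 2 * (1 + \<bar>t\<bar> + 2 * norm x) * C
      + 4 * C" for y
  proof -
    let ?z = "x - y"
    have "norm y \<le> norm x + norm ?z" by (metis add.commute diff_add_cancel norm_minus_commute
        norm_triangle_sub)
    then have v: "norm (vcoef 1 t a y) \<le> (1 + \<bar>t\<bar> + 2 * norm x) + 2 * norm ?z"
      using norm_vcoef[of 1 t a y] by linarith
    have "\<bar>vcoef 1 t a y \<bullet> ?z\<bar> \<le> norm (vcoef 1 t a y) * norm ?z" by (rule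
        Cauchy_Schwarz_ineq2)
    also have "\<dots> \<le> ((1 + \<bar>t\<bar> + 2 * norm x) + 2 * norm ?z) * norm ?z" using v by (rule
        mult_right_mono) simp
    finally have "\<bar>vcoef 1 t a y \<bullet> ?z\<bar> * \<bar>rk b j ?z\<bar> \<le> (((1 + \<bar>t\<bar>
        + 2 * norm x) + 2 * norm ?z) * norm ?z) * \<bar>rk b j ?z\<bar>"
      by (rule mult_right_mono) simp
    also have "\<dots> = (1 + \<bar>t\<bar> + 2 * norm x) * (norm ?z * \<bar>rk b j ?z\<bar>) + 2 * ((?z
        \<bullet> ?z) * \<bar>rk b j ?z\<bar>)"
      by (simp add: dot_square_norm power2_eq_square algebra_simps)
    also have "\<dots> \<le> (1 + \<bar>t\<bar> + 2 * norm x) * C + 2 * C"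
      using C by (intro add_mono mult_left_mono) auto
    finally have "2 * (\<bar>vcoef 1 t a y \<bullet> ?z\<bar> * \<bar>rk b j ?z\<bar>) \<le> 2 * ((1 +
        \<bar>t\<bar> + 2 * norm x) * C + 2 * C)" by simp
    moreover have "\<bar>Vf 1 t a (\<lambda>y. ek b j (x - y)) y\<bar> = 2 * (\<bar>vcoef 1 t a y \<bullet>
        ?z\<bar> * \<bar>rk b j ?z\<bar>)"
      unfolding Vf_ek_right abs_minus_cancel abs_mult by simp
    ultimately show ?thesis by (simp add: algebra_simps)
  qed
  then show ?thesis by (rule that)
qed

lemma integral_swap_bounded:
  fixes K :: "'a::euclidean_space \<times> 'b::euclidean_space \<Rightarrow> real"
  assumes [measurable]: "K \<in> borel_measurable borel" and C: "\<And>z. \<bar>K z\<bar> \<le> C"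
    and \<xi>: "integrable lborel \<xi>" and \<rho>: "integrable lborel \<rho>"
  shows "(\<integral>x. \<xi> x * (\<integral>y. \<rho> y * K (x, y) \<partial>lborel) \<partial>lborel) =
      (\<integral>y. \<rho> y * (\<integral>x. \<xi> x * K (x, y) \<partial>lborel) \<partial>lborel)"
proof -
  have [measurable]: "\<xi> \<in> borel_measurable borel" "\<rho> \<in> borel_measurable borel"
    using borel_measurable_integrable[OF \<xi>] borel_measurable_integrable[OF \<rho>] by simp_all
  have C0: "0 \<le> C" using C[of undefined] by linarith
  have "integrable (lborel \<Otimes>\<^sub>M lborel) (\<lambda>z. \<xi> (fst z) * \<rho> (snd z))"
    using lborel_pair.integrable_fst'
    by (intro lborel_pair.Fubini_integrable)
      (use \<xi> \<rho> in \<open>simp_all add: abs_mult lborel_prod\<close>)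
  then have "integrable lborel (\<lambda>z. C * (\<xi> (fst z) * \<rho> (snd z)))" by (simp add:
      lborel_prod)
  then have "integrable lborel (\<lambda>z. \<xi> (fst z) * \<rho> (snd z) * K z)"
  proof (rule Bochner_Integration.integrable_bound)
    show "AE z in lborel. norm (\<xi> (fst z) * \<rho> (snd z) * K z) \<le> norm (C * (\<xi> (fst z) *
        \<rho> (snd z)))"
      using C C0 by (intro AE_I2) (auto simp: abs_mult mult.commute[of C] intro!: mult_left_mono)
  qed measurable
  then have "integrable (lborel \<Otimes>\<^sub>M lborel) (\<lambda>(x, y). \<xi> x * \<rho> y * K (x, y))"
      by (simp add: lborel_prod case_prod_beta')
  from lborel_pair.Fubini_integral[OF this]
  have "(\<integral>y. \<integral>x. \<xi> x * \<rho> y * K (x, y) \<partial>lborel \<partial>lborel) =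
      (\<integral>x. \<integral>y. \<xi> x * \<rho> y * K (x, y) \<partial>lborel \<partial>lborel)" .
  moreover have "(\<integral>x. \<xi> x * \<rho> y * K (x, y) \<partial>lborel) = \<rho> y * (\<integral>x.
      \<xi> x * K (x, y) \<partial>lborel)" for y
    by (subst integral_mult_right_zero[symmetric]) (simp add: mult_ac)
  moreover have "(\<integral>y. \<xi> x * \<rho> y * K (x, y) \<partial>lborel) = \<xi> x * (\<integral>y.
      \<rho> y * K (x, y) \<partial>lborel)" for x
    by (subst integral_mult_right_zero[symmetric]) (simp add: mult_ac)
  ultimately show ?thesis by simp
qed

definition gpot :: "real \<Rightarrow> nat \<Rightarrow> (real^'n \<Rightarrow> real) \<Rightarrow> real^'n
    \<Rightarrow> real" where
  "gpot b j \<rho> x = (\<integral>y. \<rho> y * ek b j (x - y) \<partial>lborel)"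

lemma integral_adj_gpot:
  fixes \<xi> :: "(real, 'n::{finite,linorder}) vec \<Rightarrow> real"
  assumes a: "a \<in> vfs" and b: "0 \<le> b" and \<rho>: "integrable lborel \<rho>"
    and \<xi>: "CE 1 \<xi>" and supp: "\<And>x. R < norm x \<Longrightarrow> \<xi> x = 0"
  shows "(\<integral>x. adj t a \<xi> x * gpot b j \<rho> x \<partial>lborel)
     = (\<integral>x. \<xi> x * (\<integral>y. \<rho> y * Vf 1 t a (\<lambda>x. ek b j (x - y)) x
         \<partial>lborel) \<partial>lborel)"
proof -
  have \<xi>': "CE (Suc 0) \<xi>" using \<xi> by simp
  have i\<xi>: "integrable lborel \<xi>" "integrable lborel (adj t a \<xi>)"
    by (rule integrable_compact_support[OF CE_continuous[OF \<xi>] supp]) 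
      (auto intro!: integrable_compact_support[OF CE_continuous[OF CE_adj[OF \<xi>']]] adj_eq_0_outside[of
          R \<xi>, OF supp])
  obtain C where C: "\<And>z::(real, 'n) vec. norm z * \<bar>rk b j z\<bar> \<le> C" using rk_bounds[OF b]
      by metis
  have C0: "0 \<le> C" using C[of 0] by simp
  have [measurable]: "ek b j \<in> borel_measurable (borel :: (real, 'n) vec measure)" "rk b j \<in>
      borel_measurable (borel :: (real, 'n) vec measure)"
    by (intro borel_measurable_continuous_onI continuous_ek continuous_rk)+
  have vm: "(\<lambda>x. vcoef 1 t a x) \<in> borel_measurable (borel :: (real, 'n) vec measure)"
    by (intro borel_measurable_continuous_onI) (cases a; auto intro!: continuous_intros)
  have ind: "\<xi> x * (indicator (cball 0 R) x * V) = \<xi> x * V" for x V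
    using supp[of x] by (auto simp: indicator_def not_le)
  have "(\<integral>x. adj t a \<xi> x * gpot b j \<rho> x \<partial>lborel) = (\<integral>y. \<rho> y *
      (\<integral>x. adj t a \<xi> x * ek b j (x - y) \<partial>lborel) \<partial>lborel)"
    unfolding gpot_def
    using integral_swap_bounded[of "\<lambda>z. ek b j (fst z - snd z)" "fact j", OF _ ek_bound[OF b]
        i\<xi>(2) \<rho>] by simp
  also have "\<dots> = (\<integral>y. \<rho> y * (\<integral>x. \<xi> x * Vf 1 t a (\<lambda>x. ek b j (x -
      y)) x \<partial>lborel) \<partial>lborel)"
    using integral_Vf_mult[OF a CE_ek_left \<xi> supp] by (simp add: mult.commute)
  also have "\<dots> = (\<integral>y. \<rho> y * (\<integral>x. \<xi> x * (indicator (cball 0 R) x * Vf 1 t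
      a (\<lambda>x. ek b j (x - y)) x) \<partial>lborel) \<partial>lborel)"
    by (simp only: ind)
  also have "\<dots> = (\<integral>x. \<xi> x * (\<integral>y. \<rho> y * (indicator (cball 0 R) x * Vf 1 t
      a (\<lambda>x. ek b j (x - y)) x) \<partial>lborel) \<partial>lborel)"
  proof -
    let ?K = "\<lambda>z. indicator (cball 0 R) (fst z) * (2 * (vcoef 1 t a (fst z) \<bullet> (fst z - snd
        z)) * rk b j (fst z - snd z)) :: real"
    have [measurable]: "(\<lambda>z::'n phase. indicator (cball 0 R) (fst z) :: real) \<in>
        borel_measurable borel"
      "(\<lambda>z::'n phase. vcoef 1 t a (fst z)) \<in> borel_measurable borel"
      by (rule measurable_compose[OF fst_borel borel_measurable_indicator[OF borel_closed[OF
          closed_cball]]],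
          rule measurable_compose[OF fst_borel vm])
    have m: "?K \<in> borel_measurable borel" by measurable
    have "\<bar>?K z\<bar> \<le> 2 * ((1 + \<bar>t\<bar> + 2 * \<bar>R\<bar>) * C)" for z
    proof (cases "fst z \<in> cball 0 R")
      case True
      have "norm (vcoef 1 t a (fst z)) \<le> 1 + \<bar>t\<bar> + 2 * \<bar>R\<bar>"
        using norm_vcoef[of 1 t a "fst z"] True by simp
      moreover have "\<bar>vcoef 1 t a (fst z) \<bullet> (fst z - snd z)\<bar> \<le> norm (vcoef 1 t a (fst
          z)) * norm (fst z - snd z)"
        by (rule Cauchy_Schwarz_ineq2)
      ultimately have "\<bar>vcoef 1 t a (fst z) \<bullet> (fst z - snd z)\<bar> \<le> (1 + \<bar>t\<bar> +
          2 * \<bar>R\<bar>) * norm (fst z - snd z)"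
        by (meson mult_right_mono norm_ge_zero order_trans)
      then have "\<bar>vcoef 1 t a (fst z) \<bullet> (fst z - snd z)\<bar> * \<bar>rk b j (fst z - snd
          z)\<bar>
          \<le> (1 + \<bar>t\<bar> + 2 * \<bar>R\<bar>) * norm (fst z - snd z) * \<bar>rk b j (fst z - snd
              z)\<bar>"
        by (rule mult_right_mono) simp
      also have "\<dots> \<le> (1 + \<bar>t\<bar> + 2 * \<bar>R\<bar>) * C"
        unfolding mult.assoc by (intro mult_left_mono C) auto
      finally show ?thesis using True by (simp add: abs_mult)
    qed (use C0 in auto)
    from integral_swap_bounded[OF m this i\<xi>(1) \<rho>] show ?thesis unfolding Vf_ek_left by simp
  qed
  also have "\<dots> = (\<integral>x. \<xi> x * (\<integral>y. \<rho> y * Vf 1 t a (\<lambda>x. ek b j (x -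
      y)) x \<partial>lborel) \<partial>lborel)"
    using supp by (intro Bochner_Integration.integral_cong refl) (auto simp: indicator_def not_le)
  finally show ?thesis .
qed

lemma norm_mult_le_bound: "\<bar>k\<bar> \<le> C \<Longrightarrow> norm (r * k :: real) \<le> norm (C *
    \<bar>r\<bar>)"
proof -
  assume "\<bar>k\<bar> \<le> C"
  then have "\<bar>r\<bar> * \<bar>k\<bar> \<le> \<bar>r\<bar> * \<bar>C\<bar>" by (intro mult_left_mono)
      auto
  then show ?thesis by (simp add: abs_mult mult.commute)
qed

definition adm :: "nat \<Rightarrow> 'n::{finite,linorder} kin \<Rightarrow> real \<Rightarrow> bool" where
  "adm m g t \<longleftrightarrow> CE m (\<lambda>z. g t (fst z) (snd z)) \<and>
     (\<forall>\<beta>\<in>multi_indices m. (\<forall>R. set_integrable lborel (cball 0 R \<times> UNIV)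
         (\<lambda>z. Zs \<beta> g t (fst z) (snd z)))
        \<and> integrable lborel (rho (Zs \<beta> g) t))"

lemma Nil_multi: "[] \<in> multi_indices m"
  by (simp add: multi_indices_def)

lemma CE_vcoef_fst: "CE m (\<lambda>z :: 'n::finite phase. vcoef p q a (fst z) $ k)"
  and CE_vcoef_snd: "CE m (\<lambda>z :: 'n::finite phase. vcoef p q a (snd z) $ k)"
proof -
  have c: "CE m (\<lambda>z :: 'n phase. fst z $ i)" "CE m (\<lambda>z :: 'n phase. snd z $ i)" for i
    using CE_inner[of m "(axis i (1::real), 0 :: (real, 'n) vec)"] CE_inner[of m "(0 :: (real, 'n) vec,
        axis i (1::real))"]
    by (simp_all add: inner_prod_def inner_axis inner_real_def)
  show "CE m (\<lambda>z :: 'n phase. vcoef p q a (fst z) $ k)"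
  proof (cases a)
    case (Rot i j)
    show ?thesis unfolding Rot
      using CE_diff[OF CE_cmult[OF c(1)[of i], of "axis j 1 $ k"] CE_cmult[OF c(1)[of j], of "axis i 1 $
          k"]]
      by (simp add: mult.commute)
  qed (auto simp: CE_const c)
  show "CE m (\<lambda>z :: 'n phase. vcoef p q a (snd z) $ k)"
  proof (cases a)
    case (Rot i j)
    show ?thesis unfolding Rot
      using CE_diff[OF CE_cmult[OF c(2)[of i], of "axis j 1 $ k"] CE_cmult[OF c(2)[of j], of "axis i 1 $
          k"]]
      by (simp add: mult.commute)
  qed (auto simp: CE_const c)
qed

lemma dx_eq_dd: "dx i g t x v = dd (axis i 1, 0) (\<lambda>z. g t (fst z) (snd z)) (x, v)"
  and dv_eq_dd: "dv i g t x v = dd (0, axis i 1) (\<lambda>z. g t (fst z) (snd z)) (x, v)"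
  by (simp_all add: dx_def dv_def pd_def dd_def)

lemma Z_eq_sum:
  "Z a g t (fst z) (snd z) = (\<Sum>k\<in>UNIV. vcoef 1 t a (fst z) $ k * dd (axis k 1, 0) (\<lambda>z. g t
      (fst z) (snd z)) z)
      + (\<Sum>k\<in>UNIV. vcoef 0 1 a (snd z) $ k * dd (0, axis k 1) (\<lambda>z. g t (fst z) (snd z)) z)"
  by (simp add: Z_eq_Vf Vf_def dd_def)

lemma CE_Z:
  assumes "CE (Suc m) (\<lambda>z. g t (fst z) (snd z))"
  shows "CE m (\<lambda>z. Z a g t (fst z) (snd z))"
  unfolding Z_eq_sum
  by (intro CE_add CE_sum CE_mult CE_vcoef_fst CE_vcoef_snd CE_dd[OF assms] axis_fst_Basis axis_snd_Basis)

lemma adm_Z: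
  assumes "adm (Suc m) g t" "a \<in> vfs"
  shows "adm m (Z a g) t"
proof -
  have "Zs \<beta> (Z a g) = Zs (\<beta> @ [a]) g" "\<beta> @ [a] \<in> multi_indices (Suc m)" if "\<beta>
      \<in> multi_indices m" for \<beta>
    using that assms(2) by (auto simp: Zs_def multi_indices_def)
  then show ?thesis using assms(1) CE_Z[of m g t a] unfolding adm_def by simp
qed

lemma adm_Suc: "adm (Suc m) g t \<Longrightarrow> adm m g t"
  unfolding adm_def multi_indices_def using CE_SucD by (auto simp del: CE.simps)

lemma integral_adj_gpot_rho:
  fixes \<xi> :: "(real, 'n::{finite,linorder}) vec \<Rightarrow> real"
  assumes a: "a \<in> vfs" and b: "0 \<le> b" and g: "adm (Suc m) g t"
    and \<xi>: "CE 1 \<xi>" and supp: "\<And>x. R < norm x \<Longrightarrow> \<xi> x = 0"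
  shows "(\<integral>x. adj t a \<xi> x * gpot b j (rho g t) x \<partial>lborel)
     = (\<integral>x. \<xi> x * gpot b j (rho (Z a g) t) x \<partial>lborel)
      + (if a = Scal then (2 * real CARD('n) + 2 * real j) * (\<integral>x. \<xi> x * gpot b j (rho g t) x
          \<partial>lborel)
           - 2 * (\<integral>x. \<xi> x * gpot b (Suc j) (rho g t) x \<partial>lborel) else 0)"
proof -
  have g0: "CE 1 (\<lambda>z. g t (fst z) (snd z))" "integrable lborel (rho g t)" "integrable lborel (rho
      (Z a g) t)"
    "\<And>R. set_integrable lborel (cball 0 R \<times> UNIV) (\<lambda>z. g t (fst z) (snd z))"
    "\<And>R. set_integrable lborel (cball 0 R \<times> UNIV) (\<lambda>z. Z a g t (fst z) (snd z))"
  proof -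
    have Zs: "Zs [] g = g" "Zs [a] g = Z a g" by (auto simp: Zs_def)
    have mem: "[] \<in> multi_indices (Suc m)" "[a] \<in> multi_indices (Suc m)"
      using a by (auto simp: multi_indices_def)
    have "(\<forall>R. set_integrable lborel (cball 0 R \<times> UNIV) (\<lambda>z. Zs \<beta> g t (fst z)
        (snd z)))
        \<and> integrable lborel (rho (Zs \<beta> g) t)" if "\<beta> \<in> multi_indices (Suc m)" for
            \<beta>
      using g that unfolding adm_def by blast
    from this[OF mem(1)] this[OF mem(2)] show "integrable lborel (rho g t)" "integrable lborel (rho (Z a g)
        t)"
      "\<And>R. set_integrable lborel (cball 0 R \<times> UNIV) (\<lambda>z. g t (fst z) (snd z))"
      "\<And>R. set_integrable lborel (cball 0 R \<times> UNIV) (\<lambda>z. Z a g t (fst z) (snd z))"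
      unfolding Zs by auto
    show "CE 1 (\<lambda>z. g t (fst z) (snd z))"
      by (rule CE_le[of "Suc m"]) (use g in \<open>auto simp: adm_def simp del: CE.simps\<close>)
  qed
  have [measurable]: "ek b i \<in> borel_measurable (borel :: (real, 'n) vec measure)" for i
    by (intro borel_measurable_continuous_onI continuous_ek)
  have ie: "integrable lborel (\<lambda>y. \<rho> y * ek b i (x - y))" if "integrable lborel \<rho>" for
      \<rho> i and x :: "(real, 'n) vec"
  proof (rule Bochner_Integration.integrable_bound[OF integrable_mult_right[OF integrable_abs[OF that], of
      "fact i"]])
    show "AE y in lborel. norm (\<rho> y * ek b i (x - y)) \<le> norm (fact i * \<bar>\<rho> y\<bar>)"
      by (intro AE_I2 norm_mult_le_bound ek_bound[OF b])
  qed (use borel_measurable_integrable[OF that] in measurable)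
  have im: "integrable lborel (\<lambda>x. \<xi> x * gpot b i \<rho> x)" if \<rho>: "integrable lborel
      \<rho>" for i \<rho>
  proof (rule Bochner_Integration.integrable_bound[OF
        integrable_mult_right[OF integrable_abs[OF integrable_compact_support[OF CE_continuous[OF \<xi>]
            supp]], of "fact i * (\<integral>y. \<bar>\<rho> y\<bar> \<partial>lborel)"]])
    have [measurable]: "\<rho> \<in> borel_measurable borel" "\<xi> \<in> borel_measurable borel"
      using borel_measurable_integrable[OF \<rho>] borel_measurable_continuous_onI[OF CE_continuous[OF
          \<xi>]] by simp_all
    show "(\<lambda>x. \<xi> x * gpot b i \<rho> x) \<in> borel_measurable lborel" unfolding
        gpot_def[abs_def] by measurable
    have G: "\<bar>gpot b i \<rho> x\<bar> \<le> fact i * (\<integral>y. \<bar>\<rho> y\<bar>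
        \<partial>lborel)" for x
    proof -
      have "\<bar>gpot b i \<rho> x\<bar> \<le> (\<integral>y. \<bar>\<rho> y * ek b i (x - y)\<bar>
          \<partial>lborel)" unfolding gpot_def by (rule integral_abs_bound)
      also have "\<dots> \<le> (\<integral>y. fact i * \<bar>\<rho> y\<bar> \<partial>lborel)"
        using norm_mult_le_bound[OF ek_bound[OF b]]
        by (intro integral_mono integrable_abs ie \<rho> integrable_mult_right) (simp add: abs_mult)
      finally show ?thesis by simp
    qed
    show "AE x in lborel. norm (\<xi> x * gpot b i \<rho> x) \<le> norm (fact i * (\<integral>y.
        \<bar>\<rho> y\<bar> \<partial>lborel) * \<bar>\<xi> x\<bar>)"
      by (intro AE_I2 norm_mult_le_bound G)
  qed auto
  have pt: "(\<integral>y. rho g t y * Vf 1 t a (\<lambda>x. ek b j (x - y)) x \<partial>lborel) = gpot b j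
      (rho (Z a g) t) x
      + (if a = Scal then (2 * real CARD('n) + 2 * real j) * gpot b j (rho g t) x - 2 * gpot b (Suc j) (rho
          g t) x else 0)" for x
  proof -
    obtain B where B: "\<And>y. \<bar>Vf 1 t a (\<lambda>y. ek b j (x - y)) y\<bar> \<le> B" using
        Vf_ek_right_bounded[OF b] by metis
    have rz: "(\<integral>y. rho (Z a g) t y * ek b j (x - y) \<partial>lborel)
        = (\<integral>y. rho g t y * (- Vf 1 t a (\<lambda>y. ek b j (x - y)) y - 2 * dvg a * ek b j (x -
            y)) \<partial>lborel)"
    proof (rule rho_Z_integral[where B = "max (fact j) B", OF a g0(1) g0(4,5,2,3)])
      show "CE 1 (\<lambda>y. ek b j (x - y))" by (rule CE_ek_right)
      show "\<bar>ek b j (x - y)\<bar> \<le> max (fact j) B" for y using ek_bound[OF b, of j "x - y"] by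
          simp
      show "\<bar>Vf 1 t a (\<lambda>y. ek b j (x - y)) y\<bar> \<le> max (fact j) B" for y using B[of y]
          by simp
    qed
    have iV: "integrable lborel (\<lambda>y. rho g t y * Vf 1 t a (\<lambda>y. ek b j (x - y)) y)"
    proof (rule Bochner_Integration.integrable_bound[OF integrable_mult_right[OF integrable_abs[OF g0(2)],
        of B]])
      have "CE (Suc 0) (\<lambda>y. ek b j (x - y))" using CE_ek_right[of b j x] by simp
      from borel_measurable_continuous_onI[OF CE_continuous[OF CE_Vf[OF this]]]
      show "(\<lambda>y. rho g t y * Vf 1 t a (\<lambda>y. ek b j (x - y)) y) \<in> borel_measurable lborel"
        using borel_measurable_integrable[OF g0(2)] by measurable
      show "AE y in lborel. norm (rho g t y * Vf 1 t a (\<lambda>y. ek b j (x - y)) y) \<le> norm (B *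
          \<bar>rho g t y\<bar>)"
        by (intro AE_I2 norm_mult_le_bound B)
    qed
    let ?c = "if a = Scal then 1 else (0::real)"
    have e: "rho g t y * Vf 1 t a (\<lambda>x. ek b j (x - y)) x = - (rho g t y * Vf 1 t a (\<lambda>y. ek
        b j (x - y)) y)
        + (?c * (2 * real j) * (rho g t y * ek b j (x - y)) - ?c * 2 * (rho g t y * ek b (Suc j) (x - y)))"
            for y
      unfolding Vf_ek_sum[of 1 t a b j y x] by (simp add: algebra_simps)
    have "(\<integral>y. rho g t y * Vf 1 t a (\<lambda>x. ek b j (x - y)) x \<partial>lborel) = -
        (\<integral>y. rho g t y * Vf 1 t a (\<lambda>y. ek b j (x - y)) y \<partial>lborel)
        + (?c * (2 * real j) * gpot b j (rho g t) x - ?c * 2 * gpot b (Suc j) (rho g t) x)"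
      unfolding e gpot_def using ie[OF g0(2)] iV by simp
    moreover have "gpot b j (rho (Z a g) t) x = - (\<integral>y. rho g t y * Vf 1 t a (\<lambda>y. ek b j
        (x - y)) y \<partial>lborel)
        - 2 * dvg a * gpot b j (rho g t) x"
    proof -
      have "rho g t y * (- Vf 1 t a (\<lambda>y. ek b j (x - y)) y - 2 * dvg a * ek b j (x - y))
          = - (rho g t y * Vf 1 t a (\<lambda>y. ek b j (x - y)) y) - 2 * dvg a * (rho g t y * ek b j (x -
              y))" for y
        by (simp add: algebra_simps)
      then show ?thesis unfolding gpot_def rz using ie[OF g0(2)] iV by simp
    qed
    ultimately show ?thesis by (cases "a = Scal") (simp_all add: dvg_def algebra_simps del: Z.simps)
  qed
  let ?c = "if a = Scal then 1 else (0::real)"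
  have "(\<integral>x. adj t a \<xi> x * gpot b j (rho g t) x \<partial>lborel)
     = (\<integral>x. \<xi> x * gpot b j (rho (Z a g) t) x + (?c * (2 * real CARD('n) + 2 * real j) *
         (\<xi> x * gpot b j (rho g t) x)
           - ?c * 2 * (\<xi> x * gpot b (Suc j) (rho g t) x)) \<partial>lborel)"
    by (subst integral_adj_gpot[OF a b g0(2) \<xi> supp], assumption, unfold pt,
        intro Bochner_Integration.integral_cong refl)
      (cases "a = Scal"; simp add: algebra_simps del: Z.simps)
  also have "\<dots> = (\<integral>x. \<xi> x * gpot b j (rho (Z a g) t) x \<partial>lborel)
      + (?c * (2 * real CARD('n) + 2 * real j) * (\<integral>x. \<xi> x * gpot b j (rho g t) x
          \<partial>lborel)
           - ?c * 2 * (\<integral>x. \<xi> x * gpot b (Suc j) (rho g t) x \<partial>lborel))"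
    using im[OF g0(2)] im[OF g0(3)] by (simp del: Z.simps)
  finally show ?thesis by (simp del: Z.simps)
qed

definition gauss_L1 :: "real \<Rightarrow> (real^'n \<Rightarrow> real) \<Rightarrow> (real^'n
    \<Rightarrow> real) \<Rightarrow> ennreal" where
  "gauss_L1 b \<zeta> \<rho> = (\<integral>\<^sup>+x. \<integral>\<^sup>+y. ennreal (\<bar>\<zeta> x\<bar>
      * \<bar>\<rho> y\<bar> *
      (b * norm (x - y) * exp (- (b * ((x - y) \<bullet> (x - y))) / 2))) \<partial>lborel
          \<partial>lborel)"

lemma CE_fold_adj: "CE (length l + m) \<zeta> \<Longrightarrow> CE m (fold (adj t) l \<zeta>)"
proof (induction l arbitrary: \<zeta>)
  case (Cons a l)
  have "CE (Suc (length l + m)) \<zeta>" using Cons.prems by (simp del: CE.simps)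
  from Cons.IH[OF CE_adj[OF this]] show ?case by simp
qed simp

lemma fold_adj_eq_0_outside:
  assumes "\<And>x. R < norm x \<Longrightarrow> \<zeta> x = 0" "R < norm x" shows "fold (adj t) l \<zeta>
      x = 0"
  using assms(1)
proof (induction l arbitrary: \<zeta>)
  case (Cons a l)
  show ?case using Cons.IH[OF adj_eq_0_outside[of R \<zeta>, OF Cons.prems]] by simp
qed (use assms(2) in simp)

lemma abs_integral_le_nn_integral:
  fixes h :: "'a \<Rightarrow> real"
  shows "ennreal \<bar>\<integral>x. h x \<partial>M\<bar> \<le> (\<integral>\<^sup>+x. ennreal \<bar>h
      x\<bar> \<partial>M)"
proof (cases "integrable M h")
  case True
  then show ?thesis using integral_norm_bound_ennreal[of M h] by simp
qed (simp add: not_integrable_integral_eq)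

lemma gpot_base_est:
  fixes \<zeta> :: "(real, 'n::{finite,linorder}) vec \<Rightarrow> real"
  assumes b: "0 \<le> b" and \<rho>: "integrable lborel \<rho>"
    and \<zeta>: "CE 1 \<zeta>" and supp: "\<And>x. R < norm x \<Longrightarrow> \<zeta> x = 0"
  shows "ennreal \<bar>\<integral>x. adj t (Trans k) \<zeta> x * gpot b j \<rho> x \<partial>lborel\<bar>
     \<le> ennreal (2 * (real j * (2 ^ (j - 1) * fact (j - 1)) + 2 ^ j * fact j)) * gauss_L1 b \<zeta>
         \<rho>"
proof -
  let ?C = "2 * (real j * (2 ^ (j - 1) * fact (j - 1)) + 2 ^ j * fact j) :: real"
  have [measurable]: "\<rho> \<in> borel_measurable borel" "\<zeta> \<in> borel_measurable borel"
    using borel_measurable_integrable[OF \<rho>] borel_measurable_continuous_onI[OF CE_continuous[OF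
        \<zeta>]] by simp_all
  have V: "Vf 1 t (Trans k) (\<lambda>x. ek b j (x - y)) x = 2 * (x - y) $ k * rk b j (x - y)" for x y ::
      "(real, 'n) vec"
    unfolding Vf_ek_left by (simp add: inner_axis')
  have tr: "Trans k \<in> vfs" by (simp add: vfs_def)
  have "ennreal \<bar>\<integral>x. adj t (Trans k) \<zeta> x * gpot b j \<rho> x \<partial>lborel\<bar>
      \<le> (\<integral>\<^sup>+x. ennreal \<bar>\<zeta> x * (\<integral>y. \<rho> y * (2 * (x - y) $ k *
          rk b j (x - y)) \<partial>lborel)\<bar> \<partial>lborel)"
    by (subst integral_adj_gpot[OF tr b \<rho> \<zeta> supp], assumption, unfold V, rule
        abs_integral_le_nn_integral)
  also have "\<dots> \<le> (\<integral>\<^sup>+x. ennreal ?C * (\<integral>\<^sup>+y. ennreal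
      (\<bar>\<zeta> x\<bar> * \<bar>\<rho> y\<bar> *
      (b * norm (x - y) * exp (- (b * ((x - y) \<bullet> (x - y))) / 2))) \<partial>lborel)
          \<partial>lborel)"
  proof (rule nn_integral_mono)
    fix x
    have "ennreal \<bar>\<zeta> x * (\<integral>y. \<rho> y * (2 * (x - y) $ k * rk b j (x - y))
        \<partial>lborel)\<bar>
        = ennreal \<bar>\<integral>y. \<zeta> x * (\<rho> y * (2 * (x - y) $ k * rk b j (x - y)))
            \<partial>lborel\<bar>" by simp
    also have "\<dots> \<le> (\<integral>\<^sup>+y. ennreal \<bar>\<zeta> x * (\<rho> y * (2 * (x - y) $ k
        * rk b j (x - y)))\<bar> \<partial>lborel)"
      by (rule abs_integral_le_nn_integral)
    also have "\<dots> \<le> (\<integral>\<^sup>+y. ennreal ?C * ennreal (\<bar>\<zeta> x\<bar> *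
        \<bar>\<rho> y\<bar> *
      (b * norm (x - y) * exp (- (b * ((x - y) \<bullet> (x - y))) / 2))) \<partial>lborel)"
    proof (rule nn_integral_mono)
      fix y
      have "\<bar>\<zeta> x\<bar> * \<bar>\<rho> y\<bar> * \<bar>2 * (x - y) $ k * rk b j (x - y)\<bar>
          \<le> \<bar>\<zeta> x\<bar> * \<bar>\<rho> y\<bar> * (?C * (b * norm (x - y) * exp (- (b * ((x -
              y) \<bullet> (x - y))) / 2)))"
        by (intro mult_left_mono dd_kernel_le[OF b]) auto
      then have "\<bar>\<zeta> x * (\<rho> y * (2 * (x - y) $ k * rk b j (x - y)))\<bar>
          \<le> ?C * (\<bar>\<zeta> x\<bar> * \<bar>\<rho> y\<bar> * (b * norm (x - y) * exp (- (b * ((x -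
              y) \<bullet> (x - y))) / 2)))"
        by (simp add: abs_mult mult_ac)
      then show "ennreal \<bar>\<zeta> x * (\<rho> y * (2 * (x - y) $ k * rk b j (x - y)))\<bar>
          \<le> ennreal ?C * ennreal (\<bar>\<zeta> x\<bar> * \<bar>\<rho> y\<bar> * (b * norm (x - y) *
              exp (- (b * ((x - y) \<bullet> (x - y))) / 2)))"
        by (subst ennreal_mult'[symmetric]) (auto intro!: ennreal_leI)
    qed
    also have "\<dots> = ennreal ?C * (\<integral>\<^sup>+y. ennreal (\<bar>\<zeta> x\<bar> * \<bar>\<rho>
        y\<bar> *
      (b * norm (x - y) * exp (- (b * ((x - y) \<bullet> (x - y))) / 2))) \<partial>lborel)"
      by (rule nn_integral_cmult) measurable
    finally show "ennreal \<bar>\<zeta> x * (\<integral>y. \<rho> y * (2 * (x - y) $ k * rk b j (x - y))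
        \<partial>lborel)\<bar>
      \<le> ennreal ?C * (\<integral>\<^sup>+y. ennreal (\<bar>\<zeta> x\<bar> * \<bar>\<rho> y\<bar> *
      (b * norm (x - y) * exp (- (b * ((x - y) \<bullet> (x - y))) / 2))) \<partial>lborel)" .
  qed
  also have "\<dots> = ennreal ?C * gauss_L1 b \<zeta> \<rho>"
    unfolding gauss_L1_def by (rule nn_integral_cmult) measurable
  finally show ?thesis .
qed

lemma sum_multi_append_le:
  fixes A :: "'n::{finite,linorder} kin \<Rightarrow> ennreal"
  assumes "a \<in> vfs"
  shows "(\<Sum>\<beta>\<in>multi_indices m. A (Zs \<beta> (Z a g))) \<le> (\<Sum>\<beta>\<in>multi_indices
      (Suc m). A (Zs \<beta> g))"
proof -
  have "(\<Sum>\<beta>\<in>multi_indices m. A (Zs \<beta> (Z a g))) = (\<Sum>\<beta>\<in>(\<lambda>\<beta>.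
      \<beta> @ [a]) ` multi_indices m. A (Zs \<beta> g))"
    by (subst sum.reindex) (auto simp: inj_on_def Zs_def)
  also have "\<dots> \<le> (\<Sum>\<beta>\<in>multi_indices (Suc m). A (Zs \<beta> g))"
    using assms by (intro sum_mono2 finite_multi_indices) (auto simp: multi_indices_def)
  finally show ?thesis .
qed

lemma gpot_est:
  "\<exists>C\<ge>0. \<forall>(\<gamma> :: 'n::{finite,linorder} vf list) g t b R \<zeta> k. length
      \<gamma> = m \<longrightarrow> set \<gamma> \<subseteq> vfs \<longrightarrow> adm m g t
          \<longrightarrow> 0 \<le> b \<longrightarrow>
     CE (Suc m) \<zeta> \<longrightarrow> (\<forall>x. R < norm x \<longrightarrow> \<zeta> x = 0)
         \<longrightarrow>
     ennreal \<bar>\<integral>x. fold (adj t) (Trans k # \<gamma>) \<zeta> x * gpot b j (rho g t) x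
         \<partial>lborel\<bar>
       \<le> ennreal C * (\<Sum>\<beta>\<in>multi_indices m. gauss_L1 b \<zeta> (rho (Zs \<beta> g) t))"
proof (induction m arbitrary: j)
  case 0
  have m0: "multi_indices 0 = {[] :: 'n vf list}" by (auto simp: multi_indices_def)
  define D where "D = 2 * (real j * (2 ^ (j - 1) * fact (j - 1)) + 2 ^ j * fact j)"
  have D0: "0 \<le> D" by (simp add: D_def)
  have base: "ennreal \<bar>\<integral>x. adj t (Trans k) \<zeta> x * gpot b j \<rho> x
      \<partial>lborel\<bar> \<le> ennreal D * gauss_L1 b \<zeta> \<rho>"
    if "integrable lborel \<rho>" "0 \<le> b" "CE (Suc 0) \<zeta>" "\<forall>x. R < norm x
        \<longrightarrow> \<zeta> x = 0"
    for \<rho> \<zeta> :: "(real, 'n) vec \<Rightarrow> real" and R t b k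
    unfolding D_def by (rule gpot_base_est[where R = R]) (use that in \<open>simp_all del: CE.simps\<close>)
  show ?case
    using D0 by (intro exI[of _ D]) (auto simp: m0 Zs_def adm_def simp del: CE.simps intro: base)
next
  case (Suc m)
  obtain C1 where C1: "0 \<le> C1" "\<And>(\<gamma> :: 'n vf list) g t b R \<zeta> k. length \<gamma> = m
      \<Longrightarrow> set \<gamma> \<subseteq> vfs \<Longrightarrow> adm m g t \<Longrightarrow> 0 \<le>
          b \<Longrightarrow>
     CE (Suc m) \<zeta> \<Longrightarrow> (\<And>x. R < norm x \<Longrightarrow> \<zeta> x = 0)
         \<Longrightarrow>
     ennreal \<bar>\<integral>x. fold (adj t) (Trans k # \<gamma>) \<zeta> x * gpot b j (rho g t) x
         \<partial>lborel\<bar>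
       \<le> ennreal C1 * (\<Sum>\<beta>\<in>multi_indices m. gauss_L1 b \<zeta> (rho (Zs \<beta> g) t))"
    using Suc[of j] by blast
  obtain C2 where C2: "0 \<le> C2" "\<And>(\<gamma> :: 'n vf list) g t b R \<zeta> k. length \<gamma> = m
      \<Longrightarrow> set \<gamma> \<subseteq> vfs \<Longrightarrow> adm m g t \<Longrightarrow> 0 \<le>
          b \<Longrightarrow>
     CE (Suc m) \<zeta> \<Longrightarrow> (\<And>x. R < norm x \<Longrightarrow> \<zeta> x = 0)
         \<Longrightarrow>
     ennreal \<bar>\<integral>x. fold (adj t) (Trans k # \<gamma>) \<zeta> x * gpot b (Suc j) (rho g t) x
         \<partial>lborel\<bar>
       \<le> ennreal C2 * (\<Sum>\<beta>\<in>multi_indices m. gauss_L1 b \<zeta> (rho (Zs \<beta> g) t))"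
    using Suc[of "Suc j"] by blast
  define c where "c = 2 * real CARD('n) + 2 * real j"
  show ?case
  proof (intro exI[of _ "C1 + c * C1 + 2 * C2"] conjI allI impI)
    show "0 \<le> C1 + c * C1 + 2 * C2" using C1(1) C2(1) by (simp add: c_def)
    fix \<gamma>' :: "'n vf list" and g :: "'n kin" and t b R :: real and k :: 'n and \<zeta> :: "(real,
        'n) vec \<Rightarrow> real"
    assume len: "length \<gamma>' = Suc m" and sub: "set \<gamma>' \<subseteq> vfs" and g: "adm (Suc m) g
        t" and b: "0 \<le> b"
      and \<zeta>: "CE (Suc (Suc m)) \<zeta>" and supp: "\<forall>x. R < norm x \<longrightarrow> \<zeta> x
          = 0"
    obtain \<gamma> a where \<gamma>': "\<gamma>' = \<gamma> @ [a]" using len by (metis length_Suc_conv_rev)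
    then have \<gamma>: "length \<gamma> = m" "set \<gamma> \<subseteq> vfs" and a: "a \<in> vfs" using len
        sub by auto
    define \<xi> where "\<xi> = fold (adj t) (Trans k # \<gamma>) \<zeta>"
    have \<xi>: "CE 1 \<xi>" unfolding \<xi>_def by (rule CE_fold_adj) (use \<zeta> \<gamma> in \<open>simp
        del: CE.simps\<close>)
    have s\<xi>: "\<xi> x = 0" if "R < norm x" for x unfolding \<xi>_def
      by (rule fold_adj_eq_0_outside[OF _ that]) (use supp in auto)
    define S where "S = (\<Sum>\<beta>\<in>multi_indices (Suc m). gauss_L1 b \<zeta> (rho (Zs \<beta> g)
        t))"
    define I where "I i h = (\<integral>x. \<xi> x * gpot b i (rho h t) x \<partial>lborel)" for i h
    have e: "fold (adj t) (Trans k # \<gamma>') \<zeta> = adj t a \<xi>" by (simp add: \<gamma>' \<xi>_def)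
    have \<zeta>': "CE (Suc m) \<zeta>" by (rule CE_SucD[OF \<zeta>])
    have S': "(\<Sum>\<beta>\<in>multi_indices m. gauss_L1 b \<zeta> (rho (Zs \<beta> g) t)) \<le> S"
      unfolding S_def by (intro sum_mono2 finite_multi_indices) (auto simp: multi_indices_def)
    have I1: "ennreal \<bar>I j (Z a g)\<bar> \<le> ennreal C1 * S"
    proof -
      have "ennreal \<bar>I j (Z a g)\<bar> \<le> ennreal C1 * (\<Sum>\<beta>\<in>multi_indices m. gauss_L1
          b \<zeta> (rho (Zs \<beta> (Z a g)) t))"
        unfolding I_def \<xi>_def using supp by (intro C1(2)[OF \<gamma> adm_Z[OF g a] b \<zeta>']) auto
      also have "\<dots> \<le> ennreal C1 * S" unfolding S_def
        by (intro mult_left_mono sum_multi_append_le[OF a, where A = "\<lambda>h. gauss_L1 b \<zeta> (rho h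
            t)"]) auto
      finally show ?thesis .
    qed
    have I2: "ennreal \<bar>I j g\<bar> \<le> ennreal C1 * S"
      unfolding I_def \<xi>_def using supp
      by (intro order_trans[OF C1(2)[OF \<gamma> adm_Suc[OF g] b \<zeta>'] mult_left_mono[OF S']]) auto
    have I3: "ennreal \<bar>I (Suc j) g\<bar> \<le> ennreal C2 * S"
      unfolding I_def \<xi>_def using supp
      by (intro order_trans[OF C2(2)[OF \<gamma> adm_Suc[OF g] b \<zeta>'] mult_left_mono[OF S']]) auto
    have c0: "0 \<le> c" by (simp add: c_def)
    have "(\<integral>x. fold (adj t) (Trans k # \<gamma>') \<zeta> x * gpot b j (rho g t) x
        \<partial>lborel)
        = I j (Z a g) + (if a = Scal then c * I j g - 2 * I (Suc j) g else 0)"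
      unfolding e I_def c_def by (rule integral_adj_gpot_rho[OF a b g \<xi> s\<xi>])
    also have "\<bar>\<dots>\<bar> \<le> \<bar>I j (Z a g)\<bar> + (c * \<bar>I j g\<bar> + 2 * \<bar>I
        (Suc j) g\<bar>)"
      using c0 abs_triangle_ineq4[of "c * I j g" "2 * I (Suc j) g"]
      by (intro order_trans[OF abs_triangle_ineq] add_mono) (auto simp: abs_mult)
    finally have "ennreal \<bar>\<integral>x. fold (adj t) (Trans k # \<gamma>') \<zeta> x * gpot b j (rho
        g t) x \<partial>lborel\<bar>
        \<le> ennreal (\<bar>I j (Z a g)\<bar> + (c * \<bar>I j g\<bar> + 2 * \<bar>I (Suc j) g\<bar>))" by
            (rule ennreal_leI)
    also have "\<dots> = ennreal \<bar>I j (Z a g)\<bar> + (ennreal c * ennreal \<bar>I j g\<bar> + ennreal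
        2 * ennreal \<bar>I (Suc j) g\<bar>)"
      using c0 by (simp add: ennreal_mult ennreal_plus)
    also have "\<dots> \<le> ennreal C1 * S + (ennreal c * (ennreal C1 * S) + ennreal 2 * (ennreal C2 * S))"
      by (intro add_mono mult_left_mono I1 I2 I3) auto
    also have "\<dots> = (ennreal C1 + (ennreal c * ennreal C1 + ennreal 2 * ennreal C2)) * S"
      by (simp add: distrib_right mult.assoc)
    also have "ennreal C1 + (ennreal c * ennreal C1 + ennreal 2 * ennreal C2) = ennreal (C1 + c * C1 + 2 *
        C2)"
      using c0 C1(1) C2(1) by (simp add: ennreal_mult ennreal_plus add.assoc)
    finally show "ennreal \<bar>\<integral>x. fold (adj t) (Trans k # \<gamma>') \<zeta> x * gpot b j (rho
        g t) x \<partial>lborel\<bar>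
       \<le> ennreal (C1 + c * C1 + 2 * C2) * (\<Sum>\<beta>\<in>multi_indices (Suc m). gauss_L1 b \<zeta>
           (rho (Zs \<beta> g) t))"
      by (simp only: S_def)
  qed
qed

lemma integral_ZXs_mult:
  assumes "set l \<subseteq> vfs" "CE (length l) (h t)" "CE (length l) \<zeta>" "\<And>x. R < norm x
      \<Longrightarrow> \<zeta> x = 0"
  shows "(\<integral>x. ZXs l h t x * \<zeta> x \<partial>lborel) = (\<integral>x. h t x * fold (adj t) l
      \<zeta> x \<partial>lborel)
    \<and> (\<forall>m. CE (length l + m) (h t) \<longrightarrow> CE m (ZXs l h t))"
  using assms
proof (induction l arbitrary: \<zeta>)
  case Nil
  then show ?case by (simp add: ZXs_def)
next
  case (Cons a l)
  have ZX: "ZXs (a # l) h t = Vf 1 t a (ZXs l h t)" by (simp add: ZXs_def ZX_eq_Vf)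
  have h: "CE (length l + 1) (h t)" "CE (length l) (h t)"
    using Cons.prems(2) CE_le[of "length (a # l)" "h t" "length l"] by (simp_all del: CE.simps)
  have \<zeta>: "CE (Suc (length l)) \<zeta>" "CE 1 \<zeta>" using Cons.prems(3) CE_le[of "Suc (length l)"
      \<zeta> 1] by (simp_all del: CE.simps)
  have sub: "set l \<subseteq> vfs" "a \<in> vfs" using Cons.prems(1) by auto
  note IH = Cons.IH[OF sub(1) h(2) CE_adj[OF \<zeta>(1)] adj_eq_0_outside[of R \<zeta>, OF Cons.prems(4)]]
  have "CE 1 (ZXs l h t)" using IH[of t a] h(1) by blast
  then have "(\<integral>x. ZXs (a # l) h t x * \<zeta> x \<partial>lborel) = (\<integral>x. ZXs l h t x *
      adj t a \<zeta> x \<partial>lborel)"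
    unfolding ZX by (rule integral_Vf_mult[OF sub(2) _ \<zeta>(2) Cons.prems(4)])
  moreover have "CE m (ZXs (a # l) h t)" if "CE (length (a # l) + m) (h t)" for m
    unfolding ZX using that IH[of t a] by (intro CE_Vf) (simp del: CE.simps)
  ultimately show ?case using IH[of t a] by simp
qed

section \<open>Green's functions as superpositions of Gaussians\<close>

lemma nn_integral_exp_abs_finite:
  assumes a: "0 < (a::real)"
  shows "(\<integral>\<^sup>+\<mu>. ennreal (exp (- (a * \<bar>\<mu>\<bar>))) \<partial>lborel) <
      \<infinity>"
proof -
  have half: "(\<integral>\<^sup>+x. ennreal (exp (- (a * x))) * indicator {0..} x \<partial>lborel) =
      ennreal (0 - (- (1 / a) * exp (- (a * 0))))"
  proof (rule nn_integral_FTC_atLeast)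
    show "DERIV (\<lambda>x. - (1 / a) * exp (- (a * x))) x :> exp (- (a * x))" for x
      using a by (auto intro!: derivative_eq_intros)
    show "((\<lambda>x. - (1 / a) * exp (- (a * x))) \<longlongrightarrow> 0) at_top"
    proof -
      have "filterlim (\<lambda>x. a * x) at_top at_top"
        by (rule filterlim_tendsto_pos_mult_at_top[OF tendsto_const a filterlim_ident])
      then have "filterlim (\<lambda>x. - (a * x)) at_bot at_top" by (simp add: filterlim_uminus_at_bot)
      then have "((\<lambda>x. exp (- (a * x))) \<longlongrightarrow> 0) at_top" by (rule
          filterlim_compose[OF exp_at_bot])
      then show ?thesis using tendsto_mult_right_zero by fastforce
    qed
  qed auto
  have "(\<integral>\<^sup>+\<mu>. ennreal (exp (- (a * \<bar>\<mu>\<bar>))) \<partial>lborel)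
      \<le> (\<integral>\<^sup>+x. ennreal (exp (- (a * x))) * indicator {0..} x + ennreal (exp (- (a * (-
          x)))) * indicator {0..} (- x) \<partial>lborel)"
    by (intro nn_integral_mono) (auto simp: indicator_def abs_if)
  also have "\<dots> = (\<integral>\<^sup>+x. ennreal (exp (- (a * x))) * indicator {0..} x
      \<partial>lborel)
      + (\<integral>\<^sup>+x. ennreal (exp (- (a * (- x)))) * indicator {0..} (- x) \<partial>lborel)"
    by (rule nn_integral_add) auto
  also have "(\<integral>\<^sup>+x. ennreal (exp (- (a * (- x)))) * indicator {0..} (- x) \<partial>lborel)
      = (\<integral>\<^sup>+x. ennreal (exp (- (a * x))) * indicator {0..} x \<partial>lborel)"
    by (subst (2) nn_integral_real_affine[where c = "-1" and t = 0]) auto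
  finally show ?thesis unfolding half by (rule le_less_trans) simp
qed

lemma nn_integral_finite_by_exp_abs:
  assumes "0 < (a::real)" "\<And>\<mu>. h \<mu> \<le> K * exp (- (a * \<bar>\<mu>\<bar>))"
  shows "(\<integral>\<^sup>+\<mu>. ennreal (h \<mu>) \<partial>lborel) < \<infinity>"
proof -
  have "(\<integral>\<^sup>+\<mu>. ennreal (h \<mu>) \<partial>lborel) \<le> (\<integral>\<^sup>+\<mu>.
      ennreal \<bar>K\<bar> * ennreal (exp (- (a * \<bar>\<mu>\<bar>))) \<partial>lborel)"
  proof (rule nn_integral_mono)
    fix \<mu>
    have "h \<mu> \<le> \<bar>K\<bar> * exp (- (a * \<bar>\<mu>\<bar>))"
      by (rule order_trans[OF assms(2) mult_right_mono[OF abs_ge_self]]) simp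
    then show "ennreal (h \<mu>) \<le> ennreal \<bar>K\<bar> * ennreal (exp (- (a * \<bar>\<mu>\<bar>)))"
      by (simp add: ennreal_mult'[symmetric] ennreal_leI)
  qed
  also have "\<dots> = ennreal \<bar>K\<bar> * (\<integral>\<^sup>+\<mu>. ennreal (exp (- (a *
      \<bar>\<mu>\<bar>))) \<partial>lborel)"
    by (rule nn_integral_cmult) auto
  also have "\<dots> < \<infinity>" using nn_integral_exp_abs_finite[OF assms(1)] by (simp add:
      ennreal_mult_less_top)
  finally show ?thesis .
qed

lemma gauss_1d_finite: "(\<integral>\<^sup>+s. ennreal (exp (- s\<^sup>2)) \<partial>lborel) < \<infinity>"
proof (rule nn_integral_finite_by_exp_abs[of 1 _ "exp 1"])
  fix s :: real
  have "0 \<le> (\<bar>s\<bar> - 1)\<^sup>2" by simp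
  then have "2 * \<bar>s\<bar> \<le> 1 + s\<^sup>2" by (simp add: power2_diff)
  then have "- s\<^sup>2 \<le> 1 - \<bar>s\<bar>" using abs_ge_zero[of s] by linarith
  then show "exp (- s\<^sup>2) \<le> exp 1 * exp (- (1 * \<bar>s\<bar>))" by (simp flip: exp_add)
qed simp

lemma gauss_integral_le:
  "\<exists>I\<ge>0. \<forall>\<mu> (y :: real^'n). (\<integral>\<^sup>+x. ennreal (ek (exp \<mu>) 0 (x -
      y)) \<partial>lborel) \<le> ennreal (I * exp (- (real CARD('n) * \<mu> / 2)))"
proof -
  define J where "J = enn2real (\<integral>\<^sup>+s. ennreal (exp (- s\<^sup>2)) \<partial>lborel)"
  have J: "(\<integral>\<^sup>+s. ennreal (exp (- s\<^sup>2)) \<partial>lborel) = ennreal J" "0 \<le> J"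
    using gauss_1d_finite by (simp_all add: J_def)
  have "(\<integral>\<^sup>+x. ennreal (ek (exp \<mu>) 0 (x - y)) \<partial>lborel) = ennreal (J ^ CARD('n)
      * exp (- (real CARD('n) * \<mu> / 2)))"
    for \<mu> and y :: "real^'n"
  proof -
    have m: "ek (exp \<mu>) 0 \<in> borel_measurable (borel :: (real^'n) measure)"
      by (intro borel_measurable_continuous_onI continuous_ek)
    have 1: "(\<integral>\<^sup>+s. ennreal (exp (- (exp \<mu> * s\<^sup>2))) \<partial>lborel) = ennreal
        (exp (- (\<mu> / 2)) * J)"
    proof -
      have e: "exp \<mu> * (exp (- (\<mu> / 2)) * s)\<^sup>2 = s\<^sup>2" for s
        using exp_double[of "\<mu> / 2"] by (simp add: power_mult_distrib exp_minus power_inverse)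
      have "(\<integral>\<^sup>+s. ennreal (exp (- (exp \<mu> * s\<^sup>2))) \<partial>lborel)
          = \<bar>exp (- (\<mu> / 2))\<bar> * (\<integral>\<^sup>+s. ennreal (exp (- (exp \<mu> * (0 + exp
              (- (\<mu> / 2)) * s)\<^sup>2))) \<partial>lborel)"
        by (rule nn_integral_real_affine) auto
      also have "\<dots> = ennreal (exp (- (\<mu> / 2))) * ennreal J" unfolding add_0 e J(1) by simp
      finally show ?thesis using J(2) by (simp add: ennreal_mult)
    qed
    have "(\<integral>\<^sup>+x. ennreal (ek (exp \<mu>) 0 (x - y)) \<partial>lborel) =
        (\<integral>\<^sup>+x. ennreal (ek (exp \<mu>) 0 (x :: real^'n)) \<partial>lborel)"
      using nn_integral_lborel_translate[of "\<lambda>x. ennreal (ek (exp \<mu>) 0 x)" "- y"] m by simp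
    also have "\<dots> = (\<integral>\<^sup>+x. (\<Prod>b\<in>Basis. ennreal (exp (- (exp \<mu> * ((x ::
        real^'n) \<bullet> b)\<^sup>2)))) \<partial>lborel)"
    proof (rule nn_integral_cong)
      fix x :: "real^'n"
      have "ek (exp \<mu>) 0 x = (\<Prod>b\<in>Basis. exp (- (exp \<mu> * (x \<bullet> b)\<^sup>2)))"
        unfolding ek_def exp_sum[OF finite_Basis, symmetric]
        by (subst euclidean_inner) (simp add: sum_negf sum_distrib_left power2_eq_square)
      then show "ennreal (ek (exp \<mu>) 0 x) = (\<Prod>b\<in>Basis. ennreal (exp (- (exp \<mu> * (x
          \<bullet> b)\<^sup>2))))"
        by (simp add: prod_ennreal)
    qed
    also have "\<dots> = (\<Prod>b\<in>(Basis :: (real^'n) set). \<integral>\<^sup>+s. ennreal (exp (- (exp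
        \<mu> * s\<^sup>2))) \<partial>lborel)"
      by (rule nn_integral_lborel_prod) auto
    also have "\<dots> = ennreal ((exp (- (\<mu> / 2)) * J) ^ CARD('n))"
      unfolding 1 using J(2) by (simp add: ennreal_power)
    also have "(exp (- (\<mu> / 2)) * J) ^ CARD('n) = J ^ CARD('n) * exp (- (real CARD('n) * \<mu> / 2))"
      by (simp add: power_mult_distrib exp_of_nat_mult[symmetric] mult.commute)
    finally show ?thesis .
  qed
  then show ?thesis using J(2) by (intro exI[of _ "J ^ CARD('n)"]) simp
qed

lemma superposition_integral:
  fixes \<xi> \<rho> \<phi> G :: "(real, 'n::{finite,linorder}) vec \<Rightarrow> real" and \<nu> :: "real
      \<Rightarrow> real"
  assumes \<nu>m [measurable]: "\<nu> \<in> borel_measurable borel" and \<nu>0: "\<And>\<mu>. 0 \<le> \<nu>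
      \<mu>"
    and G: "\<And>z. z \<noteq> 0 \<Longrightarrow> (\<integral>\<^sup>+\<mu>. ennreal (\<nu> \<mu> * ek
        (exp \<mu>) 0 z) \<partial>lborel) = ennreal (- G z)"
      "\<And>z. G z \<le> 0"
    and N: "(\<integral>\<^sup>+\<mu>. ennreal (\<nu> \<mu> * min 1 (exp (- (real CARD('n) * \<mu> / 2))))
        \<partial>lborel) < \<infinity>"
    and \<rho>: "integrable lborel \<rho>" and \<xi>: "continuous_on UNIV \<xi>" and supp: "\<And>x. R <
        norm x \<Longrightarrow> \<xi> x = 0"
    and Gm [measurable]: "G \<in> borel_measurable borel" and \<phi>m [measurable]: "\<phi> \<in>
        borel_measurable borel"
    and rep: "\<And>x. (\<integral>y. G (x - y) * \<rho> y \<partial>lborel) = \<phi> x"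
  shows "(\<integral>x. \<phi> x * \<xi> x \<partial>lborel) = - (\<integral>\<mu>. \<nu> \<mu> *
      (\<integral>x. \<xi> x * gpot (exp \<mu>) 0 \<rho> x \<partial>lborel) \<partial>lborel)"
proof -
  define \<Phi> :: "(real, 'n) vec \<times> ((real, 'n) vec \<times> real) \<Rightarrow> real" where
    "\<Phi> z = \<xi> (fst z) * \<rho> (fst (snd z)) * (\<nu> (snd (snd z)) *
       exp (- (exp (snd (snd z)) * ((fst z - fst (snd z)) \<bullet> (fst z - fst (snd z))))))" for z
  have ek: "ek (exp \<mu>) 0 z = exp (- (exp \<mu> * (z \<bullet> z)))" for \<mu> and z :: "(real, 'n) vec"
      by (simp add: ek_def)
  have \<Phi>: "\<Phi> (x, (y, \<mu>)) = \<xi> x * \<rho> y * (\<nu> \<mu> * ek (exp \<mu>) 0 (x - y))" for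
      x y \<mu> by (simp add: \<Phi>_def ek)
  have [measurable]: "\<rho> \<in> borel_measurable borel" "\<xi> \<in> borel_measurable borel"
    using borel_measurable_integrable[OF \<rho>] borel_measurable_continuous_onI[OF \<xi>] by simp_all
  have [measurable]: "\<Phi> \<in> borel_measurable borel" unfolding \<Phi>_def[abs_def] by measurable
  have [measurable]: "ek b j \<in> borel_measurable (borel :: (real, 'n) vec measure)" for b j
    by (intro borel_measurable_continuous_onI continuous_ek)
  have i\<xi>: "integrable lborel \<xi>" by (rule integrable_compact_support[OF \<xi> supp])
  define S where "S = cball (0 :: (real, 'n) vec) \<bar>R\<bar>"
  have "compact (\<xi> ` S)"
    unfolding S_def using \<xi> continuous_on_subset by (intro compact_continuous_image) auto
  then obtain M where M: "\<And>x. x \<in> S \<Longrightarrow> \<bar>\<xi> x\<bar> \<le> M"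
    using compact_imp_bounded[of "\<xi> ` S"] by (auto simp: bounded_iff)
  have M0: "0 \<le> M" using M[of 0] by (auto simp: S_def)
  have M: "\<bar>\<xi> x\<bar> \<le> M" for x using M[of x] supp[of x] M0 by (cases "R < norm x") (auto
      simp: S_def)
  obtain I where I: "0 \<le> I" "\<And>\<mu> (y :: (real, 'n) vec). (\<integral>\<^sup>+x. ennreal (ek (exp
      \<mu>) 0 (x - y)) \<partial>lborel) \<le> ennreal (I * exp (- (real CARD('n) * \<mu> / 2)))"
    using gauss_integral_le[where 'n = 'n] by blast
  define L where "L = (\<integral>x. \<bar>\<xi> x\<bar> \<partial>lborel)"
  have L: "(\<integral>\<^sup>+x. ennreal \<bar>\<xi> x\<bar> \<partial>lborel) = ennreal L" "0 \<le> L"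
    unfolding L_def using i\<xi> by (simp_all add: nn_integral_eq_integral)
  define K where "K = L + M * I"
  have K0: "0 \<le> K" using L(2) M0 I(1) by (simp add: K_def)
  have xi_ek: "(\<integral>\<^sup>+x. ennreal (\<bar>\<xi> x\<bar> * ek (exp \<mu>) 0 (x - y))
      \<partial>lborel) \<le> ennreal (K * min 1 (exp (- (real CARD('n) * \<mu> / 2))))" for \<mu> y
  proof -
    have "(\<integral>\<^sup>+x. ennreal (\<bar>\<xi> x\<bar> * ek (exp \<mu>) 0 (x - y)) \<partial>lborel)
        \<le> (\<integral>\<^sup>+x. ennreal \<bar>\<xi> x\<bar> \<partial>lborel)"
      by (intro nn_integral_mono ennreal_leI) (auto simp: ek intro!: mult_left_le)
    then have 1: "(\<integral>\<^sup>+x. ennreal (\<bar>\<xi> x\<bar> * ek (exp \<mu>) 0 (x - y))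
        \<partial>lborel) \<le> ennreal L" by (simp add: L)
    have "(\<integral>\<^sup>+x. ennreal (\<bar>\<xi> x\<bar> * ek (exp \<mu>) 0 (x - y)) \<partial>lborel)
        \<le> (\<integral>\<^sup>+x. ennreal M * ennreal (ek (exp \<mu>) 0 (x - y)) \<partial>lborel)"
      using M M0 by (intro nn_integral_mono) (auto simp: ek ennreal_mult[symmetric] intro!: ennreal_leI
          mult_right_mono)
    also have "\<dots> = ennreal M * (\<integral>\<^sup>+x. ennreal (ek (exp \<mu>) 0 (x - y))
        \<partial>lborel)" by (rule nn_integral_cmult) measurable
    also have "\<dots> \<le> ennreal M * ennreal (I * exp (- (real CARD('n) * \<mu> / 2)))" by (intro
        mult_left_mono I) auto
    also have "\<dots> = ennreal (M * I * exp (- (real CARD('n) * \<mu> / 2)))" using M0 I by (simp add: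
        ennreal_mult[symmetric] mult.assoc)
    finally have 2: "(\<integral>\<^sup>+x. ennreal (\<bar>\<xi> x\<bar> * ek (exp \<mu>) 0 (x - y))
        \<partial>lborel) \<le> ennreal (M * I * exp (- (real CARD('n) * \<mu> / 2)))" .
    have "L \<le> K" "M * I * exp (- (real CARD('n) * \<mu> / 2)) \<le> K * exp (- (real CARD('n) * \<mu> /
        2))"
      unfolding K_def using L M0 I by (auto intro!: mult_right_mono)
    with 1 2 show ?thesis
      by (cases "1 \<le> exp (- (real CARD('n) * \<mu> / 2))")
        (auto simp: min_def intro: order_trans[OF _ ennreal_leI])
  qed
  define NN where "NN = (\<integral>\<^sup>+\<mu>. ennreal (\<nu> \<mu> * min 1 (exp (- (real CARD('n) *
      \<mu> / 2)))) \<partial>lborel)"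
  have i\<Phi>: "integrable (lborel \<Otimes>\<^sub>M lborel) \<Phi>"
  proof (rule integrableI_bounded)
    show "\<Phi> \<in> borel_measurable (lborel \<Otimes>\<^sub>M lborel)" by (simp add: lborel_prod)
    have "(\<integral>\<^sup>+z. ennreal (norm (\<Phi> z)) \<partial>(lborel \<Otimes>\<^sub>M lborel)) =
        (\<integral>\<^sup>+p. \<integral>\<^sup>+x. ennreal (norm (\<Phi> (x, p))) \<partial>lborel
            \<partial>lborel)"
      by (rule lborel_pair.nn_integral_snd[symmetric]) (simp add: lborel_prod)
    also have "\<dots> \<le> (\<integral>\<^sup>+p. ennreal \<bar>\<rho> (fst p)\<bar> * (ennreal K *
        ennreal (\<nu> (snd p) * min 1 (exp (- (real CARD('n) * snd p / 2))))) \<partial>lborel)"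
    proof (rule nn_integral_mono)
      fix p :: "(real, 'n) vec \<times> real"
      obtain y \<mu> where p: "p = (y, \<mu>)" by (cases p)
      have "(\<integral>\<^sup>+x. ennreal (norm (\<Phi> (x, p))) \<partial>lborel)
          = (\<integral>\<^sup>+x. ennreal (\<bar>\<rho> y\<bar> * \<nu> \<mu>) * ennreal (\<bar>\<xi>
              x\<bar> * ek (exp \<mu>) 0 (x - y)) \<partial>lborel)"
        unfolding p \<Phi> using \<nu>0 by (intro nn_integral_cong) (simp add: abs_mult ek
            ennreal_mult[symmetric] mult_ac)
      also have "\<dots> = ennreal (\<bar>\<rho> y\<bar> * \<nu> \<mu>) * (\<integral>\<^sup>+x. ennreal
          (\<bar>\<xi> x\<bar> * ek (exp \<mu>) 0 (x - y)) \<partial>lborel)"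
        by (rule nn_integral_cmult) measurable
      also have "\<dots> \<le> ennreal (\<bar>\<rho> y\<bar> * \<nu> \<mu>) * ennreal (K * min 1 (exp (-
          (real CARD('n) * \<mu> / 2))))"
        by (intro mult_left_mono xi_ek) auto
      also have "\<dots> = ennreal \<bar>\<rho> y\<bar> * (ennreal K * ennreal (\<nu> \<mu> * min 1 (exp (-
          (real CARD('n) * \<mu> / 2)))))"
        using \<nu>0[of \<mu>] K0 by (simp add: ennreal_mult[symmetric] mult_ac)
      finally show "(\<integral>\<^sup>+x. ennreal (norm (\<Phi> (x, p))) \<partial>lborel)
          \<le> ennreal \<bar>\<rho> (fst p)\<bar> * (ennreal K * ennreal (\<nu> (snd p) * min 1 (exp (-
              (real CARD('n) * snd p / 2)))))"
        by (simp add: p)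
    qed
    also have "\<dots> = (\<integral>\<^sup>+y. \<integral>\<^sup>+\<mu>. ennreal \<bar>\<rho> y\<bar> *
        (ennreal K * ennreal (\<nu> \<mu> * min 1 (exp (- (real CARD('n) * \<mu> / 2))))) \<partial>lborel
            \<partial>lborel)"
      unfolding lborel_prod[symmetric] by (subst lborel.nn_integral_fst[symmetric]) (simp_all add:
          lborel_prod)
    also have "\<dots> = (\<integral>\<^sup>+y. ennreal \<bar>\<rho> y\<bar> * (ennreal K * NN)
        \<partial>lborel)"
      unfolding NN_def by (subst nn_integral_cmult[symmetric], measurable, subst
          nn_integral_cmult[symmetric], measurable)
    also have "\<dots> = (\<integral>\<^sup>+y. ennreal \<bar>\<rho> y\<bar> \<partial>lborel) * (ennreal K
        * NN)"
      by (rule nn_integral_multc) measurable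
    also have "\<dots> < \<infinity>"
      using N nn_integral_eq_integral[OF integrable_abs[OF \<rho>]] unfolding NN_def by (simp add:
          ennreal_mult_less_top top.not_eq_extremum)
    finally show "(\<integral>\<^sup>+z. ennreal (norm (\<Phi> z)) \<partial>(lborel \<Otimes>\<^sub>M
        lborel)) < \<infinity>" .
  qed
  have left: "(\<integral>x. \<integral>p. \<Phi> (x, p) \<partial>lborel \<partial>lborel) =
      (\<integral>x. - (\<phi> x * \<xi> x) \<partial>lborel)"
  proof (rule integral_cong_AE)
    show "AE x in lborel. (\<integral>p. \<Phi> (x, p) \<partial>lborel) = - (\<phi> x * \<xi> x)"
      using lborel_pair.AE_integrable_fst'[OF i\<Phi>]
    proof eventually_elim
      case (elim x)
      have "(\<integral>p. \<Phi> (x, p) \<partial>lborel) = (\<integral>y. \<integral>\<mu>. \<Phi> (x,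
          (y, \<mu>)) \<partial>lborel \<partial>lborel)"
        unfolding lborel_prod[symmetric]
        by (rule lborel_pair.integral_fst'[symmetric]) (use elim in \<open>simp add: lborel_prod\<close>)
      also have "\<dots> = (\<integral>y. - \<xi> x * (G (x - y) * \<rho> y) \<partial>lborel)"
      proof (rule integral_cong_AE)
        have "AE y in lborel. y \<noteq> x" by (rule AE_lborel_singleton)
        then show "AE y in lborel. (\<integral>\<mu>. \<Phi> (x, (y, \<mu>)) \<partial>lborel) = - \<xi> x
            * (G (x - y) * \<rho> y)"
        proof eventually_elim
          case (elim y)
          have "(\<integral>\<mu>. \<nu> \<mu> * ek (exp \<mu>) 0 (x - y) \<partial>lborel) = enn2real
              (\<integral>\<^sup>+\<mu>. ennreal (\<nu> \<mu> * ek (exp \<mu>) 0 (x - y)) \<partial>lborel)"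
            using \<nu>0 by (intro integral_eq_nn_integral) (auto simp: ek)
          also have "\<dots> = - G (x - y)" using elim G(1)[of "x - y"] G(2)[of "x - y"] by simp
          finally show ?case unfolding \<Phi> by simp
        qed
        have "(\<lambda>y. \<integral>\<mu>. \<Phi> (x, (y, \<mu>)) \<partial>lborel) \<in>
            borel_measurable borel" by measurable
        then show "(\<lambda>y. \<integral>\<mu>. \<Phi> (x, (y, \<mu>)) \<partial>lborel) \<in>
            borel_measurable lborel" by simp
        show "(\<lambda>y. - \<xi> x * (G (x - y) * \<rho> y)) \<in> borel_measurable lborel" by measurable
      qed
      also have "\<dots> = - (\<phi> x * \<xi> x)" using rep[of x] by (simp add: mult.commute)
      finally show ?case .
    qed
    show "(\<lambda>x. \<integral>p. \<Phi> (x, p) \<partial>lborel) \<in> borel_measurable lborel"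
      using borel_measurable_integrable[OF lborel_pair.integrable_fst'[OF i\<Phi>]] .
    show "(\<lambda>x. - (\<phi> x * \<xi> x)) \<in> borel_measurable lborel" by measurable
  qed
  have i2: "integrable (lborel \<Otimes>\<^sub>M lborel) (\<lambda>(x, p). \<Phi> (x, p))" using i\<Phi> by
      simp
  have H: "integrable (lborel \<Otimes>\<^sub>M lborel) (\<lambda>(y, \<mu>). \<integral>x. \<Phi> (x, (y,
      \<mu>)) \<partial>lborel)"
    using lborel_pair.integrable_snd[OF i2] by (simp add: lborel_prod case_prod_beta')
  have "(\<integral>x. \<integral>p. \<Phi> (x, p) \<partial>lborel \<partial>lborel) = (\<integral>p.
      \<integral>x. \<Phi> (x, p) \<partial>lborel \<partial>lborel)"
    using lborel_pair.Fubini_integral[OF i2] by simp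
  also have "\<dots> = (\<integral>\<mu>. \<integral>y. \<integral>x. \<Phi> (x, (y, \<mu>))
      \<partial>lborel \<partial>lborel \<partial>lborel)"
    using lborel_pair.integral_snd[OF H] by (simp add: lborel_prod case_prod_beta')
  also have "\<dots> = (\<integral>\<mu>. \<nu> \<mu> * (\<integral>x. \<xi> x * gpot (exp \<mu>) 0 \<rho>
      x \<partial>lborel) \<partial>lborel)"
  proof (intro Bochner_Integration.integral_cong refl)
    fix \<mu>
    have "(\<integral>y. \<integral>x. \<Phi> (x, (y, \<mu>)) \<partial>lborel \<partial>lborel) =
        (\<integral>y. \<nu> \<mu> * (\<rho> y * (\<integral>x. \<xi> x * ek (exp \<mu>) 0 (x - y)
            \<partial>lborel)) \<partial>lborel)"
      unfolding \<Phi> integral_mult_right_zero[symmetric]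
      by (intro Bochner_Integration.integral_cong refl) (simp add: mult_ac)
    also have "\<dots> = \<nu> \<mu> * (\<integral>y. \<rho> y * (\<integral>x. \<xi> x * ek (exp \<mu>) 0
        (x - y) \<partial>lborel) \<partial>lborel)" by simp
    also have "(\<integral>y. \<rho> y * (\<integral>x. \<xi> x * ek (exp \<mu>) 0 (x - y)
        \<partial>lborel) \<partial>lborel) = (\<integral>x. \<xi> x * gpot (exp \<mu>) 0 \<rho> x
            \<partial>lborel)"
      unfolding gpot_def
      using integral_swap_bounded[of "\<lambda>z. ek (exp \<mu>) 0 (fst z - snd z)" "fact 0", OF _ ek_bound
          i\<xi> \<rho>] by simp
    finally show "(\<integral>y. \<integral>x. \<Phi> (x, (y, \<mu>)) \<partial>lborel \<partial>lborel) =
        \<nu> \<mu> * (\<integral>x. \<xi> x * gpot (exp \<mu>) 0 \<rho> x \<partial>lborel)" .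
  qed
  finally show ?thesis using left by simp
qed

lemma weak_estimate:
  fixes \<nu> :: "real \<Rightarrow> real" and G :: "(real, 'n::{finite,linorder}) vec \<Rightarrow> real"
      and Cw :: real
  assumes \<nu>m [measurable]: "\<nu> \<in> borel_measurable borel" and \<nu>0: "\<And>\<mu>. 0 \<le> \<nu>
      \<mu>"
    and G: "\<And>z. z \<noteq> 0 \<Longrightarrow> (\<integral>\<^sup>+\<mu>. ennreal (\<nu> \<mu> * ek
        (exp \<mu>) 0 z) \<partial>lborel) = ennreal (- G z)"
      "\<And>z. G z \<le> 0" and Gm: "G \<in> borel_measurable borel"
    and N: "(\<integral>\<^sup>+\<mu>. ennreal (\<nu> \<mu> * min 1 (exp (- (real CARD('n) * \<mu> / 2))))
        \<partial>lborel) < \<infinity>"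
    and W: "\<And>z :: (real, 'n) vec. z \<noteq> 0 \<Longrightarrow>
      (\<integral>\<^sup>+\<mu>. ennreal (\<nu> \<mu> * (exp \<mu> * norm z * exp (- (exp \<mu> * (z
          \<bullet> z)) / 2))) \<partial>lborel) \<le> ennreal (Cw * wt sys z)"
    and Cw: "0 \<le> Cw"
  shows "\<exists>C\<ge>0. \<forall>(\<gamma> :: 'n vf list) (f :: 'n kin) (\<phi> :: 'n fld) t R \<zeta>
      k. length \<gamma> = m \<longrightarrow> set \<gamma> \<subseteq> vfs \<longrightarrow> adm m f t
          \<longrightarrow>
     CE (Suc m) (\<phi> t) \<longrightarrow> CE (Suc m) \<zeta> \<longrightarrow> (\<forall>x. R < norm x
         \<longrightarrow> \<zeta> x = 0) \<longrightarrow>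
     (\<forall>x. (\<integral>y. G (x - y) * rho f t y \<partial>lborel) = \<phi> t x) \<longrightarrow>
     ennreal \<bar>\<integral>x. ZXs (Trans k # \<gamma>) \<phi> t x * \<zeta> x \<partial>lborel\<bar>
       \<le> ennreal C * (\<Sum>\<beta>\<in>multi_indices m. \<integral>\<^sup>+x. \<integral>\<^sup>+y.
           ennreal (\<bar>\<zeta> x\<bar> * \<bar>rho (Zs \<beta> f) t y\<bar> * wt sys (x - y))
               \<partial>lborel \<partial>lborel)"
proof -
  obtain C where C: "0 \<le> C" "\<And>(\<gamma> :: 'n vf list) g t b R \<zeta> k. length \<gamma> = m
      \<Longrightarrow> set \<gamma> \<subseteq> vfs \<Longrightarrow> adm m g t \<Longrightarrow> 0 \<le>
          b \<Longrightarrow>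
     CE (Suc m) \<zeta> \<Longrightarrow> (\<And>x. R < norm x \<Longrightarrow> \<zeta> x = 0)
         \<Longrightarrow>
     ennreal \<bar>\<integral>x. fold (adj t) (Trans k # \<gamma>) \<zeta> x * gpot b 0 (rho g t) x
         \<partial>lborel\<bar>
       \<le> ennreal C * (\<Sum>\<beta>\<in>multi_indices m. gauss_L1 b \<zeta> (rho (Zs \<beta> g) t))"
    using gpot_est[of m 0] by blast
  show ?thesis
  proof (intro exI[of _ "C * Cw"] conjI allI impI)
    show "0 \<le> C * Cw" using C(1) Cw by simp
    fix \<gamma> :: "'n vf list" and f :: "'n kin" and \<phi> :: "'n fld" and t R :: real and \<zeta> ::
        "(real, 'n) vec \<Rightarrow> real" and k :: 'n
    assume \<gamma>: "length \<gamma> = m" "set \<gamma> \<subseteq> vfs" and f: "adm m f t" and \<phi>: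
        "CE (Suc m) (\<phi> t)" and \<zeta>: "CE (Suc m) \<zeta>"
      and supp: "\<forall>x. R < norm x \<longrightarrow> \<zeta> x = 0" and rep: "\<forall>x.
          (\<integral>y. G (x - y) * rho f t y \<partial>lborel) = \<phi> t x"
    define \<xi> where "\<xi> = fold (adj t) (Trans k # \<gamma>) \<zeta>"
    have c\<xi>: "continuous_on UNIV \<xi>" unfolding \<xi>_def
      by (rule CE_continuous[where k = 0], rule CE_fold_adj) (use \<zeta> \<gamma> in \<open>simp del:
          CE.simps\<close>)
    have s\<xi>: "\<xi> x = 0" if "R < norm x" for x unfolding \<xi>_def
      by (rule fold_adj_eq_0_outside[OF _ that]) (use supp in auto)
    have sub: "set (Trans k # \<gamma>) \<subseteq> vfs" using \<gamma> by (auto simp: vfs_def)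
    have \<rho>: "integrable lborel (rho (Zs \<beta> f) t)" if "\<beta> \<in> multi_indices m" for \<beta>
      using f that unfolding adm_def by blast
    have \<rho>0: "integrable lborel (rho f t)" using \<rho>[OF Nil_multi] by (simp add: Zs_def)
    have \<zeta>m [measurable]: "\<zeta> \<in> borel_measurable borel" using CE_continuous[OF \<zeta>] by
        (rule borel_measurable_continuous_onI)
    define A where "A \<rho> = (\<integral>\<^sup>+x. \<integral>\<^sup>+y. ennreal (\<bar>\<zeta> x\<bar>
        * \<bar>\<rho> y\<bar> * wt sys (x - y)) \<partial>lborel \<partial>lborel)" for \<rho> :: "(real,
            'n) vec \<Rightarrow> real"
    have gA: "(\<integral>\<^sup>+\<mu>. ennreal (\<nu> \<mu>) * gauss_L1 (exp \<mu>) \<zeta> \<rho>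
        \<partial>lborel) \<le> ennreal Cw * A \<rho>"
      and gm: "(\<lambda>\<mu>. gauss_L1 (exp \<mu>) \<zeta> \<rho>) \<in> borel_measurable borel"
      if \<rho>i: "integrable lborel \<rho>" for \<rho>
    proof -
      have [measurable]: "\<rho> \<in> borel_measurable borel" using borel_measurable_integrable[OF
          \<rho>i] by simp
      have [measurable]: "(wt sys :: (real, 'n) vec \<Rightarrow> real) \<in> borel_measurable borel" by
          (rule wt_measurable)
      define F where "F \<mu> x y = ennreal (\<bar>\<zeta> x\<bar> * \<bar>\<rho> y\<bar> * (\<nu> \<mu> *
          (exp \<mu> * norm (x - y) * exp (- (exp \<mu> * ((x - y) \<bullet> (x - y))) / 2))))" for \<mu> x
              y
      have [measurable]: "(\<lambda>(\<mu>, x). \<integral>\<^sup>+y. F \<mu> x y \<partial>lborel) \<in>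
          borel_measurable (lborel \<Otimes>\<^sub>M lborel)"
        unfolding F_def by measurable
      have [measurable]: "(\<lambda>(\<mu>, y). F \<mu> x y) \<in> borel_measurable (lborel
          \<Otimes>\<^sub>M lborel)" for x
        unfolding F_def by measurable
      have Fm: "(\<lambda>y. F \<mu> x y) \<in> borel_measurable lborel" "(\<lambda>\<mu>. F \<mu> x y)
          \<in> borel_measurable lborel" for \<mu> x y
        unfolding F_def by measurable
      show "(\<lambda>\<mu>. gauss_L1 (exp \<mu>) \<zeta> \<rho>) \<in> borel_measurable borel" unfolding
          gauss_L1_def by measurable
      have "ennreal (\<nu> \<mu>) * gauss_L1 (exp \<mu>) \<zeta> \<rho> = (\<integral>\<^sup>+x.
          \<integral>\<^sup>+y. F \<mu> x y \<partial>lborel \<partial>lborel)" for \<mu>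
      proof -
        have "ennreal (\<nu> \<mu>) * gauss_L1 (exp \<mu>) \<zeta> \<rho> = (\<integral>\<^sup>+x. ennreal
            (\<nu> \<mu>) * (\<integral>\<^sup>+y. ennreal (\<bar>\<zeta> x\<bar> * \<bar>\<rho> y\<bar> *
      (exp \<mu> * norm (x - y) * exp (- (exp \<mu> * ((x - y) \<bullet> (x - y))) / 2))) \<partial>lborel)
          \<partial>lborel)"
          unfolding gauss_L1_def by (rule nn_integral_cmult[symmetric]) measurable
        also have "\<dots> = (\<integral>\<^sup>+x. \<integral>\<^sup>+y. ennreal (\<nu> \<mu>) * ennreal
            (\<bar>\<zeta> x\<bar> * \<bar>\<rho> y\<bar> *
      (exp \<mu> * norm (x - y) * exp (- (exp \<mu> * ((x - y) \<bullet> (x - y))) / 2))) \<partial>lborel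
          \<partial>lborel)"
          by (intro nn_integral_cong nn_integral_cmult[symmetric]) measurable
        also have "\<dots> = (\<integral>\<^sup>+x. \<integral>\<^sup>+y. F \<mu> x y \<partial>lborel
            \<partial>lborel)"
          unfolding F_def using \<nu>0 by (intro nn_integral_cong) (simp add: ennreal_mult[symmetric]
              mult_ac)
        finally show ?thesis .
      qed
      then have "(\<integral>\<^sup>+\<mu>. ennreal (\<nu> \<mu>) * gauss_L1 (exp \<mu>) \<zeta> \<rho>
          \<partial>lborel) = (\<integral>\<^sup>+\<mu>. \<integral>\<^sup>+x. \<integral>\<^sup>+y. F
              \<mu> x y \<partial>lborel \<partial>lborel \<partial>lborel)" by simp
      also have "\<dots> = (\<integral>\<^sup>+x. \<integral>\<^sup>+\<mu>. \<integral>\<^sup>+y. F \<mu> x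
          y \<partial>lborel \<partial>lborel \<partial>lborel)"
        by (rule lborel_pair.Fubini'[symmetric]) measurable
      also have "\<dots> = (\<integral>\<^sup>+x. \<integral>\<^sup>+y. \<integral>\<^sup>+\<mu>. F \<mu> x
          y \<partial>lborel \<partial>lborel \<partial>lborel)"
        by (intro nn_integral_cong lborel_pair.Fubini'[symmetric]) measurable
      also have "\<dots> \<le> (\<integral>\<^sup>+x. \<integral>\<^sup>+y. ennreal Cw * ennreal
          (\<bar>\<zeta> x\<bar> * \<bar>\<rho> y\<bar> * wt sys (x - y)) \<partial>lborel
              \<partial>lborel)"
      proof (rule nn_integral_mono, rule nn_integral_mono_AE)
        fix x :: "(real, 'n) vec"
        have "AE y in lborel. y \<noteq> x" by (rule AE_lborel_singleton)
        then show "AE y in lborel. (\<integral>\<^sup>+\<mu>. F \<mu> x y \<partial>lborel) \<le> ennreal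
            Cw * ennreal (\<bar>\<zeta> x\<bar> * \<bar>\<rho> y\<bar> * wt sys (x - y))"
        proof eventually_elim
          case (elim y)
          have "(\<integral>\<^sup>+\<mu>. F \<mu> x y \<partial>lborel) = (\<integral>\<^sup>+\<mu>.
              ennreal (\<bar>\<zeta> x\<bar> * \<bar>\<rho> y\<bar>) *
              ennreal (\<nu> \<mu> * (exp \<mu> * norm (x - y) * exp (- (exp \<mu> * ((x - y) \<bullet> (x
                  - y))) / 2))) \<partial>lborel)"
            unfolding F_def using \<nu>0 by (intro nn_integral_cong) (simp add: ennreal_mult[symmetric])
          also have "\<dots> = ennreal (\<bar>\<zeta> x\<bar> * \<bar>\<rho> y\<bar>) *
              (\<integral>\<^sup>+\<mu>. ennreal (\<nu> \<mu> * (exp \<mu> * norm (x - y) * exp (- (exp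
                  \<mu> * ((x - y) \<bullet> (x - y))) / 2))) \<partial>lborel)"
            by (rule nn_integral_cmult) measurable
          also have "\<dots> \<le> ennreal (\<bar>\<zeta> x\<bar> * \<bar>\<rho> y\<bar>) * ennreal (Cw *
              wt sys (x - y))"
            using elim by (intro mult_left_mono W) auto
          also have "\<dots> = ennreal Cw * ennreal (\<bar>\<zeta> x\<bar> * \<bar>\<rho> y\<bar> * wt sys
              (x - y))"
            using Cw wt_nonneg[of sys "x - y"] by (simp add: ennreal_mult[symmetric] mult_ac)
          finally show ?case .
        qed
      qed
      also have "\<dots> = ennreal Cw * A \<rho>"
        unfolding A_def by (subst nn_integral_cmult[symmetric], measurable, subst
            nn_integral_cmult[symmetric], measurable)
      finally show "(\<integral>\<^sup>+\<mu>. ennreal (\<nu> \<mu>) * gauss_L1 (exp \<mu>) \<zeta> \<rho>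
          \<partial>lborel) \<le> ennreal Cw * A \<rho>" .
    qed
    have "(\<integral>x. ZXs (Trans k # \<gamma>) \<phi> t x * \<zeta> x \<partial>lborel) = (\<integral>x.
        \<phi> t x * \<xi> x \<partial>lborel)"
      unfolding \<xi>_def using integral_ZXs_mult[OF sub, of \<phi> t \<zeta> R] \<phi> \<zeta> \<gamma>
          supp by (simp del: CE.simps)
    also have "\<dots> = - (\<integral>\<mu>. \<nu> \<mu> * (\<integral>x. \<xi> x * gpot (exp \<mu>) 0
        (rho f t) x \<partial>lborel) \<partial>lborel)"
      using borel_measurable_continuous_onI[OF CE_continuous[OF \<phi>]] rep
      by (intro superposition_integral[OF \<nu>m \<nu>0 G N \<rho>0 c\<xi> s\<xi> Gm]) auto
    finally have "ennreal \<bar>\<integral>x. ZXs (Trans k # \<gamma>) \<phi> t x * \<zeta> x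
        \<partial>lborel\<bar>
        = ennreal \<bar>\<integral>\<mu>. \<nu> \<mu> * (\<integral>x. \<xi> x * gpot (exp \<mu>) 0 (rho f
            t) x \<partial>lborel) \<partial>lborel\<bar>" by simp
    also have "\<dots> \<le> (\<integral>\<^sup>+\<mu>. ennreal \<bar>\<nu> \<mu> * (\<integral>x. \<xi> x
        * gpot (exp \<mu>) 0 (rho f t) x \<partial>lborel)\<bar> \<partial>lborel)"
      by (rule abs_integral_le_nn_integral)
    also have "\<dots> \<le> (\<integral>\<^sup>+\<mu>. ennreal C * (\<Sum>\<beta>\<in>multi_indices m.
        ennreal (\<nu> \<mu>) * gauss_L1 (exp \<mu>) \<zeta> (rho (Zs \<beta> f) t)) \<partial>lborel)"
    proof (rule nn_integral_mono)
      fix \<mu>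
      have "ennreal \<bar>\<nu> \<mu> * (\<integral>x. \<xi> x * gpot (exp \<mu>) 0 (rho f t) x
          \<partial>lborel)\<bar>
          = ennreal (\<nu> \<mu>) * ennreal \<bar>\<integral>x. \<xi> x * gpot (exp \<mu>) 0 (rho f t) x
              \<partial>lborel\<bar>"
        using \<nu>0 by (simp add: abs_mult ennreal_mult)
      also have "\<dots> \<le> ennreal (\<nu> \<mu>) * (ennreal C * (\<Sum>\<beta>\<in>multi_indices m.
          gauss_L1 (exp \<mu>) \<zeta> (rho (Zs \<beta> f) t)))"
        unfolding \<xi>_def using supp by (intro mult_left_mono C(2)[OF \<gamma> f _ \<zeta>, of _ R]) auto
      also have "\<dots> = ennreal C * (\<Sum>\<beta>\<in>multi_indices m. ennreal (\<nu> \<mu>) * gauss_L1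
          (exp \<mu>) \<zeta> (rho (Zs \<beta> f) t))"
        by (simp add: sum_distrib_left mult_ac)
      finally show "ennreal \<bar>\<nu> \<mu> * (\<integral>x. \<xi> x * gpot (exp \<mu>) 0 (rho f t) x
          \<partial>lborel)\<bar>
          \<le> ennreal C * (\<Sum>\<beta>\<in>multi_indices m. ennreal (\<nu> \<mu>) * gauss_L1 (exp
              \<mu>) \<zeta> (rho (Zs \<beta> f) t))" .
    qed
    also have "\<dots> = ennreal C * (\<Sum>\<beta>\<in>multi_indices m. \<integral>\<^sup>+\<mu>. ennreal
        (\<nu> \<mu>) * gauss_L1 (exp \<mu>) \<zeta> (rho (Zs \<beta> f) t) \<partial>lborel)"
      using gm[OF \<rho>] by (subst nn_integral_cmult) (auto intro!: borel_measurable_sum simp: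
          nn_integral_sum)
    also have "\<dots> \<le> ennreal C * (\<Sum>\<beta>\<in>multi_indices m. ennreal Cw * A (rho (Zs
        \<beta> f) t))"
      by (intro mult_left_mono sum_mono gA \<rho>) auto
    also have "\<dots> = ennreal (C * Cw) * (\<Sum>\<beta>\<in>multi_indices m. A (rho (Zs \<beta> f) t))"
      using C(1) Cw by (simp add: sum_distrib_left[symmetric] ennreal_mult mult.assoc)
    finally show "ennreal \<bar>\<integral>x. ZXs (Trans k # \<gamma>) \<phi> t x * \<zeta> x
        \<partial>lborel\<bar>
       \<le> ennreal (C * Cw) * (\<Sum>\<beta>\<in>multi_indices m. \<integral>\<^sup>+x.
           \<integral>\<^sup>+y. ennreal (\<bar>\<zeta> x\<bar> * \<bar>rho (Zs \<beta> f) t y\<bar> * wt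
               sys (x - y)) \<partial>lborel \<partial>lborel)"
      unfolding A_def .
  qed
qed

lemma exp_exp_le:
  fixes a c :: real
  assumes a: "0 < a" and j: "2 * a \<le> real j" and c: "1 / 2 \<le> c"
  shows "exp (a * \<mu> - c * exp \<mu>) \<le> 2 ^ j * fact j * exp (- (a * \<bar>\<mu>\<bar>))"
proof (cases "\<mu> \<le> 0")
  case True
  have "a * \<mu> - c * exp \<mu> \<le> - (a * \<bar>\<mu>\<bar>)" using True c by (simp add: less_imp_le)
  then have "exp (a * \<mu> - c * exp \<mu>) \<le> 1 * exp (- (a * \<bar>\<mu>\<bar>))" by simp
  also have "\<dots> \<le> 2 ^ j * fact j * exp (- (a * \<bar>\<mu>\<bar>))"
  proof (intro mult_right_mono)
    have "1 * 1 \<le> (2::real) ^ j * fact j" by (intro mult_mono) auto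
    then show "1 \<le> (2::real) ^ j * fact j" by simp
  qed simp
  finally show ?thesis .
next
  case False
  have "exp (2 * a * \<mu>) * exp (- (exp \<mu> / 2)) \<le> exp \<mu> ^ j * exp (- (exp \<mu> / 2))"
    using False j by (intro mult_right_mono) (auto simp: exp_of_nat_mult[symmetric] intro!: mult_right_mono)
  also have "\<dots> = 2 ^ j * ((exp \<mu> / 2) ^ j * exp (- (exp \<mu> / 2)))" by (simp add: power_divide)
  also have "\<dots> \<le> 2 ^ j * fact j" by (intro mult_left_mono power_exp_le_fact) auto
  also have "exp (2 * a * \<mu>) * exp (- (exp \<mu> / 2)) = exp (2 * a * \<mu> - exp \<mu> / 2)" by (simp
      flip: exp_add)
  finally have 1: "exp (2 * a * \<mu> - exp \<mu> / 2) \<le> 2 ^ j * fact j" .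
  have "exp (a * \<mu> - c * exp \<mu>) \<le> exp ((2 * a * \<mu> - exp \<mu> / 2) + - (a *
      \<bar>\<mu>\<bar>))"
    using False c mult_right_mono[of "1 / 2" c "exp \<mu>"] by simp
  also have "\<dots> = exp (2 * a * \<mu> - exp \<mu> / 2) * exp (- (a * \<bar>\<mu>\<bar>))" by (simp
      only: exp_add)
  also have "\<dots> \<le> 2 ^ j * fact j * exp (- (a * \<bar>\<mu>\<bar>))" using 1 by (rule
      mult_right_mono) simp
  finally show ?thesis .
qed

lemma nn_integral_exp_exp:
  fixes a c :: real
  assumes "0 < a" "1 / 2 \<le> c"
  obtains K where "0 < K" "(\<integral>\<^sup>+\<mu>. ennreal (exp (a * \<mu> - c * exp \<mu>))
      \<partial>lborel) = ennreal K"
proof -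
  obtain j :: nat where j: "2 * a \<le> real j" using real_arch_simple by blast
  have fin: "(\<integral>\<^sup>+\<mu>. ennreal (exp (a * \<mu> - c * exp \<mu>)) \<partial>lborel) <
      \<infinity>"
    using exp_exp_le[OF assms(1) j assms(2)] by (rule nn_integral_finite_by_exp_abs[OF assms(1)])
  have "(\<integral>\<^sup>+\<mu>. ennreal (exp (a * \<mu> - c * exp \<mu>)) \<partial>lborel) \<noteq> 0"
    by (subst nn_integral_0_iff_AE) (auto simp: ennreal_eq_0_iff not_le eventually_False
        ae_filter_eq_bot_iff)
  then show ?thesis
    using fin by (intro that[of "enn2real (\<integral>\<^sup>+\<mu>. ennreal (exp (a * \<mu> - c * exp
        \<mu>)) \<partial>lborel)"])
      (auto simp: enn2real_positive_iff zero_less_iff_neq_zero)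
qed

text \<open>Scaling in \<open>r\<close> is a translation in \<open>\<mu>\<close>.\<close>

lemma nn_integral_exp_exp_scale:
  fixes a c r :: real
  assumes r: "0 < r"
  shows "(\<integral>\<^sup>+\<mu>. ennreal (exp (a * \<mu> - c * (exp \<mu> * (r * r)))) \<partial>lborel)
     = ennreal (r powr (- (2 * a))) * (\<integral>\<^sup>+\<mu>. ennreal (exp (a * \<mu> - c * exp \<mu>))
         \<partial>lborel)"
proof -
  have "(\<integral>\<^sup>+\<mu>. ennreal (exp (a * \<mu> - c * (exp \<mu> * (r * r)))) \<partial>lborel)
      = (\<integral>\<^sup>+\<mu>. ennreal (exp (a * (\<mu> + - (2 * ln r)) - c * (exp (\<mu> + - (2 * ln
          r)) * (r * r)))) \<partial>lborel)"
    by (rule nn_integral_lborel_translate[symmetric]) measurable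
  also have "\<dots> = (\<integral>\<^sup>+\<mu>. ennreal (r powr (- (2 * a))) * ennreal (exp (a * \<mu> -
      c * exp \<mu>)) \<partial>lborel)"
  proof (rule nn_integral_cong)
    fix \<mu> :: real
    have "exp (2 * ln r) = r * r" using r by (simp add: exp_double power2_eq_square)
    then have "exp (\<mu> + - (2 * ln r)) * (r * r) = exp \<mu>"
      unfolding exp_add exp_minus using r by (simp add: field_simps)
    moreover have "exp (a * (\<mu> + - (2 * ln r)) - c * exp \<mu>) = r powr (- (2 * a)) * exp (a * \<mu> -
        c * exp \<mu>)"
      using r by (simp add: powr_def exp_add[symmetric] algebra_simps)
    ultimately show "ennreal (exp (a * (\<mu> + - (2 * ln r)) - c * (exp (\<mu> + - (2 * ln r)) * (r * r))))
        = ennreal (r powr (- (2 * a))) * ennreal (exp (a * \<mu> - c * exp \<mu>))"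
      by (simp add: ennreal_mult)
  qed
  also have "\<dots> = ennreal (r powr (- (2 * a))) * (\<integral>\<^sup>+\<mu>. ennreal (exp (a * \<mu> -
      c * exp \<mu>)) \<partial>lborel)"
    by (rule nn_integral_cmult) measurable
  finally show ?thesis .
qed

lemma nn_integral_even:
  fixes h :: "real \<Rightarrow> ennreal"
  assumes [measurable]: "h \<in> borel_measurable borel" and even: "\<And>x. h (- x) = h x"
  shows "(\<integral>\<^sup>+x. h x \<partial>lborel) = 2 * (\<integral>\<^sup>+x. indicator {0..} x * h x
      \<partial>lborel)"
proof -
  have "(\<integral>\<^sup>+x. h x \<partial>lborel) = (\<integral>\<^sup>+x. indicator {0..} x * h x +
      indicator {0..} (- x) * h (- x) \<partial>lborel)"
  proof (rule nn_integral_cong_AE)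
    have "AE x in lborel. x \<noteq> (0::real)" by (rule AE_lborel_singleton)
    then show "AE x in lborel. h x = indicator {0..} x * h x + indicator {0..} (- x) * h (- x)"
      by eventually_elim (auto simp: indicator_def even)
  qed
  also have "\<dots> = (\<integral>\<^sup>+x. indicator {0..} x * h x \<partial>lborel) +
      (\<integral>\<^sup>+x. indicator {0..} (- x) * h (- x) \<partial>lborel)"
    by (rule nn_integral_add) measurable
  also have "(\<integral>\<^sup>+x. indicator {0..} (- x) * h (- x) \<partial>lborel) =
      (\<integral>\<^sup>+x. indicator {0..} x * h x \<partial>lborel)"
    by (subst (2) nn_integral_real_affine[where c = "-1" and t = 0]) auto
  finally show ?thesis by (simp add: mult_2)
qed

lemma besselK_0:
  assumes r: "0 < r"
  shows "(\<integral>\<^sup>+\<mu>. ennreal (exp (- (exp (- \<mu>) / 4)) * exp (- (exp \<mu> * (r * r))))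
      \<partial>lborel) = 2 * ennreal (besselK 0 r)"
    "0 \<le> besselK 0 r"
proof -
  have ch: "exp \<bar>l\<bar> / 2 \<le> cosh l" for l :: real by (simp add: cosh_field_def abs_if)
  have bd: "exp (- (r * cosh l)) \<le> 2 / r * exp (- (1 * \<bar>l\<bar>))" for l :: real
  proof -
    define u where "u = r * (exp \<bar>l\<bar> / 2)"
    have u: "0 < u" using r by (simp add: u_def)
    have "exp (- (r * cosh l)) \<le> exp (- u)"
      unfolding u_def using r ch[of l] by (simp del: times_divide_eq_right)
    also have "\<dots> \<le> 1 / u" using power_exp_le_fact[of u 1] u by (simp add: field_simps)
    also have "\<dots> = 2 / r * exp (- (1 * \<bar>l\<bar>))" using r by (simp add: u_def exp_minus
        field_simps)
    finally show ?thesis .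
  qed
  have fin: "(\<integral>\<^sup>+l. ennreal (exp (- (r * cosh l))) \<partial>lborel) < \<infinity>"
    by (rule nn_integral_finite_by_exp_abs[of 1, OF _ bd]) simp
  have [measurable]: "(cosh :: real \<Rightarrow> real) \<in> borel_measurable borel"
    by (intro borel_measurable_continuous_onI continuous_intros)
  have two: "(\<integral>\<^sup>+l. ennreal (exp (- (r * cosh l))) \<partial>lborel) = 2 *
      (\<integral>\<^sup>+l. indicator {0..} l * ennreal (exp (- (r * cosh l))) \<partial>lborel)"
    by (rule nn_integral_even) auto
  have B: "besselK 0 r = (\<integral>l. indicator {0..} l * exp (- (r * cosh l)) \<partial>lborel)"
    by (simp add: besselK_def set_lebesgue_integral_def)
  have "besselK 0 r = enn2real (\<integral>\<^sup>+l. ennreal (indicator {0..} l * exp (- (r * cosh l)))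
      \<partial>lborel)"
    unfolding B by (rule integral_eq_nn_integral) auto
  also have "(\<integral>\<^sup>+l. ennreal (indicator {0..} l * exp (- (r * cosh l))) \<partial>lborel) =
      (\<integral>\<^sup>+l. indicator {0..} l * ennreal (exp (- (r * cosh l))) \<partial>lborel)"
    by (intro nn_integral_cong) (simp add: indicator_def)
  finally have BK: "besselK 0 r = enn2real (\<integral>\<^sup>+l. indicator {0..} l * ennreal (exp (- (r *
      cosh l))) \<partial>lborel)" .
  have "(\<integral>\<^sup>+l. indicator {0..} l * ennreal (exp (- (r * cosh l))) \<partial>lborel) \<le>
      (\<integral>\<^sup>+l. ennreal (exp (- (r * cosh l))) \<partial>lborel)"
    by (intro nn_integral_mono) (simp add: indicator_def)
  then have "(\<integral>\<^sup>+l. indicator {0..} l * ennreal (exp (- (r * cosh l))) \<partial>lborel) <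
      \<infinity>"
    using fin by (rule le_less_trans)
  then have "(\<integral>\<^sup>+l. indicator {0..} l * ennreal (exp (- (r * cosh l))) \<partial>lborel) =
      ennreal (besselK 0 r)"
    unfolding BK by simp
  moreover have "(\<integral>\<^sup>+\<mu>. ennreal (exp (- (exp (- \<mu>) / 4)) * exp (- (exp \<mu> * (r *
      r)))) \<partial>lborel) = (\<integral>\<^sup>+l. ennreal (exp (- (r * cosh l))) \<partial>lborel)"
  proof -
    have m: "(\<lambda>\<mu>. exp (- (exp (- \<mu>) / 4)) * exp (- (exp \<mu> * (r * r)))) \<in>
        borel_measurable borel"
      by (intro borel_measurable_continuous_onI continuous_intros) auto
    have "(\<integral>\<^sup>+\<mu>. ennreal (exp (- (exp (- \<mu>) / 4)) * exp (- (exp \<mu> * (r * r))))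
        \<partial>lborel)
        = (\<integral>\<^sup>+l. ennreal (exp (- (exp (- (l + - ln (2 * r))) / 4)) * exp (- (exp (l + - ln
            (2 * r)) * (r * r)))) \<partial>lborel)"
      by (rule nn_integral_lborel_translate[where c = "- ln (2 * r)" and
            F = "\<lambda>\<mu>. ennreal (exp (- (exp (- \<mu>) / 4)) * exp (- (exp \<mu> * (r * r))))",
                symmetric])
        (rule measurable_compose[OF m measurable_ennreal])
    also have "\<dots> = (\<integral>\<^sup>+l. ennreal (exp (- (r * cosh l))) \<partial>lborel)"
    proof (rule nn_integral_cong)
      fix l :: real
      have 1: "exp (l + - ln (2 * r)) = exp l / (2 * r)" "exp (- (l + - ln (2 * r))) = exp (- l) * (2 * r)"
      proof -
        have e: "exp (ln (2 * r)) = 2 * r" using r by simp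
        show "exp (l + - ln (2 * r)) = exp l / (2 * r)" unfolding exp_add exp_minus e divide_inverse ..
        have "- (l + - ln (2 * r)) = - l + ln (2 * r)" by simp
        then show "exp (- (l + - ln (2 * r))) = exp (- l) * (2 * r)" by (simp only: exp_add e)
      qed
      have "- (exp (- l) * (2 * r) / 4) + - (exp l / (2 * r) * (r * r)) = - (r * cosh l)"
      proof -
        have "exp l / (2 * r) * (r * r) = r * (exp l / 2)" "exp (- l) * (2 * r) / 4 = r * (exp (- l) / 2)"
          using r by simp_all
        then show ?thesis by (simp add: cosh_field_def add_divide_distrib distrib_left)
      qed
      then show "ennreal (exp (- (exp (- (l + - ln (2 * r))) / 4)) * exp (- (exp (l + - ln (2 * r)) * (r *
          r))))
          = ennreal (exp (- (r * cosh l)))"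
        unfolding 1 exp_add[symmetric] by simp
    qed
    finally show ?thesis .
  qed
  ultimately show "(\<integral>\<^sup>+\<mu>. ennreal (exp (- (exp (- \<mu>) / 4)) * exp (- (exp \<mu> * (r
      * r)))) \<partial>lborel) = 2 * ennreal (besselK 0 r)"
    using two by simp
  show "0 \<le> besselK 0 r" unfolding BK by simp
qed

lemma green_measurable: "green sys \<in> borel_measurable (borel :: (real, 'n::finite) vec measure)"
proof -
  have "(cosh :: real \<Rightarrow> real) \<in> borel_measurable borel"
    by (intro borel_measurable_continuous_onI continuous_intros)
  then have [measurable]: "besselK \<nu> \<in> borel_measurable borel" for \<nu>
    unfolding besselK_def[abs_def] set_lebesgue_integral_def by measurable
  show ?thesis unfolding green_def[abs_def] Let_def by (cases sys) (simp_all, measurable)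
qed

lemma green_superposition:
  assumes "(sys = Vlasov_Poisson \<and> CARD('n::{finite,linorder}) = 3) \<or> (sys = Vlasov_Yukawa \<and>
      CARD('n) = 2)"
  shows "\<exists>\<nu> Cw. \<nu> \<in> borel_measurable borel \<and> (\<forall>\<mu>. 0 \<le> \<nu> \<mu>)
      \<and>
     (\<forall>z :: (real, 'n) vec. z \<noteq> 0 \<longrightarrow> (\<integral>\<^sup>+\<mu>. ennreal
         (\<nu> \<mu> * ek (exp \<mu>) 0 z) \<partial>lborel) = ennreal (- green sys z)) \<and>
     (\<forall>z :: (real, 'n) vec. green sys z \<le> 0) \<and>
     (\<integral>\<^sup>+\<mu>. ennreal (\<nu> \<mu> * min 1 (exp (- (real CARD('n) * \<mu> / 2))))
         \<partial>lborel) < \<infinity> \<and>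
     (\<forall>z :: (real, 'n) vec. z \<noteq> 0 \<longrightarrow>
       (\<integral>\<^sup>+\<mu>. ennreal (\<nu> \<mu> * (exp \<mu> * norm z * exp (- (exp \<mu> * (z
           \<bullet> z)) / 2))) \<partial>lborel) \<le> ennreal (Cw * wt sys z)) \<and> 0 \<le> Cw"
  using assms
proof (elim disjE conjE)
  assume sys: "sys = Vlasov_Poisson" and n: "CARD('n) = 3"
  obtain K1 where K1: "0 < K1" "(\<integral>\<^sup>+\<mu>. ennreal (exp (1 / 2 * \<mu> - 1 * exp \<mu>))
      \<partial>lborel) = ennreal K1"
    by (rule nn_integral_exp_exp[of "1 / 2" 1]) auto
  obtain K3 where K3: "0 < K3" "(\<integral>\<^sup>+\<mu>. ennreal (exp (3 / 2 * \<mu> - 1 / 2 * exp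
      \<mu>)) \<partial>lborel) = ennreal K3"
    by (rule nn_integral_exp_exp[of "3 / 2" "1 / 2"]) auto
  define V where "V = 3 * unit_ball_vol 3"
  have V: "0 < V" by (simp add: V_def)
  define c where "c = 1 / (V * K1)"
  have c: "0 < c" "c * K1 = 1 / V" using V K1(1) by (simp_all add: c_def)
  have green: "- green sys z = 1 / V * norm z powr (- 1)" for z :: "(real, 'n) vec"
    by (simp add: green_def Let_def sys n V_def)
  show ?thesis
  proof (rule exI[of _ "\<lambda>\<mu>. c * exp (\<mu> / 2)"], rule exI[of _ "c * K3"], intro conjI allI
      impI)
    fix z :: "(real, 'n) vec" assume z: "z \<noteq> 0"
    then have r: "0 < norm z" and zz: "z \<bullet> z = norm z * norm z" by (simp_all add: dot_square_norm
        power2_eq_square)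
    have "(\<integral>\<^sup>+\<mu>. ennreal (c * exp (\<mu> / 2) * ek (exp \<mu>) 0 z) \<partial>lborel)
        = (\<integral>\<^sup>+\<mu>. ennreal c * ennreal (exp (1 / 2 * \<mu> - 1 * (exp \<mu> * (norm z *
            norm z)))) \<partial>lborel)"
      using c by (intro nn_integral_cong) (simp add: ek_def zz ennreal_mult[symmetric] exp_add[symmetric]
          mult.assoc)
    also have "\<dots> = ennreal c * (ennreal (norm z powr (- (2 * (1 / 2)))) * ennreal K1)"
      unfolding K1(2)[symmetric] nn_integral_exp_exp_scale[OF r, symmetric] by (rule nn_integral_cmult)
          measurable
    also have "\<dots> = ennreal ((c * K1) * norm z powr (- 1))"
      using c K1 by (simp add: ennreal_mult[symmetric] mult_ac)
    also have "\<dots> = ennreal (- green sys z)" unfolding c(2) green ..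
    finally show "(\<integral>\<^sup>+\<mu>. ennreal (c * exp (\<mu> / 2) * ek (exp \<mu>) 0 z)
        \<partial>lborel) = ennreal (- green sys z)" .
    have "(\<integral>\<^sup>+\<mu>. ennreal (c * exp (\<mu> / 2) * (exp \<mu> * norm z * exp (- (exp \<mu>
        * (z \<bullet> z)) / 2))) \<partial>lborel)
        = (\<integral>\<^sup>+\<mu>. ennreal (c * norm z) * ennreal (exp (3 / 2 * \<mu> - 1 / 2 * (exp
            \<mu> * (norm z * norm z)))) \<partial>lborel)"
    proof (rule nn_integral_cong)
      fix \<mu>
      have "exp (3 / 2 * \<mu> - 1 / 2 * (exp \<mu> * (norm z * norm z))) = exp (\<mu> / 2) * exp \<mu> *
          exp (- (exp \<mu> * (norm z * norm z)) / 2)"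
        unfolding exp_add[symmetric] by simp
      then show "ennreal (c * exp (\<mu> / 2) * (exp \<mu> * norm z * exp (- (exp \<mu> * (z \<bullet> z))
          / 2)))
          = ennreal (c * norm z) * ennreal (exp (3 / 2 * \<mu> - 1 / 2 * (exp \<mu> * (norm z * norm z))))"
        using c by (simp add: zz ennreal_mult[symmetric] mult_ac)
    qed
    also have "\<dots> = ennreal (c * norm z) * (ennreal (norm z powr (- (2 * (3 / 2)))) * ennreal K3)"
      unfolding K3(2)[symmetric] nn_integral_exp_exp_scale[OF r, symmetric] by (rule nn_integral_cmult)
          measurable
    also have "\<dots> = ennreal (c * K3 * (norm z * norm z powr (- 3)))"
      using c K3 by (simp add: ennreal_mult[symmetric] mult_ac)
    also have "norm z * norm z powr (- 3) = wt sys z"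
      using r by (simp add: wt_def sys zz powr_minus powr_numeral field_simps power3_eq_cube)
    finally show "(\<integral>\<^sup>+\<mu>. ennreal (c * exp (\<mu> / 2) * (exp \<mu> * norm z * exp (-
        (exp \<mu> * (z \<bullet> z)) / 2))) \<partial>lborel)
        \<le> ennreal (c * K3 * wt sys z)" by simp
  next
    show "(\<integral>\<^sup>+\<mu>. ennreal (c * exp (\<mu> / 2) * min 1 (exp (- (real CARD('n) * \<mu> /
        2)))) \<partial>lborel) < \<infinity>"
    proof (rule nn_integral_finite_by_exp_abs[of "1 / 2" _ c])
      fix \<mu> :: real
      have "exp (\<mu> / 2) * min 1 (exp (- (3 * \<mu> / 2))) \<le> exp (- (1 / 2 * \<bar>\<mu>\<bar>))"
      proof (cases "\<mu> \<le> 0")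
        case True
        then have "exp (\<mu> / 2) * min 1 (exp (- (3 * \<mu> / 2))) \<le> exp (\<mu> / 2) * 1" by (intro
            mult_left_mono) auto
        with True show ?thesis by simp
      next
        case False
        have "exp (\<mu> / 2) * min 1 (exp (- (3 * \<mu> / 2))) \<le> exp (\<mu> / 2) * exp (- (3 * \<mu> /
            2))" by (intro mult_left_mono) auto
        also have "\<dots> \<le> exp (- (1 / 2 * \<bar>\<mu>\<bar>))" unfolding exp_add[symmetric] using
            False by simp
        finally show ?thesis .
      qed
      then show "c * exp (\<mu> / 2) * min 1 (exp (- (real CARD('n) * \<mu> / 2))) \<le> c * exp (- (1 / 2
          * \<bar>\<mu>\<bar>))"
        using c unfolding n mult.assoc by (intro mult_left_mono) auto
    qed simp
    have "0 \<le> - green sys z" for z :: "(real, 'n) vec" unfolding green using V by simp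
    then show "green sys z \<le> 0" for z :: "(real, 'n) vec" by (simp only: neg_0_le_iff_le)
  qed (use c K3 in auto)
next
  assume sys: "sys = Vlasov_Yukawa" and n: "CARD('n) = 2"
  obtain K1 where K1: "0 < K1" "(\<integral>\<^sup>+\<mu>. ennreal (exp (1 * \<mu> - 1 / 2 * exp \<mu>))
      \<partial>lborel) = ennreal K1"
    by (rule nn_integral_exp_exp[of 1 "1 / 2"]) auto
  obtain K2 where K2: "0 < K2" "(\<integral>\<^sup>+\<mu>. ennreal (exp (2 * \<mu> - 1 / 2 * exp \<mu>))
      \<partial>lborel) = ennreal K2"
    by (rule nn_integral_exp_exp[of 2 "1 / 2"]) auto
  define c where "c = 1 / (4 * pi)"
  have c: "0 < c" by (simp add: c_def)
  have green: "- green sys z = 2 * c * (if z = 0 then 0 else besselK 0 (norm z))" for z :: "(real, 'n) vec"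
    by (simp add: green_def Let_def sys n c_def powr_minus) (simp add: divide_inverse)
  have e4: "exp (- (exp (- \<mu>) / 4)) \<le> 4 * exp \<mu>" for \<mu> :: real
  proof -
    have "(exp (- \<mu>) / 4) * exp (- (exp (- \<mu>) / 4)) \<le> 1" using power_exp_le_fact[of "exp (-
        \<mu>) / 4" 1] by simp
    then show ?thesis by (simp add: exp_minus field_simps)
  qed
  show ?thesis
  proof (rule exI[of _ "\<lambda>\<mu>. c * exp (- (exp (- \<mu>) / 4))"], rule exI[of _ "4 * c * (K1 + 4 *
      K2)"], intro conjI allI impI)
    fix z :: "(real, 'n) vec" assume z: "z \<noteq> 0"
    define r where "r = norm z"
    have r: "0 < r" and zz: "z \<bullet> z = r * r" using z by (simp_all add: r_def dot_square_norm
        power2_eq_square)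
    have "(\<integral>\<^sup>+\<mu>. ennreal (c * exp (- (exp (- \<mu>) / 4)) * ek (exp \<mu>) 0 z)
        \<partial>lborel)
        = (\<integral>\<^sup>+\<mu>. ennreal c * ennreal (exp (- (exp (- \<mu>) / 4)) * exp (- (exp \<mu> *
            (r * r)))) \<partial>lborel)"
      using c by (intro nn_integral_cong) (simp add: ek_def zz ennreal_mult[symmetric] mult.assoc)
    also have "\<dots> = ennreal c * (2 * ennreal (besselK 0 r))"
      unfolding besselK_0(1)[OF r, symmetric] by (rule nn_integral_cmult) measurable
    also have "\<dots> = ennreal c * (ennreal 2 * ennreal (besselK 0 r))" by simp
    also have "\<dots> = ennreal (2 * c * besselK 0 r)"
      using c besselK_0(2)[OF r] by (simp only: ennreal_mult[symmetric] mult_nonneg_nonneg less_imp_le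
          zero_le_numeral mult_ac)
    also have "\<dots> = ennreal (- green sys z)" unfolding green using z by (simp add: r_def)
    finally show "(\<integral>\<^sup>+\<mu>. ennreal (c * exp (- (exp (- \<mu>) / 4)) * ek (exp \<mu>) 0 z)
        \<partial>lborel) = ennreal (- green sys z)" .
    let ?I = "\<integral>\<^sup>+\<mu>. ennreal (c * exp (- (exp (- \<mu>) / 4)) * (exp \<mu> * norm z *
        exp (- (exp \<mu> * (z \<bullet> z)) / 2))) \<partial>lborel"
    have "?I \<le> (\<integral>\<^sup>+\<mu>. ennreal (c * r) * ennreal (exp (1 * \<mu> - 1 / 2 * (exp
        \<mu> * (r * r)))) \<partial>lborel)"
    proof (rule nn_integral_mono)
      fix \<mu> :: real
      have "c * exp (- (exp (- \<mu>) / 4)) * (exp \<mu> * r * exp (- (exp \<mu> * (r * r)) / 2)) \<le> c *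
          1 * (exp \<mu> * r * exp (- (exp \<mu> * (r * r)) / 2))"
        using c r by (intro mult_right_mono mult_left_mono) auto
      also have "\<dots> = (c * r) * exp (1 * \<mu> - 1 / 2 * (exp \<mu> * (r * r)))"
        unfolding exp_diff by (simp add: exp_minus field_simps)
      finally show "ennreal (c * exp (- (exp (- \<mu>) / 4)) * (exp \<mu> * norm z * exp (- (exp \<mu> * (z
          \<bullet> z)) / 2)))
          \<le> ennreal (c * r) * ennreal (exp (1 * \<mu> - 1 / 2 * (exp \<mu> * (r * r))))"
        using c r unfolding r_def[symmetric] zz by (subst ennreal_mult[symmetric]) (auto intro!:
            ennreal_leI)
    qed
    also have "\<dots> = ennreal (c * r) * (ennreal (r powr (- (2 * 1))) * ennreal K1)"
      unfolding K1(2)[symmetric] nn_integral_exp_exp_scale[OF r, symmetric] by (rule nn_integral_cmult)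
          measurable
    also have "\<dots> = ennreal (c * K1 / r)"
      using c K1 r by (simp add: ennreal_mult[symmetric] powr_minus field_simps power2_eq_square)
    finally have b1: "?I \<le> ennreal (c * K1 / r)" .
    have "?I \<le> (\<integral>\<^sup>+\<mu>. ennreal (4 * c * r) * ennreal (exp (2 * \<mu> - 1 / 2 * (exp
        \<mu> * (r * r)))) \<partial>lborel)"
    proof (rule nn_integral_mono)
      fix \<mu> :: real
      have "c * exp (- (exp (- \<mu>) / 4)) * (exp \<mu> * r * exp (- (exp \<mu> * (r * r)) / 2)) \<le> c *
          (4 * exp \<mu>) * (exp \<mu> * r * exp (- (exp \<mu> * (r * r)) / 2))"
        using c r e4 by (intro mult_right_mono mult_left_mono) auto
      also have "\<dots> = (4 * c * r) * exp (2 * \<mu> - 1 / 2 * (exp \<mu> * (r * r)))"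
        unfolding exp_diff exp_double by (simp add: exp_minus field_simps power2_eq_square)
      finally show "ennreal (c * exp (- (exp (- \<mu>) / 4)) * (exp \<mu> * norm z * exp (- (exp \<mu> * (z
          \<bullet> z)) / 2)))
          \<le> ennreal (4 * c * r) * ennreal (exp (2 * \<mu> - 1 / 2 * (exp \<mu> * (r * r))))"
        using c r unfolding r_def[symmetric] zz by (subst ennreal_mult[symmetric]) (auto intro!:
            ennreal_leI)
    qed
    also have "\<dots> = ennreal (4 * c * r) * (ennreal (r powr (- (2 * 2))) * ennreal K2)"
      unfolding K2(2)[symmetric] nn_integral_exp_exp_scale[OF r, symmetric] by (rule nn_integral_cmult)
          measurable
    also have "\<dots> = ennreal (4 * c * K2 / r ^ 3)"
      using c K2 r by (simp add: ennreal_mult[symmetric] powr_minus powr_numeral field_simps power4_eq_xxxx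
          power3_eq_cube)
    finally have b2: "?I \<le> ennreal (4 * c * K2 / r ^ 3)" .
    have wt: "wt sys z = 1 / (r * (1 + r)\<^sup>2)" by (simp add: wt_def sys r_def)
    show "?I \<le> ennreal (4 * c * (K1 + 4 * K2) * wt sys z)"
    proof (cases "r \<le> 1")
      case True
      then have "(1 + r)\<^sup>2 \<le> 2\<^sup>2" using r by (intro power_mono) auto
      then have "r * (1 + r)\<^sup>2 \<le> r * 4" using r by (intro mult_left_mono) auto
      then have "1 / (r * 4) \<le> wt sys z" unfolding wt using r by (intro divide_left_mono) auto
      then have "4 * c * (K1 + 4 * K2) * (1 / (r * 4)) \<le> 4 * c * (K1 + 4 * K2) * wt sys z"
        using c K1 K2 by (intro mult_left_mono) auto
      moreover have "c * K1 / r \<le> 4 * c * (K1 + 4 * K2) * (1 / (r * 4))"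
        using c K1 K2 r by (simp add: field_simps)
      ultimately show ?thesis by (intro order_trans[OF b1 ennreal_leI]) linarith
    next
      case False
      then have "(1 + r)\<^sup>2 \<le> (2 * r)\<^sup>2" using r by (intro power_mono) auto
      then have "r * (1 + r)\<^sup>2 \<le> r * (2 * r)\<^sup>2" using r by (intro mult_left_mono) auto
      then have "1 / (r * (2 * r)\<^sup>2) \<le> wt sys z" unfolding wt using r by (intro divide_left_mono)
          auto
      then have "4 * c * (K1 + 4 * K2) * (1 / (r * (2 * r)\<^sup>2)) \<le> 4 * c * (K1 + 4 * K2) * wt sys z"
        using c K1 K2 by (intro mult_left_mono) auto
      moreover have "4 * c * K2 / r ^ 3 \<le> 4 * c * (K1 + 4 * K2) * (1 / (r * (2 * r)\<^sup>2))"
        using c K1 K2 r by (simp add: field_simps power2_eq_square power3_eq_cube)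
      ultimately show ?thesis by (intro order_trans[OF b2 ennreal_leI]) linarith
    qed
  next
    show "(\<integral>\<^sup>+\<mu>. ennreal (c * exp (- (exp (- \<mu>) / 4)) * min 1 (exp (- (real
        CARD('n) * \<mu> / 2)))) \<partial>lborel) < \<infinity>"
    proof (rule nn_integral_finite_by_exp_abs[of 1 _ "c * 4"])
      fix \<mu> :: real
      have "exp (- (exp (- \<mu>) / 4)) * min 1 (exp (- \<mu>)) \<le> 4 * exp (- (1 * \<bar>\<mu>\<bar>))"
      proof (cases "\<mu> \<le> 0")
        case True
        then have "exp (- (exp (- \<mu>) / 4)) * min 1 (exp (- \<mu>)) \<le> (4 * exp \<mu>) * 1" using e4
            by (intro mult_mono) auto
        with True show ?thesis by simp
      next
        case False
        have "exp (- (exp (- \<mu>) / 4)) * min 1 (exp (- \<mu>)) \<le> 1 * exp (- \<mu>)" by (intro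
            mult_mono) auto
        also have "\<dots> \<le> 4 * exp (- (1 * \<bar>\<mu>\<bar>))" using False by simp
        finally show ?thesis .
      qed
      then have "c * (exp (- (exp (- \<mu>) / 4)) * min 1 (exp (- \<mu>))) \<le> c * (4 * exp (- (1 *
          \<bar>\<mu>\<bar>)))"
        using c by (intro mult_left_mono) auto
      then show "c * exp (- (exp (- \<mu>) / 4)) * min 1 (exp (- (real CARD('n) * \<mu> / 2))) \<le> c * 4
          * exp (- (1 * \<bar>\<mu>\<bar>))"
        unfolding n by (simp add: mult.assoc)
    qed simp
    have "0 \<le> - green sys z" for z :: "(real, 'n) vec" unfolding green using c besselK_0(2)[of "norm
        z"] by simp
    then show "green sys z \<le> 0" for z :: "(real, 'n) vec" by (simp only: neg_0_le_iff_le)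
  qed (use c K1 K2 in auto)
qed

section \<open>From test functions to pointwise products\<close>

definition bump :: "nat \<Rightarrow> real \<Rightarrow> 'a::euclidean_space \<Rightarrow> real" where
  "bump m \<delta> z = max 0 (1 - (1 / \<delta>\<^sup>2) * (z \<bullet> z)) ^ (m + 2)"

lemma CE_bump: "CE m (\<lambda>x. bump m \<delta> (x - a))"
  unfolding bump_def by (intro CE_max0_power CE_diff CE_const CE_cmult CE_inner_self)

lemma bump_nonneg: "0 \<le> bump m \<delta> z"
  by (simp add: bump_def)

lemma bump_eq_0: "0 < \<delta> \<Longrightarrow> \<delta> \<le> norm z \<Longrightarrow> bump m \<delta> z
    = 0"
  using power_mono[of \<delta> "norm z" 2] by (simp add: bump_def dot_square_norm max_def field_simps)

lemma bump_pos: "0 < \<delta> \<Longrightarrow> norm z < \<delta> \<Longrightarrow> 0 < bump m \<delta> z"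
proof -
  assume "0 < \<delta>" "norm z < \<delta>"
  then have "(1 / \<delta>\<^sup>2) * (z \<bullet> z) < 1"
    using power_strict_mono[of "norm z" \<delta> 2] by (simp add: dot_square_norm)
  then show ?thesis unfolding bump_def by (intro zero_less_power) simp
qed

lemma continuous_bump: "continuous_on UNIV (bump m \<delta>)"
  unfolding bump_def[abs_def] by (intro continuous_intros)

lemma integral_bump:
  assumes \<delta>: "0 < \<delta>"
  shows "integrable lborel (bump m \<delta> :: 'a::euclidean_space \<Rightarrow> real)" "0 < (\<integral>x.
      bump m \<delta> (x :: 'a) \<partial>lborel)"
proof -
  show i: "integrable lborel (bump m \<delta> :: 'a \<Rightarrow> real)"
    by (rule integrable_compact_support[OF continuous_bump, where R = \<delta>]) (use \<delta> in
        \<open>auto intro!: bump_eq_0\<close>)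
  have [measurable]: "(bump m \<delta> :: 'a \<Rightarrow> real) \<in> borel_measurable borel"
    by (rule borel_measurable_continuous_onI[OF continuous_bump])
  have "(\<integral>\<^sup>+x. ennreal (bump m \<delta> (x :: 'a)) \<partial>lborel) \<noteq> 0"
  proof
    assume "(\<integral>\<^sup>+x. ennreal (bump m \<delta> (x :: 'a)) \<partial>lborel) = 0"
    then have "emeasure lborel {x :: 'a. ennreal (bump m \<delta> x) \<noteq> 0} = 0"
      by (subst (asm) nn_integral_0_iff) auto
    moreover have "emeasure lborel (ball (0 :: 'a) \<delta>) \<le> emeasure lborel {x :: 'a. ennreal (bump
        m \<delta> x) \<noteq> 0}"
      using bump_pos[OF \<delta>] by (intro emeasure_mono) (auto simp: ennreal_eq_0_iff not_le)
    ultimately have "emeasure lborel (ball (0 :: 'a) \<delta>) = 0" by simp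
    then have "measure lborel (ball (0 :: 'a) \<delta>) = 0" by (simp add: measure_def)
    then show False using content_ball_pos[OF \<delta>, of "0 :: 'a"] by simp
  qed
  then show "0 < (\<integral>x. bump m \<delta> (x :: 'a) \<partial>lborel)"
  proof -
    assume "(\<integral>\<^sup>+x. ennreal (bump m \<delta> (x :: 'a)) \<partial>lborel) \<noteq> 0"
    moreover have "(\<integral>\<^sup>+x. ennreal (bump m \<delta> (x :: 'a)) \<partial>lborel) = ennreal
        (\<integral>x. bump m \<delta> (x :: 'a) \<partial>lborel)"
      by (intro nn_integral_eq_integral i AE_I2 bump_nonneg)
    ultimately show ?thesis by (simp add: ennreal_eq_0_iff not_le)
  qed
qed

lemma bump_average_tendsto:
  fixes h :: "'a::euclidean_space \<Rightarrow> real"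
  assumes h: "continuous_on UNIV h" and \<delta>: "\<And>j. 0 < \<delta> j" "\<delta>
      \<longlonglongrightarrow> 0"
  shows "(\<lambda>j. (\<integral>x. h x * bump m (\<delta> j) (x - a) \<partial>lborel) / (\<integral>x.
      bump m (\<delta> j) (x :: 'a) \<partial>lborel)) \<longlonglongrightarrow> h a"
proof (rule LIMSEQ_I)
  fix r :: real assume r: "0 < r"
  obtain d where d: "0 < d" "\<And>x. dist x a < d \<Longrightarrow> dist (h x) (h a) < r / 2"
    using h r unfolding continuous_on_iff by (metis UNIV_I half_gt_zero)
  have "\<forall>\<^sub>F j in sequentially. \<delta> j < d" by (rule order_tendstoD(2)[OF \<delta>(2)
      d(1)])
  then obtain j0 where j0: "\<And>j. j0 \<le> j \<Longrightarrow> \<delta> j < d" by (auto simp: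
      eventually_sequentially)
  show "\<exists>j0. \<forall>j\<ge>j0. norm ((\<integral>x. h x * bump m (\<delta> j) (x - a)
      \<partial>lborel) / (\<integral>x. bump m (\<delta> j) (x :: 'a) \<partial>lborel) - h a) < r"
  proof (intro exI[of _ j0] allI impI)
    fix j assume j: "j0 \<le> j"
    let ?b = "\<lambda>x. bump m (\<delta> j) (x - a)" and ?c = "\<integral>x. bump m (\<delta> j) (x ::
        'a) \<partial>lborel"
    have c0: "0 < ?c" by (rule integral_bump(2)[OF \<delta>(1)])
    have cb: "continuous_on UNIV ?b" using CE_continuous[OF CE_bump] .
    have b0: "?b x = 0" if "norm a + \<delta> j < norm x" for x
      using norm_triangle_sub[of x a] that \<delta>(1)[of j] by (intro bump_eq_0) auto
    have ib: "integrable lborel ?b" by (rule integrable_compact_support[OF cb b0])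
    have ihb: "integrable lborel (\<lambda>x. h x * ?b x)"
      by (rule integrable_compact_support[where R = "norm a + \<delta> j"]) (use b0 in \<open>auto intro!:
          continuous_intros h cb\<close>)
    have eqc: "(\<integral>x. ?b x \<partial>lborel) = ?c"
      using integral_lborel_translate[OF borel_measurable_continuous_onI[OF continuous_bump], of m
          "\<delta> j" "- a"] by simp
    have "(\<integral>x. h x * ?b x \<partial>lborel) - h a * ?c = (\<integral>x. (h x - h a) * ?b x
        \<partial>lborel)"
      unfolding eqc[symmetric] using ib ihb by (simp add: left_diff_distrib)
    also have "\<bar>\<dots>\<bar> \<le> (\<integral>x. \<bar>(h x - h a) * ?b x\<bar> \<partial>lborel)"
        by (rule integral_abs_bound)
    also have "\<dots> \<le> (\<integral>x. r / 2 * ?b x \<partial>lborel)"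
    proof (rule integral_mono)
      show "integrable lborel (\<lambda>x. \<bar>(h x - h a) * ?b x\<bar>)"
        using ib ihb by (intro integrable_abs) (simp add: left_diff_distrib)
      show "integrable lborel (\<lambda>x. r / 2 * ?b x)" using ib by simp
      show "\<bar>(h x - h a) * ?b x\<bar> \<le> r / 2 * ?b x" for x
      proof (cases "norm (x - a) < \<delta> j")
        case True
        then have "dist x a < d" using j0[OF j] by (simp add: dist_norm)
        then have "\<bar>h x - h a\<bar> \<le> r / 2" using d(2)[of x] by (simp add: dist_real_def)
        from mult_right_mono[OF this bump_nonneg] show ?thesis
          by (simp only: abs_mult abs_of_nonneg[OF bump_nonneg])
      next
        case False
        then show ?thesis using bump_eq_0[OF \<delta>(1)[of j], of "x - a" m] by simp
      qed
    qed
    also have "\<dots> = r / 2 * ?c" using eqc by simp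
    finally have "\<bar>(\<integral>x. h x * ?b x \<partial>lborel) - h a * ?c\<bar> \<le> r / 2 * ?c" .
    then have "\<bar>(\<integral>x. h x * ?b x \<partial>lborel) - h a * ?c\<bar> / ?c \<le> r / 2" using
        c0 by (simp add: pos_divide_le_eq)
    moreover have "(\<integral>x. h x * ?b x \<partial>lborel) / ?c - h a = ((\<integral>x. h x * ?b x
        \<partial>lborel) - h a * ?c) / ?c"
      using c0 by (simp add: diff_divide_distrib)
    ultimately have "\<bar>(\<integral>x. h x * ?b x \<partial>lborel) / ?c - h a\<bar> \<le> r / 2"
      using c0 by (simp only: abs_divide abs_of_pos)
    then show "norm ((\<integral>x. h x * ?b x \<partial>lborel) / ?c - h a) < r"
      unfolding real_norm_def using r by linarith
  qed
qed

lemma mollified_product_bound: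
  fixes h :: "(real, 'n::{finite,linorder}) vec \<Rightarrow> real" and g :: "'n phase \<Rightarrow> real"
    and w :: "(real, 'n) vec \<Rightarrow> real" and \<rho> :: "'b \<Rightarrow> (real, 'n) vec
        \<Rightarrow> real"
  assumes h: "continuous_on UNIV h" and g [measurable]: "g \<in> borel_measurable borel"
    and w [measurable]: "w \<in> borel_measurable borel" and w0: "\<And>x. 0 \<le> w x"
    and \<rho>: "\<And>\<beta>. \<beta> \<in> M \<Longrightarrow> \<rho> \<beta> \<in> borel_measurable
        borel" and fin: "finite M"
    and weak: "\<And>\<zeta> R. CE m \<zeta> \<Longrightarrow> (\<forall>x. R < norm x \<longrightarrow>
        \<zeta> x = 0) \<Longrightarrow> ennreal \<bar>\<integral>x. h x * \<zeta> x \<partial>lborel\<bar>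
       \<le> C * (\<Sum>\<beta>\<in>M. \<integral>\<^sup>+x. \<integral>\<^sup>+y. ennreal (\<bar>\<zeta>
           x\<bar> * \<bar>\<rho> \<beta> y\<bar> * w (x - y)) \<partial>lborel \<partial>lborel)"
    and S: "\<And>y. (\<integral>\<^sup>+z. ennreal (w (fst z - y) * \<bar>g z\<bar>) \<partial>lborel)
        \<le> S"
  shows "(\<integral>\<^sup>+z. ennreal \<bar>h (fst z) * g z\<bar> \<partial>lborel) \<le> C * (S *
      (\<Sum>\<beta>\<in>M. \<integral>\<^sup>+y. ennreal \<bar>\<rho> \<beta> y\<bar> \<partial>lborel))"
proof -
  define \<delta> where "\<delta> j = inverse (real (Suc j))" for j
  have \<delta>: "\<And>j. 0 < \<delta> j" "\<delta> \<longlonglongrightarrow> 0"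
    unfolding \<delta>_def by (simp, rule LIMSEQ_inverse_real_of_nat)
  define c where "c j = (\<integral>x. bump m (\<delta> j) (x :: (real, 'n) vec) \<partial>lborel)" for j
  have c: "0 < c j" for j unfolding c_def by (rule integral_bump(2)[OF \<delta>(1)])
  define H where "H j a = (\<integral>x. h x * bump m (\<delta> j) (x - a) \<partial>lborel) / c j" for j a
  have [measurable]: "h \<in> borel_measurable borel" "bump m (\<delta> j) \<in> borel_measurable (borel ::
      (real, 'n) vec measure)" for j
    by (rule borel_measurable_continuous_onI, rule h continuous_bump)+
  have [measurable]: "H j \<in> borel_measurable borel" for j unfolding H_def[abs_def] by measurable
  have Hlim: "(\<lambda>j. H j a) \<longlonglongrightarrow> h a" for a
    unfolding H_def c_def by (rule bump_average_tendsto[OF h \<delta>])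
  define P where "P = (\<Sum>\<beta>\<in>M. \<integral>\<^sup>+y. ennreal \<bar>\<rho> \<beta> y\<bar>
      \<partial>lborel)"
  have cb: "(\<integral>\<^sup>+x. ennreal (bump m (\<delta> j) (x :: (real, 'n) vec)) \<partial>lborel) =
      ennreal (c j)" for j
    unfolding c_def by (intro nn_integral_eq_integral integral_bump \<delta>) (auto simp: bump_nonneg)
  have step: "(\<integral>\<^sup>+z. ennreal \<bar>H j (fst z) * g z\<bar> \<partial>lborel) \<le> C * (S *
      P)" for j
  proof -
    let ?b = "bump m (\<delta> j) :: (real, 'n) vec \<Rightarrow> real"
    define I where "I \<beta> a = (\<integral>\<^sup>+x. \<integral>\<^sup>+y. ennreal (?b x * \<bar>\<rho>
        \<beta> y\<bar> * w (a - (y - x))) \<partial>lborel \<partial>lborel)" for \<beta> a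
    have Im: "I \<beta> \<in> borel_measurable borel" if "\<beta> \<in> M" for \<beta>
    proof -
      have [measurable]: "\<rho> \<beta> \<in> borel_measurable borel" by (rule \<rho>[OF that])
      show ?thesis unfolding I_def[abs_def] by measurable
    qed
    have Ig: "(\<integral>\<^sup>+z. I \<beta> (fst z) * ennreal \<bar>g z\<bar> \<partial>lborel) \<le>
        ennreal (c j) * (S * (\<integral>\<^sup>+y. ennreal \<bar>\<rho> \<beta> y\<bar> \<partial>lborel))"
      if \<beta>: "\<beta> \<in> M" for \<beta>
    proof -
      have [measurable]: "\<rho> \<beta> \<in> borel_measurable borel" by (rule \<rho>[OF \<beta>])
      define F where "F z x y = ennreal (?b x * \<bar>\<rho> \<beta> y\<bar>) * ennreal (w (fst z - (y -
          x)) * \<bar>g z\<bar>)" for z :: "'n phase" and x y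
      have Fm [measurable]: "(\<lambda>(z, x). \<integral>\<^sup>+y. F z x y \<partial>lborel) \<in>
          borel_measurable (lborel \<Otimes>\<^sub>M lborel)"
        "(\<lambda>(z, y). F z x y) \<in> borel_measurable (lborel \<Otimes>\<^sub>M lborel)" for x
        unfolding F_def by measurable
      have "I \<beta> (fst z) * ennreal \<bar>g z\<bar> = (\<integral>\<^sup>+x. \<integral>\<^sup>+y. F z
          x y \<partial>lborel \<partial>lborel)" for z
      proof -
        have "I \<beta> (fst z) * ennreal \<bar>g z\<bar> = (\<integral>\<^sup>+x. (\<integral>\<^sup>+y.
            ennreal (?b x * \<bar>\<rho> \<beta> y\<bar> * w (fst z - (y - x))) \<partial>lborel) * ennreal
                \<bar>g z\<bar> \<partial>lborel)"
          unfolding I_def by (rule nn_integral_multc[symmetric]) measurable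
        also have "\<dots> = (\<integral>\<^sup>+x. \<integral>\<^sup>+y. ennreal (?b x * \<bar>\<rho>
            \<beta> y\<bar> * w (fst z - (y - x))) * ennreal \<bar>g z\<bar> \<partial>lborel
                \<partial>lborel)"
          by (intro nn_integral_cong nn_integral_multc[symmetric]) measurable
        also have "\<dots> = (\<integral>\<^sup>+x. \<integral>\<^sup>+y. F z x y \<partial>lborel
            \<partial>lborel)"
          unfolding F_def by (intro nn_integral_cong) (simp add: ennreal_mult bump_nonneg w0 mult.assoc)
        finally show ?thesis .
      qed
      then have "(\<integral>\<^sup>+z. I \<beta> (fst z) * ennreal \<bar>g z\<bar> \<partial>lborel) =
          (\<integral>\<^sup>+z. \<integral>\<^sup>+x. \<integral>\<^sup>+y. F z x y \<partial>lborel
              \<partial>lborel \<partial>lborel)" by simp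
      also have "\<dots> = (\<integral>\<^sup>+x. \<integral>\<^sup>+z. \<integral>\<^sup>+y. F z x y
          \<partial>lborel \<partial>lborel \<partial>lborel)"
        by (rule lborel_pair.Fubini'[symmetric]) measurable
      also have "\<dots> = (\<integral>\<^sup>+x. \<integral>\<^sup>+y. \<integral>\<^sup>+z. F z x y
          \<partial>lborel \<partial>lborel \<partial>lborel)"
        by (intro nn_integral_cong lborel_pair.Fubini'[symmetric]) measurable
      also have "\<dots> \<le> (\<integral>\<^sup>+x. \<integral>\<^sup>+y. ennreal (?b x) * (ennreal
          \<bar>\<rho> \<beta> y\<bar> * S) \<partial>lborel \<partial>lborel)"
      proof (rule nn_integral_mono, rule nn_integral_mono)
        fix x y :: "(real, 'n) vec"
        have "(\<integral>\<^sup>+z. F z x y \<partial>lborel) = ennreal (?b x * \<bar>\<rho> \<beta>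
            y\<bar>) * (\<integral>\<^sup>+z. ennreal (w (fst z - (y - x)) * \<bar>g z\<bar>)
                \<partial>lborel)"
          unfolding F_def by (rule nn_integral_cmult) measurable
        also have "\<dots> \<le> ennreal (?b x * \<bar>\<rho> \<beta> y\<bar>) * S" by (intro
            mult_left_mono S) auto
        also have "\<dots> = ennreal (?b x) * (ennreal \<bar>\<rho> \<beta> y\<bar> * S)"
          using bump_nonneg[of m "\<delta> j" x] by (simp add: ennreal_mult mult.assoc)
        finally show "(\<integral>\<^sup>+z. F z x y \<partial>lborel) \<le> ennreal (?b x) * (ennreal
            \<bar>\<rho> \<beta> y\<bar> * S)" .
      qed
      also have "\<dots> = (\<integral>\<^sup>+x. ennreal (?b x) * ((\<integral>\<^sup>+y. ennreal
          \<bar>\<rho> \<beta> y\<bar> \<partial>lborel) * S) \<partial>lborel)"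
        by (subst nn_integral_cmult, measurable, subst nn_integral_multc, measurable)
      also have "\<dots> = ennreal (c j) * ((\<integral>\<^sup>+y. ennreal \<bar>\<rho> \<beta> y\<bar>
          \<partial>lborel) * S)"
        unfolding cb[symmetric] by (rule nn_integral_multc) measurable
      finally show ?thesis by (simp add: mult.commute)
    qed
    have "ennreal \<bar>H j a\<bar> \<le> ennreal (1 / c j) * (C * (\<Sum>\<beta>\<in>M. I \<beta> a))" for
        a
    proof -
      have "ennreal \<bar>\<integral>x. h x * ?b (x - a) \<partial>lborel\<bar>
          \<le> C * (\<Sum>\<beta>\<in>M. \<integral>\<^sup>+x. \<integral>\<^sup>+y. ennreal (\<bar>?b (x
              - a)\<bar> * \<bar>\<rho> \<beta> y\<bar> * w (x - y)) \<partial>lborel \<partial>lborel)"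
      proof (rule weak[where R = "norm a + \<delta> j"])
        show "CE m (\<lambda>x. ?b (x - a))" by (rule CE_bump)
        show "\<forall>x. norm a + \<delta> j < norm x \<longrightarrow> ?b (x - a) = 0"
        proof (intro allI impI)
          fix x :: "(real, 'n) vec" assume "norm a + \<delta> j < norm x"
          then show "?b (x - a) = 0"
            using norm_triangle_sub[of x a] \<delta>(1)[of j] by (intro bump_eq_0) auto
        qed
      qed
      also have "(\<Sum>\<beta>\<in>M. \<integral>\<^sup>+x. \<integral>\<^sup>+y. ennreal (\<bar>?b (x -
          a)\<bar> * \<bar>\<rho> \<beta> y\<bar> * w (x - y)) \<partial>lborel \<partial>lborel) =
              (\<Sum>\<beta>\<in>M. I \<beta> a)"
      proof (rule sum.cong[OF refl])
        fix \<beta> assume "\<beta> \<in> M"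
        then have [measurable]: "\<rho> \<beta> \<in> borel_measurable borel" by (rule \<rho>)
        have "(\<integral>\<^sup>+x. \<integral>\<^sup>+y. ennreal (\<bar>?b (x - a)\<bar> * \<bar>\<rho>
            \<beta> y\<bar> * w (x - y)) \<partial>lborel \<partial>lborel)
            = (\<integral>\<^sup>+x. \<integral>\<^sup>+y. ennreal (\<bar>?b (x + a - a)\<bar> *
                \<bar>\<rho> \<beta> y\<bar> * w (x + a - y)) \<partial>lborel \<partial>lborel)"
          by (rule nn_integral_lborel_translate[where F = "\<lambda>x. \<integral>\<^sup>+y. ennreal
              (\<bar>?b (x - a)\<bar> * \<bar>\<rho> \<beta> y\<bar> * w (x - y)) \<partial>lborel",
                  symmetric]) measurable
        also have "\<dots> = I \<beta> a" unfolding I_def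
          by (intro nn_integral_cong) (simp add: bump_nonneg algebra_simps)
        finally show "(\<integral>\<^sup>+x. \<integral>\<^sup>+y. ennreal (\<bar>?b (x - a)\<bar> *
            \<bar>\<rho> \<beta> y\<bar> * w (x - y)) \<partial>lborel \<partial>lborel) = I \<beta> a" .
      qed
      finally have "ennreal (1 / c j) * ennreal \<bar>\<integral>x. h x * ?b (x - a) \<partial>lborel\<bar>
          \<le> ennreal (1 / c j) * (C * (\<Sum>\<beta>\<in>M. I \<beta> a))"
        by (rule mult_left_mono) simp
      moreover have "ennreal \<bar>H j a\<bar> = ennreal (1 / c j) * ennreal \<bar>\<integral>x. h x * ?b
          (x - a) \<partial>lborel\<bar>"
        using c[of j] by (simp add: H_def ennreal_mult[symmetric])
      ultimately show ?thesis by simp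
    qed
    then have "(\<integral>\<^sup>+z. ennreal \<bar>H j (fst z) * g z\<bar> \<partial>lborel) \<le>
        (\<integral>\<^sup>+z. ennreal (1 / c j) * (C * (\<Sum>\<beta>\<in>M. I \<beta> (fst z) * ennreal
            \<bar>g z\<bar>)) \<partial>lborel)"
      by (intro nn_integral_mono) (simp add: abs_mult ennreal_mult sum_distrib_right[symmetric]
          mult.assoc[symmetric] mult_right_mono)
    also have "\<dots> = ennreal (1 / c j) * (C * (\<Sum>\<beta>\<in>M. \<integral>\<^sup>+z. I \<beta>
        (fst z) * ennreal \<bar>g z\<bar> \<partial>lborel))"
    proof -
      have m: "(\<lambda>z. I \<beta> (fst z) * ennreal \<bar>g z\<bar>) \<in> borel_measurable lborel" if
          "\<beta> \<in> M" for \<beta>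
        using Im[OF that] by measurable
      show ?thesis
        using m by (subst nn_integral_cmult, measurable, subst nn_integral_cmult, measurable) (simp add:
            nn_integral_sum)
    qed
    also have "\<dots> \<le> ennreal (1 / c j) * (C * (\<Sum>\<beta>\<in>M. ennreal (c j) * (S *
        (\<integral>\<^sup>+y. ennreal \<bar>\<rho> \<beta> y\<bar> \<partial>lborel))))"
      by (intro mult_left_mono sum_mono Ig) auto
    also have "\<dots> = (ennreal (1 / c j) * ennreal (c j)) * (C * (S * P))"
      by (simp add: P_def sum_distrib_left mult_ac)
    also have "ennreal (1 / c j) * ennreal (c j) = 1" using c[of j] by (simp add: ennreal_mult[symmetric])
    finally show ?thesis by simp
  qed
  have "liminf (\<lambda>j. ennreal \<bar>H j (fst z) * g z\<bar>) = ennreal \<bar>h (fst z) * g z\<bar>"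
      for z
  proof (rule lim_imp_Liminf)
    show "(\<lambda>j. ennreal \<bar>H j (fst z) * g z\<bar>) \<longlonglongrightarrow> ennreal \<bar>h
        (fst z) * g z\<bar>"
      by (intro tendsto_ennrealI tendsto_rabs tendsto_mult Hlim tendsto_const)
  qed simp
  then have "(\<integral>\<^sup>+z. ennreal \<bar>h (fst z) * g z\<bar> \<partial>lborel) =
      (\<integral>\<^sup>+z. liminf (\<lambda>j. ennreal \<bar>H j (fst z) * g z\<bar>) \<partial>lborel)"
          by simp
  also have "\<dots> \<le> liminf (\<lambda>j. \<integral>\<^sup>+z. ennreal \<bar>H j (fst z) * g z\<bar>
      \<partial>lborel)"
    by (intro nn_integral_liminf) measurable
  also have "\<dots> \<le> liminf (\<lambda>j::nat. C * (S * P))" by (intro Liminf_mono always_eventually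
      allI step)
  also have "\<dots> = C * (S * P)" by (simp add: Liminf_const)
  finally show ?thesis by (simp add: P_def)
qed

section \<open>The bootstrap setting at a fixed time\<close>

lemma Basis_phase: "b \<in> (Basis :: 'n::finite phase set) \<Longrightarrow> \<exists>i. b = (axis i 1, 0)
    \<or> b = (0, axis i 1)"
  by (auto simp: Basis_prod_def Basis_vec_def)

lemma has_pd_imp_has_dd: "has_pd i h x \<Longrightarrow> has_dd (axis i 1) h (pd i h x) x"
  by (simp add: has_pd_def has_dd_def pd_def DERIV_deriv_iff_field_differentiable)

lemma has_dd_phase:
  assumes "has_pd i (\<lambda>y. g t y (snd z)) (fst z)" 
  shows "has_dd (axis i 1, 0) (\<lambda>z. g t (fst z) (snd z)) (dd (axis i 1, 0) (\<lambda>z. g t (fst z)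
      (snd z)) z) z"
  using assms by (simp add: has_pd_def has_dd_def dd_def DERIV_deriv_iff_field_differentiable)

lemma has_dd_phase':
  assumes "has_pd i (\<lambda>w. g t (fst z) w) (snd z)" 
  shows "has_dd (0, axis i 1) (\<lambda>z. g t (fst z) (snd z)) (dd (0, axis i 1) (\<lambda>z. g t (fst z)
      (snd z)) z) z"
  using assms by (simp add: has_pd_def has_dd_def dd_def DERIV_deriv_iff_field_differentiable)

lemma Ck_imp_CE:
  fixes g :: "'n::finite kin"
  assumes "Ck k T g" "t \<in> {0..T}"
  shows "CE k (\<lambda>z. g t (fst z) (snd z))"
  using assms
proof (induction k arbitrary: g)
  have c: "continuous_on UNIV (\<lambda>z. g t (fst z) (snd z))"
    if "continuous_on ({0..T} \<times> UNIV) (\<lambda>(t, x, v). g t x v)" "t \<in> {0..T}" for g :: "'n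
        kin"
  proof -
    have "continuous_on UNIV (\<lambda>z. (\<lambda>(t, x, v). g t x v) (t, fst z, snd z))"
      by (rule continuous_on_compose2[OF that(1)]) (use that(2) in \<open>auto intro!:
          continuous_intros\<close>)
    then show ?thesis by (simp add: case_prod_beta')
  qed
  {
    case 0
    then show ?case using c by simp
  next
    case (Suc k)
    let ?G = "\<lambda>z. g t (fst z) (snd z)"
    show ?case
    proof (rule CE_SucI[where h' = "\<lambda>b. dd b ?G"])
      show "continuous_on UNIV ?G" using Suc.prems by (intro c) auto
      show "has_dd b ?G (dd b ?G z) z" if "b \<in> Basis" for b z
        using Basis_phase[OF that] Suc.prems has_dd_phase[of _ g t z] has_dd_phase'[of _ g t z] by auto
      show "CE k (dd b ?G)" if b: "b \<in> Basis" for b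
      proof -
        obtain i where "b = (axis i 1, 0) \<or> b = (0, axis i 1)" using Basis_phase[OF b] by blast
        then have "dd b ?G = (\<lambda>z. dx i g t (fst z) (snd z)) \<or> dd b ?G = (\<lambda>z. dv i g t
            (fst z) (snd z))"
          by (auto simp: dx_eq_dd dv_eq_dd)
        moreover have "CE k (\<lambda>z. dx i g t (fst z) (snd z))" "CE k (\<lambda>z. dv i g t (fst z)
            (snd z))"
          using Suc.prems by (auto intro!: Suc.IH)
        ultimately show ?thesis by auto
      qed
    qed
  }
qed

lemma Ck_imp_CE_field:
  fixes \<phi> :: "'n::finite fld"
  assumes "Ck k T (\<lambda>t x v. \<phi> t x)" "t \<in> {0..T}"
  shows "CE k (\<phi> t)"
  using assms
proof (induction k arbitrary: \<phi>)
  have c: "continuous_on UNIV (\<phi> t)"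
    if "continuous_on ({0..T} \<times> UNIV) (\<lambda>(t, x, v :: (real, 'n) vec). \<phi> t x)" "t \<in>
        {0..T}" for \<phi> :: "'n fld"
  proof -
    have "continuous_on UNIV (\<lambda>x. (\<lambda>(t, x, v :: (real, 'n) vec). \<phi> t x) (t, x, 0))"
      by (rule continuous_on_compose2[OF that(1)]) (use that(2) in \<open>auto intro!:
          continuous_intros\<close>)
    then show ?thesis by simp
  qed
  {
    case 0
    then show ?case using c by simp
  next
    case (Suc k)
    have d: "dx i (\<lambda>t x v. \<phi> t x) = (\<lambda>t x v. dX i \<phi> t x)" for i by (simp add:
        dx_def dX_def fun_eq_iff)
    have p: "has_pd i (\<phi> t) x" for i x using Suc.prems by auto
    show ?case
    proof (rule CE_SucI[where h' = "\<lambda>b. dd b (\<phi> t)"])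
      show "continuous_on UNIV (\<phi> t)" using Suc.prems by (intro c) auto
      show "has_dd b (\<phi> t) (dd b (\<phi> t) x) x" if "b \<in> Basis" for b x
        using that has_pd_imp_has_dd[OF p] by (auto simp: Basis_vec_def pd_eq_dd)
      show "CE k (dd b (\<phi> t))" if b0: "b \<in> Basis" for b
      proof -
        obtain i where b: "b = axis i 1" using b0 by (auto simp: Basis_vec_def)
        have "CE k (dX i \<phi> t)" using Suc.prems by (intro Suc.IH) (auto simp: d[symmetric])
        then show ?thesis by (simp add: b dX_def[abs_def] pd_eq_dd)
      qed
    qed
  }
qed

lemma CE_Zs: "CE (length \<beta> + m) (\<lambda>z. f t (fst z) (snd z)) \<Longrightarrow> CE m (\<lambda>z.
    Zs \<beta> f t (fst z) (snd z))"
proof (induction \<beta> arbitrary: m)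
  case (Cons a \<beta>)
  have "CE (Suc m) (\<lambda>z. Zs \<beta> f t (fst z) (snd z))" using Cons.prems by (intro Cons.IH) (simp
      del: CE.simps)
  from CE_Z[where g = "Zs \<beta> f", OF this] show ?case by (simp add: Zs_def)
qed (simp add: Zs_def)

lemma Ys_Cons: "Ys co (a # \<alpha>) f = Y co a (Ys co \<alpha> f)"
  by (simp add: Ys_def)

lemma CE_Ys:
  fixes f :: "'n::{finite,linorder} kin"
  assumes f: "CE N (\<lambda>z. f t (fst z) (snd z))"
    and co: "\<And>a k. a \<in> vfs \<Longrightarrow> CE (N - 1) (\<lambda>z. co a k t (fst z) (snd z))"
    and \<alpha>: "set \<alpha> \<subseteq> vfs" "length \<alpha> + m \<le> N"
  shows "CE m (\<lambda>z. Ys co \<alpha> f t (fst z) (snd z))"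
  using \<alpha>
proof (induction \<alpha> arbitrary: m)
  case Nil
  then show ?case using CE_le[OF f] by (simp add: Ys_def del: CE.simps)
next
  case (Cons a \<alpha>)
  let ?G = "\<lambda>z. Ys co \<alpha> f t (fst z) (snd z)"
  have G: "CE (Suc m) ?G" using Cons.prems by (intro Cons.IH) auto
  have c: "CE m (\<lambda>z. co a k t (fst z) (snd z))" for k
    using Cons.prems by (intro CE_le[OF co]) auto
  have "CE m (\<lambda>z. Z a (Ys co \<alpha> f) t (fst z) (snd z) - (\<Sum>k\<in>UNIV. co a k t (fst z)
      (snd z) * dd (axis k 1, 0) ?G z))"
    by (intro CE_diff CE_sum CE_mult c CE_dd[OF G] axis_fst_Basis CE_Z[where g = "Ys co \<alpha> f", OF G])
  then show ?case unfolding Ys_Cons Y_def by (simp add: dx_eq_dd del: CE.simps)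
qed

lemma one_plus_ln_le: "1 \<le> s \<Longrightarrow> 1 + ln s \<le> 2 * sqrt s"
  using ln_le_minus_one[of "sqrt s"] by (simp add: ln_sqrt)

lemma rho_measurable:
  assumes "CE 0 (\<lambda>z. g t (fst z) (snd z))"
  shows "rho g t \<in> borel_measurable borel"
proof -
  have [measurable]: "(\<lambda>z. g t (fst z) (snd z)) \<in> borel_measurable borel"
    using CE_continuous[OF assms] by (rule borel_measurable_continuous_onI)
  have "(\<lambda>(x, v). g t x v) \<in> borel_measurable (borel \<Otimes>\<^sub>M borel)"
    by (simp add: borel_prod case_prod_beta')
  then have "(\<lambda>(x, v). g t x v) \<in> borel_measurable (borel \<Otimes>\<^sub>M lborel)"
    by (simp cong: measurable_cong_sets sets_pair_measure_cong)
  then show ?thesis unfolding rho_def by (rule lborel.borel_measurable_lebesgue_integral)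
qed

lemma L1_xv_eq: "L1_xv h = (\<integral>\<^sup>+z. ennreal \<bar>h (fst z) (snd z)\<bar> \<partial>lborel)"
  by (simp add: L1_xv_def case_prod_beta')

lemma bootstrap_modified_family:
  fixes f :: "'n::{finite,linorder} kin"
  assumes sys: "CARD('n) \<le> 3" "CARD('n) \<ge> 2" and N: "N \<ge> 2 * CARD('n) + 3"
    and \<epsilon>: "0 < \<epsilon>" "\<bar>C0\<bar> * sqrt \<epsilon> \<le> 1 / 108" and t: "t \<in>
        {0..T}"
    and f: "Ck N T f" and co: "modified_coefficients N \<mu> T \<phi> co" and boot: "bootstrap N C0
        \<epsilon> T f \<phi> co"
  shows "modified_family (\<lambda>\<alpha> z. Ys co \<alpha> f t (fst z) (snd z)) (\<lambda>i k z. co (Gal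
      i) k t (fst z) (snd z)) N (1 + t)
     (\<bar>C0\<bar> * sqrt \<epsilon> * (1 + ln (1 + t))) (\<bar>C0\<bar> * sqrt \<epsilon>) \<epsilon>"
proof
  have t0: "0 \<le> t" using t by simp
  have fN: "CE N (\<lambda>z. f t (fst z) (snd z))" by (rule Ck_imp_CE[OF f t])
  have coT: "co (Trans i) k t x v = 0" for i k x v
    using co t unfolding modified_coefficients_def by blast
  have coN: "CE (N - 1) (\<lambda>z. co a k t (fst z) (snd z))" if a: "a \<in> vfs" for a k
  proof (cases "a \<in> range Trans")
    case True
    then show ?thesis using coT by (auto intro: CE_const)
  next
    case False
    then have "Ck (N - 1) T (co a k)" using co a unfolding modified_coefficients_def by blast
    then show ?thesis by (rule Ck_imp_CE[OF _ t])
  qed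
  have en: "energy N co f t \<le> ennreal (2 * \<epsilon>)"
    and B2: "\<And>\<alpha> g x v. \<alpha> \<in> multi_indices (N - CARD('n) - 2) \<Longrightarrow> g
        \<in> coefficient_set co \<Longrightarrow>
      \<bar>Ys co \<alpha> g t x v\<bar> \<le> C0 * sqrt \<epsilon> * (1 + ln (1 + t))"
    and B3: "\<And>\<alpha> g x v. \<alpha> \<in> multi_indices (N - CARD('n) - 3) \<Longrightarrow> g
        \<in> coefficient_set co \<Longrightarrow>
      norm (\<chi> j. Ys co \<alpha> (dx j g) t x v) \<le> C0 * sqrt \<epsilon>"
    using boot t unfolding bootstrap_def by blast+
  have Gal: "Gal i \<in> vfs" for i :: 'n by (simp add: vfs_def)
  have coS: "co (Gal i) k \<in> coefficient_set co" for i k using Gal unfolding coefficient_set_def by blast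
  have C0: "C0 * sqrt \<epsilon> \<le> \<bar>C0\<bar> * sqrt \<epsilon>" using \<epsilon> by (intro
      mult_right_mono) auto
  have ln0: "0 \<le> 1 + ln (1 + t)" using t0 by (simp add: add_nonneg_nonneg)
  show L1: "(\<integral>\<^sup>+z. ennreal \<bar>Ys co \<alpha> f t (fst z) (snd z)\<bar> \<partial>lborel)
      \<le> ennreal (2 * \<epsilon>)"
    if \<alpha>: "\<alpha> \<in> multi_indices N" for \<alpha>
  proof -
    have "L1_xv (Ys co \<alpha> f t) \<le> energy N co f t"
      unfolding energy_def by (rule member_le_sum[OF \<alpha>]) (auto simp: finite_multi_indices)
    with en show ?thesis unfolding L1_xv_eq by (rule order_trans[rotated])
  qed
  have Gm: "CE m (\<lambda>z. Ys co \<alpha> f t (fst z) (snd z))" if "\<alpha> \<in> multi_indices N"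
      "length \<alpha> + m \<le> N" for \<alpha> m
    by (rule CE_Ys[where co = co and N = N and f = f and t = t, OF fN coN]) (use that in \<open>auto simp:
        multi_indices_def\<close>)
  show "CE 1 (\<lambda>z. Ys co \<alpha> f t (fst z) (snd z))" if "\<alpha> \<in> multi_indices N" "length
      \<alpha> < N" for \<alpha>
    using that by (intro Gm) auto
  show "integrable lborel (\<lambda>z. Ys co \<alpha> f t (fst z) (snd z))" if \<alpha>: "\<alpha> \<in>
      multi_indices N" for \<alpha>
  proof (rule integrableI_bounded)
    have "CE 0 (\<lambda>z. Ys co \<alpha> f t (fst z) (snd z))" using \<alpha> by (intro Gm) (auto simp:
        multi_indices_def)
    from borel_measurable_continuous_onI[OF CE_continuous[OF this]]
    show "(\<lambda>z. Ys co \<alpha> f t (fst z) (snd z)) \<in> borel_measurable lborel" by simp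
    show "(\<integral>\<^sup>+z. ennreal (norm (Ys co \<alpha> f t (fst z) (snd z))) \<partial>lborel) <
        \<infinity>"
      using L1[OF \<alpha>] by (simp add: le_less_trans)
  qed
  show "(1 + t) * dd (axis i 1, 0) (\<lambda>z. Ys co \<alpha> f t (fst z) (snd z)) z
      + dd (0, axis i 1) (\<lambda>z. Ys co \<alpha> f t (fst z) (snd z)) z
      - (\<Sum>k\<in>UNIV. co (Gal i) k t (fst z) (snd z) * dd (axis k 1, 0) (\<lambda>z. Ys co \<alpha> f
          t (fst z) (snd z)) z)
      = Ys co (Trans i # \<alpha>) f t (fst z) (snd z) + Ys co (Gal i # \<alpha>) f t (fst z) (snd z)" for
          \<alpha> i z
    unfolding Ys_Cons Y_def by (simp add: coT dx_eq_dd dv_eq_dd distrib_right)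
  show "CE 1 (\<lambda>z. co (Gal i) k t (fst z) (snd z))" for i k
    using N sys by (intro CE_le[OF coN[OF Gal]]) auto
  show "\<bar>co (Gal i) k t (fst z) (snd z)\<bar> \<le> \<bar>C0\<bar> * sqrt \<epsilon> * (1 + ln (1 +
      t))" for i k z
  proof -
    have "\<bar>co (Gal i) k t (fst z) (snd z)\<bar> \<le> C0 * sqrt \<epsilon> * (1 + ln (1 + t))"
      using B2[OF Nil_multi coS, of i k "fst z" "snd z"] by (simp add: Ys_def)
    also have "\<dots> \<le> \<bar>C0\<bar> * sqrt \<epsilon> * (1 + ln (1 + t))" using C0 ln0 by (rule
        mult_right_mono)
    finally show ?thesis .
  qed
  show "\<bar>dd (axis k 1, 0) (\<lambda>z. co (Gal i) j t (fst z) (snd z)) z\<bar> \<le> \<bar>C0\<bar> *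
      sqrt \<epsilon>" for i j k z
  proof -
    have "\<bar>dx k (co (Gal i) j) t (fst z) (snd z)\<bar> \<le> norm (\<chi> k. dx k (co (Gal i) j) t
        (fst z) (snd z))"
      using component_le_norm_cart[of "\<chi> k. dx k (co (Gal i) j) t (fst z) (snd z)" k] by simp
    also have "\<dots> \<le> C0 * sqrt \<epsilon>" using B3[OF Nil_multi coS, of i j "fst z" "snd z"] by
        (simp add: Ys_def)
    finally show ?thesis using C0 by (simp add: dx_eq_dd)
  qed
  show "\<bar>C0\<bar> * sqrt \<epsilon> \<le> 1 / 9" using \<epsilon>(2) by simp
  show "\<bar>C0\<bar> * sqrt \<epsilon> * (1 + ln (1 + t)) \<le> sqrt (1 + t) / 54"
  proof -
    have "\<bar>C0\<bar> * sqrt \<epsilon> * (1 + ln (1 + t)) \<le> 1 / 108 * (2 * sqrt (1 + t))"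
      using \<epsilon>(2) ln0 t0 by (intro mult_mono one_plus_ln_le) auto
    then show ?thesis by simp
  qed
qed (use sys \<epsilon> t in auto)

theorem lemma4p5:
  fixes sys :: vlasov_system and N :: nat and C0 :: real
  assumes "(sys = Vlasov_Poisson \<and> CARD('n::{finite,linorder}) = 3) \<or>
           (sys = Vlasov_Yukawa \<and> CARD('n) = 2)"
    and "N \<ge> 2 * CARD('n) + 3"
  shows "\<exists>C>0. \<exists>\<epsilon>0>0. \<forall>\<epsilon> \<mu> T. \<forall>f :: 'n kin. \<forall>\<phi> :: 'n fld. \<forall>co.
           0 < \<epsilon> \<longrightarrow> \<epsilon> \<le> \<epsilon>0 \<longrightarrow> \<mu> \<in> {1, -1} \<longrightarrow> 0 < T \<longrightarrow>
           smooth_solution sys N \<mu> T f \<phi> \<longrightarrow>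
           modified_coefficients N \<mu> T \<phi> co \<longrightarrow>
           bootstrap N C0 \<epsilon> T f \<phi> co \<longrightarrow>
           (\<forall>\<gamma>\<in>multi_indices N. \<forall>\<alpha>\<in>multi_indices (N - CARD('n)). \<forall>t\<in>{0..T}.
              L1_xv (\<lambda>x v. norm (grad (ZXs \<gamma> \<phi>) t x) * Ys co \<alpha> f t x v)
              \<le> ennreal C * (\<Sum>\<beta>\<in>multi_indices (length \<gamma>).
                   ennreal (\<epsilon> / (1 + t)\<^sup>2) * L1_x (rho (Zs \<beta> f) t)))"
proof -
  have dim: "CARD('n) \<le> 3" "CARD('n) \<ge> 2" using assms(1) by auto
  obtain \<nu> Cw where \<nu>: "\<nu> \<in> borel_measurable borel" "\<forall>\<mu>. 0 \<le> \<nu> \<mu>"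
    "\<forall>z :: (real, 'n) vec. z \<noteq> 0 \<longrightarrow> (\<integral>\<^sup>+\<mu>. ennreal (\<nu>
        \<mu> * ek (exp \<mu>) 0 z) \<partial>lborel) = ennreal (- green sys z)"
    "\<forall>z :: (real, 'n) vec. green sys z \<le> 0"
    "(\<integral>\<^sup>+\<mu>. ennreal (\<nu> \<mu> * min 1 (exp (- (real CARD('n) * \<mu> / 2))))
        \<partial>lborel) < \<infinity>"
    "\<forall>z :: (real, 'n) vec. z \<noteq> 0 \<longrightarrow>
       (\<integral>\<^sup>+\<mu>. ennreal (\<nu> \<mu> * (exp \<mu> * norm z * exp (- (exp \<mu> * (z
           \<bullet> z)) / 2))) \<partial>lborel) \<le> ennreal (Cw * wt sys z)" "0 \<le> Cw"
    using green_superposition[OF assms(1)] by blast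
  define Q where "Q m C \<longleftrightarrow> (\<forall>(\<gamma> :: 'n vf list) (f :: 'n kin) (\<phi> ::
      'n fld) t R \<zeta> k. length \<gamma> = m \<longrightarrow> set \<gamma> \<subseteq> vfs
          \<longrightarrow> adm m f t \<longrightarrow>
     CE (Suc m) (\<phi> t) \<longrightarrow> CE (Suc m) \<zeta> \<longrightarrow> (\<forall>x. R < norm x
         \<longrightarrow> \<zeta> x = 0) \<longrightarrow>
     (\<forall>x. (\<integral>y. green sys (x - y) * rho f t y \<partial>lborel) = \<phi> t x)
         \<longrightarrow>
     ennreal \<bar>\<integral>x. ZXs (Trans k # \<gamma>) \<phi> t x * \<zeta> x \<partial>lborel\<bar>
       \<le> ennreal C * (\<Sum>\<beta>\<in>multi_indices m. \<integral>\<^sup>+x. \<integral>\<^sup>+y.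
           ennreal (\<bar>\<zeta> x\<bar> * \<bar>rho (Zs \<beta> f) t y\<bar> * wt sys (x - y))
               \<partial>lborel \<partial>lborel))" for m C
  have "\<exists>C\<ge>0. Q m C" for m
    unfolding Q_def
  proof (rule weak_estimate[OF \<nu>(1) _ _ _ green_measurable \<nu>(5) _ \<nu>(7)])
    show "0 \<le> \<nu> \<mu>" for \<mu> using \<nu>(2) by blast
    show "(\<integral>\<^sup>+\<mu>. ennreal (\<nu> \<mu> * ek (exp \<mu>) 0 z) \<partial>lborel) = ennreal
        (- green sys z)" if "z \<noteq> 0" for z :: "(real, 'n) vec"
      using \<nu>(3) that by blast
    show "green sys z \<le> 0" for z :: "(real, 'n) vec" using \<nu>(4) by blast
    show "(\<integral>\<^sup>+\<mu>. ennreal (\<nu> \<mu> * (exp \<mu> * norm z * exp (- (exp \<mu> * (z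
        \<bullet> z)) / 2))) \<partial>lborel) \<le> ennreal (Cw * wt sys z)"
      if "z \<noteq> 0" for z :: "(real, 'n) vec" using \<nu>(6) that by blast
  qed
  then obtain D where D0: "\<And>m. 0 \<le> D m" and DQ: "\<And>m. Q m (D m)" by metis
  note D = DQ[unfolded Q_def, rule_format]
  define n where "n = real CARD('n)"
  define C where "C = 1 + (\<Sum>m\<le>N. n * (D m * 812))"
  have n0: "0 \<le> n" by (simp add: n_def)
  have C: "0 < C" "\<And>m. m \<le> N \<Longrightarrow> n * (D m * 812) \<le> C"
  proof -
    have "0 \<le> (\<Sum>m\<le>N. n * (D m * 812))" using D0 n0 by (intro sum_nonneg) auto
    then show "0 < C" by (simp add: C_def)
    show "n * (D m * 812) \<le> C" if "m \<le> N" for m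
      using member_le_sum[of m "{..N}" "\<lambda>m. n * (D m * 812)"] that D0 n0 by (simp add: C_def)
  qed
  define \<epsilon>0 where "\<epsilon>0 = (1 / (108 * (\<bar>C0\<bar> + 1)))\<^sup>2"
  have \<epsilon>0: "0 < \<epsilon>0" by (simp add: \<epsilon>0_def add_nonneg_pos)
  have small: "\<bar>C0\<bar> * sqrt \<epsilon> \<le> 1 / 108" if "0 < \<epsilon>" "\<epsilon> \<le>
      \<epsilon>0" for \<epsilon>
  proof -
    have "sqrt \<epsilon> \<le> 1 / (108 * (\<bar>C0\<bar> + 1))"
      using real_sqrt_le_mono[OF that(2)] by (simp add: \<epsilon>0_def)
    then have "\<bar>C0\<bar> * sqrt \<epsilon> \<le> (\<bar>C0\<bar> + 1) * (1 / (108 * (\<bar>C0\<bar> +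
        1)))"
      using that by (intro mult_mono) auto
    also have "\<dots> = 1 / 108" by (simp add: add_nonneg_eq_0_iff)
    finally show ?thesis .
  qed
  show ?thesis
  proof (rule exI[of _ C], rule conjI[OF C(1)], rule exI[of _ \<epsilon>0], rule conjI[OF \<epsilon>0],
      intro allI impI ballI)
    fix \<epsilon> \<mu> T :: real and f :: "'n kin" and \<phi> :: "'n fld" and co and \<gamma> \<alpha> ::
        "'n vf list" and t :: real
    assume \<epsilon>: "0 < \<epsilon>" "\<epsilon> \<le> \<epsilon>0" and sol: "smooth_solution sys N
        \<mu> T f \<phi>"
      and co: "modified_coefficients N \<mu> T \<phi> co" and boot: "bootstrap N C0 \<epsilon> T f \<phi>
          co"
      and \<gamma>: "\<gamma> \<in> multi_indices N" and \<alpha>: "\<alpha> \<in> multi_indices (N -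
          CARD('n))" and t: "t \<in> {0..T}"
    let ?m = "length \<gamma>" and ?s = "1 + t"
    define M :: "'n vf list set" where "M = multi_indices ?m"
    define \<rho> where "\<rho> \<beta> = rho (Zs \<beta> f) t" for \<beta>
    have e0: "0 < \<epsilon> / ?s\<^sup>2" using \<epsilon> t by (simp add: zero_less_power)
    show "L1_xv (\<lambda>x v. norm (grad (ZXs \<gamma> \<phi>) t x) * Ys co \<alpha> f t x v)
              \<le> ennreal C * (\<Sum>\<beta>\<in>multi_indices (length \<gamma>).
                   ennreal (\<epsilon> / (1 + t)\<^sup>2) * L1_x (rho (Zs \<beta> f) t))"
    proof (cases "\<forall>\<beta>\<in>M. L1_x (\<rho> \<beta>) < \<infinity>")
      case False
      then obtain \<beta> where \<beta>: "\<beta> \<in> M" "L1_x (\<rho> \<beta>) = \<infinity>" by (auto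
          simp: not_less top.extremum_unique)
      have "ennreal (\<epsilon> / ?s\<^sup>2) \<noteq> 0" unfolding ennreal_eq_0_iff using e0 by linarith
      then have "\<infinity> = ennreal (\<epsilon> / ?s\<^sup>2) * L1_x (\<rho> \<beta>)" unfolding
          \<beta>(2) by (simp only: infinity_ennreal_def ennreal_mult_top if_False)
      also have "\<dots> \<le> (\<Sum>\<beta>\<in>M. ennreal (\<epsilon> / ?s\<^sup>2) * L1_x (\<rho>
          \<beta>))"
        by (rule member_le_sum[OF \<beta>(1)]) (auto simp: M_def finite_multi_indices)
      finally have "(\<Sum>\<beta>\<in>M. ennreal (\<epsilon> / ?s\<^sup>2) * L1_x (\<rho> \<beta>)) =
          \<infinity>" by (simp add: top.extremum_unique)
      then show ?thesis using C(1) unfolding M_def \<rho>_def by (simp add: ennreal_mult_top)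
    next
      case True
      have m: "?m \<le> N" "set \<gamma> \<subseteq> vfs" using \<gamma> by (auto simp: multi_indices_def)
      have MN: "\<beta> \<in> multi_indices N" "length \<beta> \<le> N" if "\<beta> \<in> M" for \<beta>
        using that m by (auto simp: M_def multi_indices_def)
      have fN: "Ck N T f" and \<phi>N: "Ck (N + 1) T (\<lambda>t x v. \<phi> t x)"
        and rep: "\<And>x. has_bochner_integral lborel (\<lambda>y. green sys (x - y) * rho f t y) (\<phi>
            t x)"
        and loc: "\<And>\<beta> R. \<beta> \<in> multi_indices N \<Longrightarrow> set_integrable lborel
            (cball 0 R \<times> UNIV) (\<lambda>(x, v). Zs \<beta> f t x v)"
        using sol t unfolding smooth_solution_def by blast+
      have fCE: "CE N (\<lambda>z. f t (fst z) (snd z))" by (rule Ck_imp_CE[OF fN t])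
      have \<phi>CE: "CE (Suc N) (\<phi> t)" using Ck_imp_CE_field[OF \<phi>N t] by (simp del: CE.simps)
      have \<rho>m: "\<rho> \<beta> \<in> borel_measurable borel" if "\<beta> \<in> M" for \<beta>
        unfolding \<rho>_def using MN[OF that] CE_le[OF fCE, of "length \<beta> + 0"]
        by (intro rho_measurable CE_Zs) simp
      have \<rho>i: "integrable lborel (\<rho> \<beta>)" if "\<beta> \<in> M" for \<beta>
        using \<rho>m[OF that] True that by (intro integrableI_bounded) (auto simp: L1_x_def)
      have adm: "adm ?m f t"
        unfolding adm_def
      proof (intro conjI ballI allI)
        show "CE ?m (\<lambda>z. f t (fst z) (snd z))" by (rule CE_le[OF fCE m(1)])
        fix \<beta> :: "'n vf list" assume "\<beta> \<in> multi_indices ?m"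
        then have \<beta>: "\<beta> \<in> M" by (simp add: M_def)
        show "integrable lborel (rho (Zs \<beta> f) t)" using \<rho>i[OF \<beta>] by (simp add: \<rho>_def)
        show "set_integrable lborel (cball 0 R \<times> UNIV) (\<lambda>z. Zs \<beta> f t (fst z) (snd z))"
            for R
          using loc[OF MN(1)[OF \<beta>], of R] by (simp add: case_prod_beta')
      qed
      interpret modified_family "\<lambda>\<alpha> z. Ys co \<alpha> f t (fst z) (snd z)" "\<lambda>i k z.
          co (Gal i) k t (fst z) (snd z)" N ?s
        "\<bar>C0\<bar> * sqrt \<epsilon> * (1 + ln ?s)" "\<bar>C0\<bar> * sqrt \<epsilon>" \<epsilon>
        by (rule bootstrap_modified_family[OF dim assms(2) \<epsilon>(1) small[OF \<epsilon>] t fN co boot])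
      have \<alpha>N: "\<alpha> \<in> multi_indices N" "Suc (length \<alpha>) < N"
        using \<alpha> dim assms(2) by (auto simp: multi_indices_def)
      let ?g = "\<lambda>z. Ys co \<alpha> f t (fst z) (snd z)"
      have gm [measurable]: "?g \<in> borel_measurable borel"
        using borel_measurable_integrable[OF G_int[OF \<alpha>N(1)]] by simp
      define P where "P = (\<Sum>\<beta>\<in>M. L1_x (\<rho> \<beta>))"
      have hc: "continuous_on UNIV (ZXs (Trans k # \<gamma>) \<phi> t)" for k
      proof -
        have sub: "set (Trans k # \<gamma>) \<subseteq> vfs" using m by (auto simp: vfs_def)
        have c: "CE (length (Trans k # \<gamma>)) (\<phi> t)" "CE (length (Trans k # \<gamma>) + 0) (\<phi>
            t)"
          using m(1) by (auto intro!: CE_le[OF \<phi>CE] simp del: CE.simps)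
        have "CE 0 (ZXs (Trans k # \<gamma>) \<phi> t)"
          using integral_ZXs_mult[where \<zeta> = "\<lambda>x. 0" and h = \<phi> and t = t, OF sub c(1)
              CE_const] c(2) by blast
        then show ?thesis by simp
      qed
      have comp: "(\<integral>\<^sup>+z. ennreal \<bar>ZXs (Trans k # \<gamma>) \<phi> t (fst z) * ?g
          z\<bar> \<partial>lborel)
          \<le> ennreal (D ?m) * (ennreal (812 * \<epsilon> / ?s\<^sup>2) * P)" for k
        unfolding P_def L1_x_def
      proof (rule mollified_product_bound[where m = "Suc ?m" and w = "wt sys"])
        show "continuous_on UNIV (ZXs (Trans k # \<gamma>) \<phi> t)" by (rule hc)
        show "?g \<in> borel_measurable borel" by (rule gm)
        show "(wt sys :: (real, 'n) vec \<Rightarrow> real) \<in> borel_measurable borel" by (rule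
            wt_measurable)
        show "0 \<le> wt sys x" for x :: "(real, 'n) vec" by (rule wt_nonneg)
        show "finite M" by (simp add: M_def finite_multi_indices)
        show "\<rho> \<beta> \<in> borel_measurable borel" if "\<beta> \<in> M" for \<beta> by (rule
            \<rho>m[OF that])
        show "(\<integral>\<^sup>+z. ennreal (wt sys (fst z - y) * \<bar>?g z\<bar>) \<partial>lborel)
            \<le> ennreal (812 * \<epsilon> / ?s\<^sup>2)" for y
          by (rule wt_L1[OF \<alpha>N assms(1)])
        show "ennreal \<bar>\<integral>x. ZXs (Trans k # \<gamma>) \<phi> t x * \<zeta> x
            \<partial>lborel\<bar>
          \<le> ennreal (D ?m) * (\<Sum>\<beta>\<in>M. \<integral>\<^sup>+x. \<integral>\<^sup>+y. ennreal
              (\<bar>\<zeta> x\<bar> * \<bar>\<rho> \<beta> y\<bar> * wt sys (x - y)) \<partial>lborel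
                  \<partial>lborel)"
          if "CE (Suc ?m) \<zeta>" "\<forall>x. R < norm x \<longrightarrow> \<zeta> x = 0" for \<zeta> R
          unfolding M_def \<rho>_def
        proof (rule D[OF refl m(2) adm])
          show "CE (Suc ?m) (\<phi> t)" using m(1) by (intro CE_le[OF \<phi>CE]) simp
          show "CE (Suc ?m) \<zeta>" by (rule that)
          show "\<zeta> x = 0" if "R < norm x" for x using \<open>\<forall>x. R < norm x \<longrightarrow>
              \<zeta> x = 0\<close> that by blast
          show "(\<integral>y. green sys (x - y) * rho f t y \<partial>lborel) = \<phi> t x" for x
            by (rule has_bochner_integral_integral_eq[OF rep])
        qed
      qed
      have hm: "(\<lambda>z::'n phase. ennreal \<bar>ZXs (Trans k # \<gamma>) \<phi> t (fst z) * ?g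
          z\<bar>) \<in> borel_measurable lborel" for k
      proof -
        have [measurable]: "ZXs (Trans k # \<gamma>) \<phi> t \<in> borel_measurable borel"
          by (rule borel_measurable_continuous_onI[OF hc])
        show ?thesis by measurable
      qed
      have gr: "grad (ZXs \<gamma> \<phi>) t x $ k = ZXs (Trans k # \<gamma>) \<phi> t x" for x k
        by (simp add: grad_def ZXs_def)
      have "L1_xv (\<lambda>x v. norm (grad (ZXs \<gamma> \<phi>) t x) * Ys co \<alpha> f t x v)
          \<le> (\<integral>\<^sup>+z. (\<Sum>k\<in>UNIV. ennreal \<bar>ZXs (Trans k # \<gamma>) \<phi> t
              (fst z) * ?g z\<bar>) \<partial>lborel)"
        unfolding L1_xv_eq
      proof (rule nn_integral_mono)
        fix z :: "'n phase"
        have "norm (grad (ZXs \<gamma> \<phi>) t (fst z)) * \<bar>?g z\<bar> \<le> (\<Sum>k\<in>UNIV.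
            \<bar>grad (ZXs \<gamma> \<phi>) t (fst z) $ k\<bar>) * \<bar>?g z\<bar>"
          by (intro mult_right_mono norm_le_l1_cart) auto
        then have "\<bar>norm (grad (ZXs \<gamma> \<phi>) t (fst z)) * ?g z\<bar> \<le> (\<Sum>k\<in>UNIV.
            \<bar>ZXs (Trans k # \<gamma>) \<phi> t (fst z) * ?g z\<bar>)"
          by (simp add: gr abs_mult sum_distrib_right)
        then show "ennreal \<bar>norm (grad (ZXs \<gamma> \<phi>) t (fst z)) * Ys co \<alpha> f t (fst z)
            (snd z)\<bar>
            \<le> (\<Sum>k\<in>UNIV. ennreal \<bar>ZXs (Trans k # \<gamma>) \<phi> t (fst z) * ?g z\<bar>)"
          by (simp add: sum_ennreal ennreal_leI)
      qed
      also have "\<dots> = (\<Sum>k\<in>UNIV. \<integral>\<^sup>+z. ennreal \<bar>ZXs (Trans k # \<gamma>)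
          \<phi> t (fst z) * ?g z\<bar> \<partial>lborel)"
        by (rule nn_integral_sum) (rule hm)
      also have "\<dots> \<le> (\<Sum>k\<in>(UNIV::'n set). ennreal (D ?m) * (ennreal (812 * \<epsilon> /
          ?s\<^sup>2) * P))"
        by (intro sum_mono comp)
      also have "\<dots> = ennreal (n * (D ?m * 812)) * (ennreal (\<epsilon> / ?s\<^sup>2) * P)"
      proof -
        have "ennreal (812 * \<epsilon> / ?s\<^sup>2) = ennreal 812 * ennreal (\<epsilon> / ?s\<^sup>2)"
          using e0 by (subst ennreal_mult[symmetric]) auto
        moreover have "ennreal (n * (D ?m * 812)) = of_nat CARD('n) * (ennreal (D ?m) * ennreal 812)"
          using D0[of ?m] by (simp add: n_def ennreal_mult ennreal_of_nat_eq_real_of_nat)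
        ultimately show ?thesis by (simp add: mult.assoc)
      qed
      also have "\<dots> \<le> ennreal C * (ennreal (\<epsilon> / ?s\<^sup>2) * P)"
        using C(2)[OF m(1)] by (intro mult_right_mono ennreal_leI) auto
      also have "\<dots> = ennreal C * (\<Sum>\<beta>\<in>multi_indices (length \<gamma>). ennreal
          (\<epsilon> / (1 + t)\<^sup>2) * L1_x (rho (Zs \<beta> f) t))"
        by (simp add: P_def M_def \<rho>_def sum_distrib_left)
      finally show ?thesis .
    qed
  qed
qed

end
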